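(* Let $\beta_1$ be a number such that for all $\varphi\in\Phi$ (and all $q\in Q$) $$\alpha\left\|\frac{d\pi^0_q(\varphi)}{d\varphi^T}\right\|_1+(1-\alpha)\sum_{i=1}^{p_q}\left\|\frac{dp_i(\varphi)}{d\varphi^T}\right\|_1\le\beta_1.$$ Let $\delta_2>0$. Assume that, for every $q\in Q$, the vector $\tilde\pi_q(\varphi,N_1)$ is computed by the vector iteration of the context with $N_1=\left\lceil\frac1\alpha\ln\frac{24\beta_1r}{\alpha\delta_2}\right\rceil-1$, and the matrix $\tilde\Pi_q(\varphi,N_2)$ is computed by the matrix iteration of the context with $N_2=\left\lceil\frac1\alpha\ln\frac{8\beta_1r}{\alpha\delta_2}\right\rceil-1$. Then the vector $$\tilde g(\varphi,\delta_2)=\frac2{|Q|}\sum_{q=1}^{|Q|}\left(\tilde\Pi_q(\varphi,N_2)\right)^TA_q^T(A_q\tilde\pi_q(\varphi,N_1))_+$$ satisfies $$\|\tilde g(\varphi,\delta_2)-\nabla f(\varphi)\|_\infty\le\delta_2.$$ Moreover, the calculation of $\tilde g(\varphi,\delta_2)$ requires no more than $|Q|(10mps+3psN_1+3mpsN_2+7r)$ arithmetic operations and not more than $4ps+4mp+r$ memory items.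
   Context: $Q$ is a finite set of queries. For each $q\in Q$ there is a directed graph $\Gamma_q=(V_q,E_q)$, $p_q=|V_q|$, a seed set $U_q\subset V_q$, node features $\mathbf{V}^q_i\in\mathbb{R}^{m_1}_+$, edge features $\mathbf{E}^q_{ij}\in\mathbb{R}^{m_2}_+$. Parameters: $\varphi=(\varphi_1,\varphi_2)^T\in\mathbb{R}^m$, $m=m_1+m_2$, $\varphi_1\in\mathbb{R}^{m_1}$, $\varphi_2\in\mathbb{R}^{m_2}$; damping factor $\alpha\in(0,1)$. Restart probabilities: $[\pi^0_q(\varphi)]_i=\frac{\langle\varphi_1,\mathbf{V}^q_i\rangle}{\sum_{l\in U_q}\langle\varphi_1,\mathbf{V}^q_l\rangle}$ for $i\in U_q$ and $0$ otherwise. Transition matrix: $[P_q(\varphi)]_{i,j}=\frac{\langle\varphi_2,\mathbf{E}^q_{ij}\rangle}{\sum_{l:i\to l}\langle\varphi_2,\mathbf{E}^q_{il}\rangle}$ for $i\to j\in E_q$ (zero for non-edges) if $i$ has non-zero outdegree, and $[P_q(\varphi)]_{i,j}=[\pi^0_q(\varphi)]_j$ for all $j$ if the outdegree of $i$ is $0$. The denominators are assumed non-zero. $\pi_q(\varphi)\in\mathbb{R}^{p_q}$ is the stationary distribution, the solution of $\pi=\alpha\pi^0_q(\varphi)+(1-\alpha)P_q^T(\varphi)\pi$. $p_i(\varphi)$ is the $i$-th column of $P_q^T(\varphi)$. For each $q$ some nodes are grouped by relevance labels $1,\dots,\ell$; $V_q^j$ is the set of nodes with label $\ell+1-j$. $A_q\in\mathbb{R}^{r_q\times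 p_q}$, $r_q=\sum_{1\le j<l\le\ell}|V_q^j||V_q^l|$; each row corresponds to a pair $i_1\in V_q^j$, $i_2\in V_q^l$, $j<l$, with $i_1$-th entry $-1$, $i_2$-th entry $1$, other entries $0$. $f(\varphi)=\frac1{|Q|}\sum_{q=1}^{|Q|}\|(A_q\pi_q(\varphi))_+\|_2^2$, $[x_+]_i=\max\{x_i,0\}$; $\nabla f(\varphi)=\frac2{|Q|}\sum_q\left(\frac{d\pi_q(\varphi)}{d\varphi^T}\right)^TA_q^T(A_q\pi_q(\varphi))_+$. $\Phi=\{\varphi\in\mathbb{R}^m:\|\varphi-\hat\varphi\|_2\le R\}$ with $\hat\varphi$, $R>0$ such that $\Phi$ consists of vectors with positive components; $\varphi\in\Phi$. Notation: $p=\max_qp_q$, $r=\max_qr_q$, $s=\max_q\max_{i\in V_q}|\{j:i\to j\in E_q\}|$. For a matrix $A\in\mathbb{R}^{n_1\times n_2}$, $\|A\|_1=\max_j\sum_{i=1}^{n_1}|a_{ij}|$. Vector iteration: $\pi_0=\pi_q^0(\varphi)$, $\pi_{k+1}=P_q^T(\varphi)\pi_k$, $\tilde\pi_q(\varphi,N)=\frac\alpha{1-(1-\alpha)^{N+1}}\sum_{k=0}^N(1-\alpha)^k\pi_k$. Matrix iteration: $\Pi_0=\alpha\frac{d\pi_q^0(\varphi)}{d\varphi^T}+(1-\alpha)\sum_{i=1}^{p_q}\frac{dp_i(\varphi)}{d\varphi^T}[\tilde\pi_q(\varphi,N_1)]_i$, $\Pi_{k+1}=P_q^T(\varphi)\Pi_k$,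 $\tilde\Pi_q(\varphi,N_2)=\frac1{1-(1-\alpha)^{N_2+1}}\sum_{k=0}^{N_2}(1-\alpha)^k\Pi_k$.
   Formalization: The operation and memory bounds are claimed only for s ≥ 1 (for s = 0 the bound 7r|Q| is false) and say that some straight-line program computes g̃ within them, in any order of evaluation; a negative N₁ or N₂ is replaced by 0. *)

theory Defs
  imports "HOL-Analysis.Analysis"
begin

text \<open>The combinatorial part of an instance. A node without relevance label has label \<open>None\<close>.\<close>

record ('q, 'v) query_graphs =
  queries :: "'q set"
  nodes :: "'q \<Rightarrow> 'v set"
  edges :: "'q \<Rightarrow> ('v \<times> 'v) set"
  seeds :: "'q \<Rightarrow> 'v set"
  labels :: "'q \<Rightarrow> 'v \<Rightarrow> nat option"
  num_labels :: nat

definition wf_query_graphs :: "('q, 'v) query_graphs \<Rightarrow> bool" where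
  "wf_query_graphs G \<longleftrightarrow>
     finite (queries G) \<and> queries G \<noteq> {} \<and>
     (\<forall>q\<in>queries G.
        finite (nodes G q) \<and> edges G q \<subseteq> nodes G q \<times> nodes G q \<and> seeds G q \<subseteq> nodes G q \<and>
        dom (labels G q) \<subseteq> nodes G q \<and> ran (labels G q) \<subseteq> {1..num_labels G})"

definition out_nbrs :: "('q, 'v) query_graphs \<Rightarrow> 'q \<Rightarrow> 'v \<Rightarrow> 'v set" where
  "out_nbrs G q i = {j. (i, j) \<in> edges G q}"

definition label_class :: "('q, 'v) query_graphs \<Rightarrow> 'q \<Rightarrow> nat \<Rightarrow> 'v set" where
  "label_class G q j = {i \<in> nodes G q. labels G q i = Some (num_labels G + 1 - j)}"

definition class_pairs :: "('q, 'v) query_graphs \<Rightarrow> (nat \<times> nat) set" where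
  "class_pairs G = {(j, l). 1 \<le> j \<and> j < l \<and> l \<le> num_labels G}"

definition num_rows :: "('q, 'v) query_graphs \<Rightarrow> 'q \<Rightarrow> nat" where
  "num_rows G q = (\<Sum>(j, l)\<in>class_pairs G. card (label_class G q j) * card (label_class G q l))"

text \<open>The rows of \<open>A\<^sub>q\<close> are indexed by the pairs of nodes they belong to.\<close>

definition row_pairs :: "('q, 'v) query_graphs \<Rightarrow> 'q \<Rightarrow> ('v \<times> 'v) set" where
  "row_pairs G q = (\<Union>(j, l)\<in>class_pairs G. label_class G q j \<times> label_class G q l)"

definition pair_matrix :: "'v \<times> 'v \<Rightarrow> 'v \<Rightarrow> real" where
  "pair_matrix \<rho> i = (if i = fst \<rho> then -1 else if i = snd \<rho> then 1 else 0)"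

definition max_nodes :: "('q, 'v) query_graphs \<Rightarrow> nat" where
  "max_nodes G = (MAX q\<in>queries G. card (nodes G q))"

definition max_rows :: "('q, 'v) query_graphs \<Rightarrow> nat" where
  "max_rows G = (MAX q\<in>queries G. num_rows G q)"

definition max_outdegree :: "('q, 'v) query_graphs \<Rightarrow> nat" where
  "max_outdegree G = (MAX q\<in>queries G. MAX i\<in>nodes G q. card (out_nbrs G q i))"

text \<open>A parameter is a pair \<open>(\<phi>\<^sub>1, \<phi>\<^sub>2)\<close>; the norm of the product type is the Euclidean norm of
  the concatenated vector.\<close>

type_synonym ('m1, 'm2) param = "(real ^ 'm1) \<times> (real ^ 'm2)"

definition coord :: "('m1::finite, 'm2::finite) param \<Rightarrow> 'm1 + 'm2 \<Rightarrow> real" where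
  "coord \<phi> k = (case k of Inl a \<Rightarrow> fst \<phi> $ a | Inr a \<Rightarrow> snd \<phi> $ a)"

record ('q, 'v, 'm1, 'm2) features =
  node_feat :: "'q \<Rightarrow> 'v \<Rightarrow> real ^ 'm1"
  edge_feat :: "'q \<Rightarrow> 'v \<Rightarrow> 'v \<Rightarrow> real ^ 'm2"

definition nonneg_features ::
  "('q, 'v) query_graphs \<Rightarrow> ('q, 'v, 'm1::finite, 'm2::finite) features \<Rightarrow> bool" where
  "nonneg_features G F \<longleftrightarrow>
     (\<forall>q\<in>queries G. (\<forall>i\<in>nodes G q. \<forall>k. 0 \<le> node_feat F q i $ k) \<and>
                     (\<forall>(i, j)\<in>edges G q. \<forall>k. 0 \<le> edge_feat F q i j $ k))"

definition nonzero_denominators ::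
  "('q, 'v) query_graphs \<Rightarrow> ('q, 'v, 'm1::finite, 'm2::finite) features \<Rightarrow> ('m1, 'm2) param \<Rightarrow> bool"
  where
  "nonzero_denominators G F \<phi> \<longleftrightarrow>
     (\<forall>q\<in>queries G. (\<Sum>l\<in>seeds G q. fst \<phi> \<bullet> node_feat F q l) \<noteq> 0 \<and>
        (\<forall>i\<in>nodes G q. out_nbrs G q i \<noteq> {} \<longrightarrow>
           (\<Sum>l\<in>out_nbrs G q i. snd \<phi> \<bullet> edge_feat F q i l) \<noteq> 0))"

definition restart ::
  "('q, 'v) query_graphs \<Rightarrow> ('q, 'v, 'm1::finite, 'm2::finite) features \<Rightarrow> 'q \<Rightarrow>
   ('m1, 'm2) param \<Rightarrow> 'v \<Rightarrow> real" where
  "restart G F q \<phi> i =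
     (if i \<in> seeds G q
      then (fst \<phi> \<bullet> node_feat F q i) / (\<Sum>l\<in>seeds G q. fst \<phi> \<bullet> node_feat F q l) else 0)"

definition transition ::
  "('q, 'v) query_graphs \<Rightarrow> ('q, 'v, 'm1::finite, 'm2::finite) features \<Rightarrow> 'q \<Rightarrow>
   ('m1, 'm2) param \<Rightarrow> 'v \<Rightarrow> 'v \<Rightarrow> real" where
  "transition G F q \<phi> i j =
     (if out_nbrs G q i = {} then restart G F q \<phi> j
      else if (i, j) \<in> edges G q
      then (snd \<phi> \<bullet> edge_feat F q i j) / (\<Sum>l\<in>out_nbrs G q i. snd \<phi> \<bullet> edge_feat F q i l)
      else 0)"

text \<open>A vector indexed by the nodes of query \<open>q\<close> is a total function; fixing its value outside
  \<open>nodes G q\<close> to \<open>0\<close> makes the solution unique.\<close>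

definition stationary ::
  "('q, 'v) query_graphs \<Rightarrow> ('q, 'v, 'm1::finite, 'm2::finite) features \<Rightarrow> real \<Rightarrow> 'q \<Rightarrow>
   ('m1, 'm2) param \<Rightarrow> 'v \<Rightarrow> real" where
  "stationary G F \<alpha> q \<phi> =
     (THE x. (\<forall>i\<in>nodes G q. x i = \<alpha> * restart G F q \<phi> i +
                 (1 - \<alpha>) * (\<Sum>j\<in>nodes G q. transition G F q \<phi> j i * x j)) \<and>
             (\<forall>i. i \<notin> nodes G q \<longrightarrow> x i = 0))"

definition pos_part :: "real \<Rightarrow> real" where
  "pos_part x = max x 0"

definition ranking_residual :: "('q, 'v) query_graphs \<Rightarrow> 'q \<Rightarrow> ('v \<Rightarrow> real) \<Rightarrow> 'v \<times> 'v \<Rightarrow> real" where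
  "ranking_residual G q x \<rho> = pos_part (\<Sum>i\<in>nodes G q. pair_matrix \<rho> i * x i)"

definition loss ::
  "('q, 'v) query_graphs \<Rightarrow> ('q, 'v, 'm1::finite, 'm2::finite) features \<Rightarrow> real \<Rightarrow>
   ('m1, 'm2) param \<Rightarrow> real" where
  "loss G F \<alpha> \<phi> = 1 / real (card (queries G)) *
     (\<Sum>q\<in>queries G. (L2_set (ranking_residual G q (stationary G F \<alpha> q \<phi>)) (row_pairs G q))\<^sup>2)"

definition gradient :: "('a::euclidean_space \<Rightarrow> real) \<Rightarrow> 'a \<Rightarrow> 'a" where
  "gradient f x = (THE D. GDERIV f x :> D)"

text \<open>The columns of a Jacobian \<open>dF/d\<phi>\<^sup>T\<close> are indexed by the standard basis vectors.\<close>

definition param_jacobian :: "('a::euclidean_space \<Rightarrow> 'v \<Rightarrow> real) \<Rightarrow> 'a \<Rightarrow> 'v \<Rightarrow> 'a \<Rightarrow> real" where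
  "param_jacobian F x i b = frechet_derivative (\<lambda>y. F y i) (at x) b"

definition matrix_norm1 :: "'r set \<Rightarrow> 'c set \<Rightarrow> ('r \<Rightarrow> 'c \<Rightarrow> real) \<Rightarrow> real" where
  "matrix_norm1 I J M = (MAX j\<in>J. \<Sum>i\<in>I. \<bar>M i j\<bar>)"

primrec vec_iter ::
  "('q, 'v) query_graphs \<Rightarrow> ('q, 'v, 'm1::finite, 'm2::finite) features \<Rightarrow> 'q \<Rightarrow>
   ('m1, 'm2) param \<Rightarrow> nat \<Rightarrow> 'v \<Rightarrow> real" where
  "vec_iter G F q \<phi> 0 = restart G F q \<phi>"
| "vec_iter G F q \<phi> (Suc k) =
     (\<lambda>i. \<Sum>j\<in>nodes G q. transition G F q \<phi> j i * vec_iter G F q \<phi> k j)"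

definition vec_approx ::
  "('q, 'v) query_graphs \<Rightarrow> ('q, 'v, 'm1::finite, 'm2::finite) features \<Rightarrow> real \<Rightarrow> 'q \<Rightarrow>
   ('m1, 'm2) param \<Rightarrow> nat \<Rightarrow> 'v \<Rightarrow> real" where
  "vec_approx G F \<alpha> q \<phi> N i =
     \<alpha> / (1 - (1 - \<alpha>) ^ (N + 1)) * (\<Sum>k=0..N. (1 - \<alpha>) ^ k * vec_iter G F q \<phi> k i)"

text \<open>\<open>p\<^sub>l(\<phi>)\<close>, the \<open>l\<close>-th column of the transposed transition matrix, is
  \<open>transition G F q \<phi> l\<close>.\<close>

primrec mat_iter ::
  "('q, 'v) query_graphs \<Rightarrow> ('q, 'v, 'm1::finite, 'm2::finite) features \<Rightarrow> real \<Rightarrow> 'q \<Rightarrow>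
   ('m1, 'm2) param \<Rightarrow> nat \<Rightarrow> nat \<Rightarrow> 'v \<Rightarrow> ('m1, 'm2) param \<Rightarrow> real" where
  "mat_iter G F \<alpha> q \<phi> N1 0 =
     (\<lambda>i b. \<alpha> * param_jacobian (restart G F q) \<phi> i b + (1 - \<alpha>) *
        (\<Sum>l\<in>nodes G q. param_jacobian (\<lambda>\<psi>. transition G F q \<psi> l) \<phi> i b * vec_approx G F \<alpha> q \<phi> N1 l))"
| "mat_iter G F \<alpha> q \<phi> N1 (Suc k) =
     (\<lambda>i b. \<Sum>j\<in>nodes G q. transition G F q \<phi> j i * mat_iter G F \<alpha> q \<phi> N1 k j b)"

definition mat_approx ::
  "('q, 'v) query_graphs \<Rightarrow> ('q, 'v, 'm1::finite, 'm2::finite) features \<Rightarrow> real \<Rightarrow> 'q \<Rightarrow>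
   ('m1, 'm2) param \<Rightarrow> nat \<Rightarrow> nat \<Rightarrow> 'v \<Rightarrow> ('m1, 'm2) param \<Rightarrow> real" where
  "mat_approx G F \<alpha> q \<phi> N1 N2 i b =
     1 / (1 - (1 - \<alpha>) ^ (N2 + 1)) * (\<Sum>k=0..N2. (1 - \<alpha>) ^ k * mat_iter G F \<alpha> q \<phi> N1 k i b)"

definition approx_gradient ::
  "('q, 'v) query_graphs \<Rightarrow> ('q, 'v, 'm1::finite, 'm2::finite) features \<Rightarrow> real \<Rightarrow>
   ('m1, 'm2) param \<Rightarrow> nat \<Rightarrow> nat \<Rightarrow> ('m1, 'm2) param" where
  "approx_gradient G F \<alpha> \<phi> N1 N2 =
     (2 / real (card (queries G))) *\<^sub>R
     (\<Sum>q\<in>queries G. \<Sum>b\<in>Basis.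
        (\<Sum>i\<in>nodes G q. mat_approx G F \<alpha> q \<phi> N1 N2 i b *
           (\<Sum>\<rho>\<in>row_pairs G q.
              pair_matrix \<rho> i * ranking_residual G q (vec_approx G F \<alpha> q \<phi> N1) \<rho>)) *\<^sub>R b)"

text \<open>
  The cost model is that of straight-line programs over the reals, with exact arithmetic. The
  input is read-only and not part of the working memory; registers hold one real number each.
  Every application of \<open>+\<close>, \<open>-\<close>, \<open>*\<close>, \<open>/\<close>, \<open>max\<close> is one arithmetic
  operation; moving a number (or an integer constant) into a register is none. Division by
  zero aborts the run. There is no branching, and no need for it: the control flow of the iterations
  is determined by the graphs and the numbers of iterations.
\<close>

datatype 'i operand = Reg nat | Inp 'i | Const int

datatype arith_op = Add | Sub | Mul | Div | Maximum

datatype 'i instr = Move nat "'i operand" | Arith nat arith_op "'i operand" "'i operand"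

primrec operand_val :: "('i \<Rightarrow> real) \<Rightarrow> (nat \<Rightarrow> real) \<Rightarrow> 'i operand \<Rightarrow> real" where
  "operand_val inp mem (Reg a) = mem a"
| "operand_val inp mem (Inp i) = inp i"
| "operand_val inp mem (Const c) = of_int c"

primrec apply_op :: "arith_op \<Rightarrow> real \<Rightarrow> real \<Rightarrow> real option" where
  "apply_op Add x y = Some (x + y)"
| "apply_op Sub x y = Some (x - y)"
| "apply_op Mul x y = Some (x * y)"
| "apply_op Div x y = (if y = 0 then None else Some (x / y))"
| "apply_op Maximum x y = Some (max x y)"

primrec exec_instr :: "('i \<Rightarrow> real) \<Rightarrow> 'i instr \<Rightarrow> (nat \<Rightarrow> real) \<Rightarrow> (nat \<Rightarrow> real) option" where
  "exec_instr inp (Move a x) mem = Some (mem(a := operand_val inp mem x))"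
| "exec_instr inp (Arith a f x y) mem =
     map_option (\<lambda>v. mem(a := v)) (apply_op f (operand_val inp mem x) (operand_val inp mem y))"

primrec exec :: "('i \<Rightarrow> real) \<Rightarrow> 'i instr list \<Rightarrow> (nat \<Rightarrow> real) \<Rightarrow> (nat \<Rightarrow> real) option" where
  "exec inp [] mem = Some mem"
| "exec inp (c # cs) mem = Option.bind (exec_instr inp c mem) (exec inp cs)"

primrec is_arith :: "'i instr \<Rightarrow> bool" where
  "is_arith (Move a x) = False"
| "is_arith (Arith a f x y) = True"

definition arith_ops :: "'i instr list \<Rightarrow> nat" where
  "arith_ops cs = length (filter is_arith cs)"

primrec operand_regs :: "'i operand \<Rightarrow> nat set" where
  "operand_regs (Reg a) = {a}"
| "operand_regs (Inp i) = {}"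
| "operand_regs (Const c) = {}"

primrec instr_regs :: "'i instr \<Rightarrow> nat set" where
  "instr_regs (Move a x) = insert a (operand_regs x)"
| "instr_regs (Arith a f x y) = insert a (operand_regs x \<union> operand_regs y)"

text \<open>
  \<open>computable_within n_ops n_mem D inp out\<close>: a single program with at most \<open>n_ops\<close>
  arithmetic operations and \<open>n_mem\<close> registers, initialised arbitrarily, computes the vector
  \<open>out d\<close> from the input \<open>inp d\<close>, for all \<open>d \<in> D\<close>. The result is left
  in registers, which count as memory.
\<close>

definition computable_within ::
  "nat \<Rightarrow> nat \<Rightarrow> 'd set \<Rightarrow> ('d \<Rightarrow> 'i \<Rightarrow> real) \<Rightarrow> ('d \<Rightarrow> 'o \<Rightarrow> real) \<Rightarrow> bool" where
  "computable_within n_ops n_mem D inp out \<longleftrightarrow>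
     (\<exists>prog addr. arith_ops prog \<le> n_ops \<and>
        (\<Union>c\<in>set prog. instr_regs c) \<union> range addr \<subseteq> {..<n_mem} \<and> inj addr \<and>
        (\<forall>d\<in>D. \<forall>mem. \<exists>mem'. exec (inp d) prog mem = Some mem' \<and> (\<forall>k. mem' (addr k) = out d k)))"

datatype ('q, 'v, 'm1, 'm2) input =
    In_damping
  | In_param "'m1 + 'm2"
  | In_node_feat 'q 'v 'm1
  | In_edge_feat 'q 'v 'v 'm2

text \<open>The numerical data of the problem, for fixed graphs: features, parameter, damping factor.\<close>

type_synonym ('q, 'v, 'm1, 'm2) num_data =
  "('q, 'v, 'm1, 'm2) features \<times> ('m1, 'm2) param \<times> real"

definition admissible_data ::
  "('q, 'v) query_graphs \<Rightarrow> ('q, 'v, 'm1::finite, 'm2::finite) num_data set" where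
  "admissible_data G =
     {(F, \<phi>, \<alpha>). nonneg_features G F \<and> (\<forall>k. 0 < coord \<phi> k) \<and> nonzero_denominators G F \<phi> \<and>
                 0 < \<alpha> \<and> \<alpha> < 1}"

fun data_input ::
  "('q, 'v, 'm1::finite, 'm2::finite) num_data \<Rightarrow> ('q, 'v, 'm1, 'm2) input \<Rightarrow> real" where
  "data_input (F, \<phi>, \<alpha>) In_damping = \<alpha>"
| "data_input (F, \<phi>, \<alpha>) (In_param k) = coord \<phi> k"
| "data_input (F, \<phi>, \<alpha>) (In_node_feat q i k) = node_feat F q i $ k"
| "data_input (F, \<phi>, \<alpha>) (In_edge_feat q i j k) = edge_feat F q i j $ k"

end

theory Submission
  imports Defs
begin

text \<open>
  Both the stationary vector and its derivative are fixed points \<open>x = b + (1 - \<alpha>) P\<^sup>T x\<close>, and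
  \<open>P\<^sup>T\<close> does not increase the 1-norm; hence every such \<open>x\<close> has norm at most \<open>\<parallel>b\<parallel>\<^sub>1 / \<alpha>\<close>, and a
  normalised partial sum of its Neumann series misses it by at most \<open>2 (1 - \<alpha>)\<^bsup>N + 1\<^esup> \<parallel>b\<parallel>\<^sub>1 / \<alpha>\<close>.
  These two facts give the error bound.

  For the cost bound the matrix iteration is never executed. By duality, the product of the transposed
  matrix approximation with a vector \<open>h\<close> is obtained from the iteration \<open>z \<mapsto> h + (1 - \<alpha>) P z\<close> on
  single vectors. The quotient rule writes the derivative of a row of \<open>P\<close> through differences \<open>z\<^sub>j - (P z)\<^sub>l\<close>, so that after the iteration each
  feature costs only two further operations, and nodes with a single outgoing edge cost none.
\<close>

section \<open>Discounted chains\<close>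

text \<open>\<open>gradient\<close> is a definite description, so the loss must first be proved
  differentiable: the derivative of the stationary vector is built as another fixed point, and
  squaring makes the kink of the positive part harmless. The source of that fixed point contains the
  stationary vector, so the vector error enters twice, through this source and through the residual.
  With the truncated matrix series this gives 2 c2 + 4 c1, where c1 and c2 are the tails (1 -
  \<alpha>)^(N + 1). The constants 8 and 24 reduce the two parts to 1/4 and 1/6 of \<delta>,
  together less than the 1/2 that the factor 2 / |Q| permits.

  The program yields the approximate gradient exactly, so error and cost are independent matters.
  The obstacle for the cost is the case s = 1, which leaves little slack. Hence 1 - \<alpha> is
  stored inside the matrix and the restart vector, all dangling nodes share one scalar because their
  rows coincide, and normalising the vector is postponed: the residual is positively homogeneous, so
  the normaliser becomes a scalar in the final factor.\<close>

definition push :: "'v set \<Rightarrow> ('v \<Rightarrow> 'v \<Rightarrow> real) \<Rightarrow> ('v \<Rightarrow> real) \<Rightarrow> 'v \<Rightarrow> real" where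
  "push V P x i = (\<Sum>j\<in>V. P j i * x j)"

text \<open>\<open>push V P\<close> is the operator P^T on vectors over \<open>V\<close>; with the
  swapped matrix \<open>\<lambda>j i. P i j\<close> it becomes P. The sum is an unnormalised partial
  sum of the Neumann series for the inverse of I - (1 - \<alpha>) P^T.\<close>

definition trunc_series :: "real \<Rightarrow> 'v set \<Rightarrow> ('v \<Rightarrow> 'v \<Rightarrow> real) \<Rightarrow> nat \<Rightarrow> ('v \<Rightarrow> real) \<Rightarrow> 'v \<Rightarrow> real" where
  "trunc_series \<alpha> V P N x i = (\<Sum>k=0..N. (1 - \<alpha>) ^ k * (push V P ^^ k) x i)"

definition l1_norm :: "'v set \<Rightarrow> ('v \<Rightarrow> real) \<Rightarrow> real" where
  "l1_norm V x = (\<Sum>i\<in>V. \<bar>x i\<bar>)"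

lemma l1_norm_nonneg: "0 \<le> l1_norm V x"
  by (simp add: l1_norm_def sum_nonneg)

lemma abs_le_l1_norm: "finite V \<Longrightarrow> i \<in> V \<Longrightarrow> \<bar>x i\<bar> \<le> l1_norm V x"
  unfolding l1_norm_def by (rule member_le_sum) auto

lemma l1_norm_triangle: "l1_norm V (\<lambda>i. x i + y i) \<le> l1_norm V x + l1_norm V y"
  by (simp add: l1_norm_def sum.distrib[symmetric] sum_mono abs_triangle_ineq)

lemma l1_norm_scale: "l1_norm V (\<lambda>i. c * x i) = \<bar>c\<bar> * l1_norm V x"
  by (simp add: l1_norm_def abs_mult sum_distrib_left)

lemma l1_norm_cong: "(\<And>i. i \<in> V \<Longrightarrow> x i = y i) \<Longrightarrow> l1_norm V x = l1_norm V y"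
  by (simp add: l1_norm_def)

lemma l1_norm_sum: "l1_norm V (\<lambda>i. \<Sum>k\<in>K. x k i) \<le> (\<Sum>k\<in>K. l1_norm V (x k))"
  unfolding l1_norm_def by (subst sum.swap) (intro sum_mono sum_abs)

lemma push_cong: "(\<And>j. j \<in> V \<Longrightarrow> x j = y j) \<Longrightarrow> push V P x = push V P y"
  by (auto simp: push_def fun_eq_iff intro!: sum.cong)

lemma push_add: "push V P (\<lambda>i. x i + y i) = (\<lambda>i. push V P x i + push V P y i)"
  by (simp add: push_def fun_eq_iff distrib_left sum.distrib)

lemma push_scale: "push V P (\<lambda>i. c * x i) = (\<lambda>i. c * push V P x i)"
  by (simp add: push_def fun_eq_iff sum_distrib_left mult.left_commute)

lemma push_pow_cong:
  assumes "\<And>j. j \<in> V \<Longrightarrow> x j = y j" "i \<in> V"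
  shows "(push V P ^^ k) x i = (push V P ^^ k) y i"
proof (cases k)
  case 0
  then show ?thesis using assms by simp
next
  case (Suc n)
  then show ?thesis
    using push_cong[OF assms(1), where P = P] by (simp only: Suc funpow_Suc_right comp_apply)
qed

lemma push_pow_add: "(push V P ^^ k) (\<lambda>i. x i + y i) = (\<lambda>i. (push V P ^^ k) x i + (push V P ^^ k) y i)"
  by (induction k) (simp_all add: push_add)

lemma push_pow_scale: "(push V P ^^ k) (\<lambda>i. c * x i) = (\<lambda>i. c * (push V P ^^ k) x i)"
  by (induction k) (simp_all add: push_scale)

text \<open>Horner's rule. A program can obtain the partial sum by iterating one affine map, without
  a separate accumulator and without powers of 1 - \<alpha>.\<close>

lemma trunc_series_Suc:
  "trunc_series \<alpha> V P (Suc N) x i = x i + (1 - \<alpha>) * push V P (trunc_series \<alpha> V P N x) i"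
proof -
  have "trunc_series \<alpha> V P (Suc N) x i = x i + (\<Sum>k=0..N. (1 - \<alpha>) ^ Suc k * (push V P ^^ Suc k) x i)"
    unfolding trunc_series_def
    by (subst sum.atLeast0_atMost_Suc_shift) (simp only: o_def funpow_0 power_0 mult_1)
  also have "(\<Sum>k=0..N. (1 - \<alpha>) ^ Suc k * (push V P ^^ Suc k) x i) =
      (1 - \<alpha>) * push V P (trunc_series \<alpha> V P N x) i"
    unfolding trunc_series_def push_def
    by (simp add: push_def sum_distrib_left mult_ac) (rule sum.swap)
  finally show ?thesis .
qed

section \<open>Fixed points of discounted stochastic matrices\<close>

locale discounted_chain =
  fixes V :: "'v set" and P :: "'v \<Rightarrow> 'v \<Rightarrow> real" and \<alpha> :: real
  assumes finite_V: "finite V"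
    and P_nonneg: "\<And>j i. j \<in> V \<Longrightarrow> i \<in> V \<Longrightarrow> 0 \<le> P j i"
    and P_sum: "\<And>j. j \<in> V \<Longrightarrow> (\<Sum>i\<in>V. P j i) = 1"
    and \<alpha>: "0 < \<alpha>" "\<alpha> < 1"
begin

lemma l1_norm_push: "l1_norm V (push V P x) \<le> l1_norm V x"
proof -
  have "l1_norm V (push V P x) \<le> (\<Sum>i\<in>V. \<Sum>j\<in>V. P j i * \<bar>x j\<bar>)"
    unfolding l1_norm_def push_def
    by (intro sum_mono order_trans[OF sum_abs]) (simp add: abs_mult P_nonneg)
  also have "\<dots> = (\<Sum>j\<in>V. (\<Sum>i\<in>V. P j i) * \<bar>x j\<bar>)"
    by (subst sum.swap) (simp add: sum_distrib_right)
  also have "\<dots> = l1_norm V x" by (simp add: P_sum l1_norm_def)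
  finally show ?thesis .
qed

lemma l1_norm_push_pow: "l1_norm V ((push V P ^^ k) x) \<le> l1_norm V x"
  by (induction k) (auto intro: order_trans[OF l1_norm_push])

lemma sum_push_pow: "(\<Sum>i\<in>V. (push V P ^^ k) x i) = (\<Sum>i\<in>V. x i)"
proof (induction k)
  case (Suc k)
  have "(\<Sum>i\<in>V. (push V P ^^ Suc k) x i) = (\<Sum>j\<in>V. (\<Sum>i\<in>V. P j i) * (push V P ^^ k) x j)"
    by (simp add: push_def sum_distrib_right) (rule sum.swap)
  then show ?case using Suc by (simp add: P_sum)
qed simp

lemma push_pow_nonneg:
  assumes "\<And>i. i \<in> V \<Longrightarrow> 0 \<le> x i" "i \<in> V"
  shows "0 \<le> (push V P ^^ k) x i"
  using assms(2)
  by (induction k arbitrary: i) (auto simp: push_def assms P_nonneg intro!: sum_nonneg mult_nonneg_nonneg)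

lemma geometric: "(\<Sum>k=0..N. (1 - \<alpha>) ^ k) = (1 - (1 - \<alpha>) ^ (N + 1)) / \<alpha>"
  using \<alpha> by (simp add: sum_gp0 atLeast0AtMost)

lemma pow_less_1: "(1 - \<alpha>) ^ (N + 1) < 1" "0 < (1 - \<alpha>) ^ N"
  using \<alpha> power_less_one_iff[of "1 - \<alpha>" "N+1"] by auto

text \<open>P^T conserves the total of a vector, so only the geometric weights remain. Read
  backwards, the total of a computed partial sum reveals the normaliser 1 - (1 - \<alpha>)^(N + 1)
  without any power being computed.\<close>

lemma sum_trunc_series:
  "(\<Sum>i\<in>V. trunc_series \<alpha> V P N x i) = (1 - (1 - \<alpha>) ^ (N + 1)) / \<alpha> * (\<Sum>i\<in>V. x i)"
proof -
  have "(\<Sum>i\<in>V. trunc_series \<alpha> V P N x i) =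
      (\<Sum>k=0..N. (1 - \<alpha>) ^ k * (\<Sum>i\<in>V. (push V P ^^ k) x i))"
    unfolding trunc_series_def sum_distrib_left by (rule sum.swap)
  then show ?thesis
    unfolding sum_push_pow by (simp only: sum_distrib_right[symmetric] geometric)
qed

lemma l1_norm_trunc_series:
  "l1_norm V (trunc_series \<alpha> V P N x) \<le> (1 - (1 - \<alpha>) ^ (N + 1)) / \<alpha> * l1_norm V x"
proof -
  have "l1_norm V (trunc_series \<alpha> V P N x) \<le>
      (\<Sum>k=0..N. (1 - \<alpha>) ^ k * l1_norm V ((push V P ^^ k) x))"
    unfolding trunc_series_def
    using \<alpha> by (intro order_trans[OF l1_norm_sum]) (simp add: l1_norm_scale)
  also have "\<dots> \<le> (\<Sum>k=0..N. (1 - \<alpha>) ^ k * l1_norm V x)"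
    using \<alpha> by (intro sum_mono mult_left_mono l1_norm_push_pow) auto
  also have "\<dots> = (1 - (1 - \<alpha>) ^ (N + 1)) / \<alpha> * l1_norm V x"
    by (simp only: sum_distrib_right[symmetric] geometric)
  finally show ?thesis .
qed

text \<open>The Neumann series converges entrywise, dominated by a geometric series with the 1-norm
  of \<open>b\<close> as constant. The value 0 outside \<open>V\<close> is the convention made in
  \<open>stationary\<close>.\<close>

lemma fixpoint_ex: "\<exists>x. (\<forall>i\<in>V. x i = b i + (1 - \<alpha>) * push V P x i) \<and> (\<forall>i. i \<notin> V \<longrightarrow> x i = 0)"
proof -
  define f where "f i k = (1 - \<alpha>) ^ k * (push V P ^^ k) b i" for i k
  have summ: "summable (f i)" if "i \<in> V" for i
  proof (rule summable_comparison_test')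
    show "summable (\<lambda>k. l1_norm V b * (1 - \<alpha>) ^ k)"
      using \<alpha> by (intro summable_mult summable_geometric) auto
    fix k
    have "\<bar>(push V P ^^ k) b i\<bar> \<le> l1_norm V b"
      using abs_le_l1_norm[OF finite_V that] l1_norm_push_pow order_trans by blast
    then show "norm (f i k) \<le> l1_norm V b * (1 - \<alpha>) ^ k"
      using \<alpha> by (simp add: f_def abs_mult mult.commute mult_left_mono)
  qed
  have f_Suc: "f i (Suc k) = (1 - \<alpha>) * (\<Sum>j\<in>V. P j i * f j k)" for i k
    by (simp add: f_def push_def sum_distrib_left mult_ac)
  have f0: "f i 0 = b i" for i by (simp add: f_def)
  define x where "x i = (if i \<in> V then suminf (f i) else 0)" for i
  have "x i = b i + (1 - \<alpha>) * push V P x i" if "i \<in> V" for i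
  proof -
    have "suminf (f i) = f i 0 + (\<Sum>k. f i (Suc k))"
      using suminf_split_head[OF summ[OF that]] by simp
    also have "(\<Sum>k. f i (Suc k)) = (1 - \<alpha>) * (\<Sum>k. \<Sum>j\<in>V. P j i * f j k)"
      unfolding f_Suc by (intro suminf_mult summable_sum summable_mult summ)
    also have "(\<Sum>k. \<Sum>j\<in>V. P j i * f j k) = (\<Sum>j\<in>V. \<Sum>k. P j i * f j k)"
      by (intro suminf_sum summable_mult summ)
    also have "\<dots> = (\<Sum>j\<in>V. P j i * suminf (f j))"
      by (intro sum.cong refl suminf_mult summ)
    finally show ?thesis using that by (simp add: x_def push_def f0)
  qed
  then show ?thesis by (intro exI[of _ x]) (auto simp: x_def)
qed

text \<open>Take norms in the equation and absorb (1 - \<alpha>) times the norm of \<open>x\<close>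
  on the left. Applied to differences this gives uniqueness, applied to remainders
  differentiability; for the latter it matters that 1 / \<alpha> does not depend on
  \<open>P\<close>.\<close>

lemma fixpoint_bound:
  assumes "\<And>i. i \<in> V \<Longrightarrow> x i = b i + (1 - \<alpha>) * push V P x i"
  shows "l1_norm V x \<le> l1_norm V b / \<alpha>"
proof -
  have "l1_norm V x = l1_norm V (\<lambda>i. b i + (1 - \<alpha>) * push V P x i)"
    by (rule l1_norm_cong) (rule assms)
  also have "\<dots> \<le> l1_norm V b + (1 - \<alpha>) * l1_norm V (push V P x)"
    using \<alpha> l1_norm_triangle[of V b "\<lambda>i. (1 - \<alpha>) * push V P x i"] by (simp add: l1_norm_scale)
  also have "\<dots> \<le> l1_norm V b + (1 - \<alpha>) * l1_norm V x"
    using \<alpha> by (intro add_left_mono mult_left_mono l1_norm_push) auto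
  finally show ?thesis using \<alpha> by (simp add: field_simps)
qed

lemma fixpoint_unique:
  assumes "\<And>i. i \<in> V \<Longrightarrow> x i = b i + (1 - \<alpha>) * push V P x i"
    and "\<And>i. i \<in> V \<Longrightarrow> y i = b i + (1 - \<alpha>) * push V P y i" and "i \<in> V"
  shows "x i = y i"
proof -
  let ?d = "\<lambda>i. x i + (-1) * y i"
  have "l1_norm V ?d \<le> l1_norm V (\<lambda>_. 0) / \<alpha>"
  proof (rule fixpoint_bound)
    fix i assume i: "i \<in> V"
    show "?d i = 0 + (1 - \<alpha>) * push V P ?d i"
      unfolding push_add push_scale using assms(1)[OF i] assms(2)[OF i] by (simp add: algebra_simps)
  qed
  then have "l1_norm V ?d \<le> 0" by (simp add: l1_norm_def)
  with abs_le_l1_norm[OF finite_V \<open>i \<in> V\<close>, of ?d] show ?thesis by simp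
qed

text \<open>Each induction step substitutes the equation once into the remainder term. The remainder
  keeps the full solution, whose norm \<open>fixpoint_bound\<close> controls.\<close>

lemma fixpoint_expand:
  assumes "\<And>i. i \<in> V \<Longrightarrow> x i = b i + (1 - \<alpha>) * push V P x i" and "i \<in> V"
  shows "x i = trunc_series \<alpha> V P N b i + (1 - \<alpha>) ^ (N + 1) * (push V P ^^ (N + 1)) x i"
proof (induction N)
  case 0
  then show ?case using assms by (simp add: trunc_series_def)
next
  case (Suc N)
  have "(push V P ^^ (N + 1)) x i = (push V P ^^ (N + 1)) (\<lambda>i. b i + (1 - \<alpha>) * push V P x i) i"
    by (rule push_pow_cong) (use assms in auto)
  also have "\<dots> = (push V P ^^ (N + 1)) b i + (1 - \<alpha>) * (push V P ^^ (N + 2)) x i"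
    by (simp add: push_pow_add push_pow_scale push_add push_scale funpow_swap1)
  finally have "x i = trunc_series \<alpha> V P N b i + (1 - \<alpha>) ^ (N + 1) *
      ((push V P ^^ (N + 1)) b i + (1 - \<alpha>) * (push V P ^^ (N + 2)) x i)"
    using Suc.IH by simp
  also have "\<dots> = trunc_series \<alpha> V P N b i + (1 - \<alpha>) ^ (N + 1) * (push V P ^^ (N + 1)) b i +
      (1 - \<alpha>) ^ (N + 2) * (push V P ^^ (N + 2)) x i"
    by (simp only: distrib_left power_add power_one_right power2_eq_square mult_ac add_ac)
  finally show ?case by (simp add: trunc_series_def)
qed

text \<open>With c = (1 - \<alpha>)^(N + 1), the normalised sum exceeds the plain one by c / (1 - c)
  times the plain sum, while the tail of the series is c times a pushed solution. Each of the two
  has norm at most c / \<alpha> times that of \<open>b\<close>, hence the factor 2.\<close>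

lemma trunc_series_error:
  assumes "\<And>i. i \<in> V \<Longrightarrow> x i = b i + (1 - \<alpha>) * push V P x i"
  shows "l1_norm V (\<lambda>i. 1 / (1 - (1 - \<alpha>) ^ (N + 1)) * trunc_series \<alpha> V P N b i - x i)
    \<le> 2 * (1 - \<alpha>) ^ (N + 1) / \<alpha> * l1_norm V b"
proof -
  define c where "c = (1 - \<alpha>) ^ (N + 1)"
  have c: "0 < c" "c < 1" using pow_less_1[of N] pow_less_1(2)[of "N+1"] by (auto simp: c_def)
  let ?t = "trunc_series \<alpha> V P N b" and ?z = "(push V P ^^ (N + 1)) x"
  have z: "l1_norm V ?z \<le> l1_norm V b / \<alpha>"
    using l1_norm_push_pow fixpoint_bound[OF assms] by (rule order_trans)
  have "l1_norm V (\<lambda>i. 1 / (1 - c) * ?t i - x i) = l1_norm V (\<lambda>i. c / (1 - c) * ?t i + (- c) * ?z i)"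
  proof (rule l1_norm_cong)
    fix i assume "i \<in> V"
    then have "x i = ?t i + c * ?z i" using fixpoint_expand[OF assms] by (simp add: c_def)
    then show "1 / (1 - c) * ?t i - x i = c / (1 - c) * ?t i + (- c) * ?z i"
      using c by (simp add: field_simps)
  qed
  also have "\<dots> \<le> c / (1 - c) * l1_norm V ?t + c * l1_norm V ?z"
    using c l1_norm_triangle[of V "\<lambda>i. c / (1 - c) * ?t i" "\<lambda>i. (- c) * ?z i"]
    unfolding l1_norm_scale by simp
  also have "\<dots> \<le> c / (1 - c) * ((1 - c) / \<alpha> * l1_norm V b) + c * (l1_norm V b / \<alpha>)"
    using c l1_norm_trunc_series[of N b, folded c_def] z by (intro add_mono mult_left_mono) auto
  also have "\<dots> = 2 * c / \<alpha> * l1_norm V b"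
    using c \<alpha> by (simp add: field_simps)
  finally show ?thesis by (simp only: c_def)
qed

end


text \<open>
  The remainder \<open>x \<psi> - x \<phi> - J (\<psi> - \<phi>)\<close> solves the fixed point equation at \<open>\<psi>\<close> with a source term
  \<open>R\<close> whose derivative at \<open>\<phi>\<close> vanishes.
\<close>

lemma fixpoint_has_derivative:
  fixes P :: "'a::real_normed_vector \<Rightarrow> 'v \<Rightarrow> 'v \<Rightarrow> real"
  assumes chain: "\<forall>\<^sub>F \<psi> in nhds \<phi>. discounted_chain V (P \<psi>) \<alpha>"
    and fixpoint: "\<forall>\<^sub>F \<psi> in nhds \<phi>. \<forall>i\<in>V. x \<psi> i = b \<psi> i + (1 - \<alpha>) * push V (P \<psi>) (x \<psi>) i"
    and dP: "\<And>j i. j \<in> V \<Longrightarrow> i \<in> V \<Longrightarrow> ((\<lambda>\<psi>. P \<psi> j i) has_derivative P' j i) (at \<phi>)"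
    and db: "\<And>i. i \<in> V \<Longrightarrow> ((\<lambda>\<psi>. b \<psi> i) has_derivative b' i) (at \<phi>)"
    and J: "\<And>h i. i \<in> V \<Longrightarrow> J h i =
      b' i h + (1 - \<alpha>) * (\<Sum>j\<in>V. P' j i h * x \<phi> j) + (1 - \<alpha>) * push V (P \<phi>) (J h) i"
    and J_lin: "\<And>i. i \<in> V \<Longrightarrow> bounded_linear (\<lambda>h. J h i)"
    and i: "i \<in> V"
  shows "((\<lambda>\<psi>. x \<psi> i) has_derivative (\<lambda>h. J h i)) (at \<phi>)"
proof -
  interpret discounted_chain V "P \<phi>" \<alpha> using chain by (rule eventually_nhds_x_imp_x)
  have fix_\<phi>: "x \<phi> i = b \<phi> i + (1 - \<alpha>) * push V (P \<phi>) (x \<phi>) i" if "i \<in> V" for i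
    using eventually_nhds_x_imp_x[OF fixpoint] that by blast
  \<comment> \<open>The defect of the linear prediction x \<phi> + J (\<psi> - \<phi>) in the fixed
    point equation at \<psi>.\<close>
  define R where "R i \<psi> = b \<psi> i + (1 - \<alpha>) * (\<Sum>j\<in>V. P \<psi> j i * x \<phi> j) +
    (1 - \<alpha>) * (\<Sum>j\<in>V. P \<psi> j i * J (\<psi> - \<phi>) j) - x \<phi> i - J (\<psi> - \<phi>) i" for i \<psi>
  have dJ: "((\<lambda>\<psi>. J (\<psi> - \<phi>) j) has_derivative (\<lambda>h. J h j)) (at \<phi>)" if "j \<in> V" for j
    by (rule bounded_linear.has_derivative[OF J_lin[OF that]]) (auto intro!: derivative_eq_intros)
  have J0: "J 0 j = 0" if "j \<in> V" for j
    using J_lin[OF that] by (rule linear_simps(3))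
  have dR: "(R j has_derivative (\<lambda>h. 0)) (at \<phi>)" if j: "j \<in> V" for j
  proof -
    have "(R j has_derivative (\<lambda>h. b' j h + (1 - \<alpha>) * (\<Sum>l\<in>V. P' l j h * x \<phi> l) +
        (1 - \<alpha>) * (\<Sum>l\<in>V. P \<phi> l j * J h l + P' l j h * J (\<phi> - \<phi>) l) - 0 - J h j)) (at \<phi>)"
      unfolding R_def
      by (intro has_derivative_add has_derivative_diff has_derivative_mult_right has_derivative_sum
          has_derivative_mult has_derivative_mult_left dP db dJ j has_derivative_const)
    moreover have "b' j h + (1 - \<alpha>) * (\<Sum>l\<in>V. P' l j h * x \<phi> l) +
        (1 - \<alpha>) * (\<Sum>l\<in>V. P \<phi> l j * J h l + P' l j h * J (\<phi> - \<phi>) l) - 0 - J h j = 0" for h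
      using J[OF j, of h] by (simp add: J0 push_def)
    ultimately show ?thesis by simp
  qed
  have R\<phi>: "R j \<phi> = 0" if "j \<in> V" for j
    using fix_\<phi>[OF that] by (simp add: R_def J0 that push_def)
  have "((\<lambda>\<psi>. (\<Sum>j\<in>V. norm (R j \<psi> - R j \<phi> - 0) / norm (\<psi> - \<phi>)) / \<alpha>) \<longlongrightarrow> (\<Sum>j\<in>V. 0) / \<alpha>) (at \<phi>)"
    using \<alpha> dR by (intro tendsto_intros) (auto simp: has_derivative_iff_norm)
  then have lim: "((\<lambda>\<psi>. (\<Sum>j\<in>V. norm (R j \<psi>) / norm (\<psi> - \<phi>)) / \<alpha>) \<longlongrightarrow> 0) (at \<phi>)"
    by (simp add: R\<phi>)
  \<comment> \<open>\<open>fixpoint_bound\<close> at \<psi> has the constant 1 / \<alpha> for every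
    nearby \<psi>, so smallness of the defect passes to the remainder.\<close>
  have bound: "\<forall>\<^sub>F \<psi> in nhds \<phi>. norm (norm (x \<psi> i - x \<phi> i - J (\<psi> - \<phi>) i) / norm (\<psi> - \<phi>))
      \<le> (\<Sum>j\<in>V. norm (R j \<psi>) / norm (\<psi> - \<phi>)) / \<alpha>"
    using chain fixpoint
  proof eventually_elim
    case (elim \<psi>)
    interpret \<psi>: discounted_chain V "P \<psi>" \<alpha> by (rule elim)
    let ?w = "\<lambda>i. x \<psi> i - x \<phi> i - J (\<psi> - \<phi>) i"
    have "l1_norm V ?w \<le> l1_norm V (\<lambda>j. R j \<psi>) / \<alpha>"
    proof (rule \<psi>.fixpoint_bound)
      fix j assume "j \<in> V"
      with elim have "x \<psi> j = b \<psi> j + (1 - \<alpha>) * (\<Sum>l\<in>V. P \<psi> l j * x \<psi> l)"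
        by (simp add: push_def)
      then show "?w j = R j \<psi> + (1 - \<alpha>) * push V (P \<psi>) ?w j"
        by (simp add: R_def push_def sum_subtractf right_diff_distrib)
    qed
    then have "norm (?w i) \<le> l1_norm V (\<lambda>j. R j \<psi>) / \<alpha>"
      using abs_le_l1_norm[OF finite_V i, of ?w] by simp
    then have "norm (?w i) / norm (\<psi> - \<phi>) \<le> l1_norm V (\<lambda>j. R j \<psi>) / \<alpha> / norm (\<psi> - \<phi>)"
      by (rule divide_right_mono) simp
    then show ?case by (simp add: l1_norm_def sum_divide_distrib[symmetric] mult.commute)
  qed
  show ?thesis
    unfolding has_derivative_iff_norm
  proof (intro conjI J_lin i Lim_null_comparison[OF _ lim])
    show "\<forall>\<^sub>F \<psi> in at \<phi>. norm (norm (x \<psi> i - x \<phi> i - J (\<psi> - \<phi>) i) / norm (\<psi> - \<phi>))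
        \<le> (\<Sum>j\<in>V. norm (R j \<psi>) / norm (\<psi> - \<phi>)) / \<alpha>"
      using bound by (simp only: eventually_nhds_conv_at)
  qed
qed

section \<open>Derivatives of the restart and transition probabilities\<close>

text \<open>The quotient rule with the quotient put back: (u / S)' = (u' - (u / S) S') / S. The
  probability as coefficient of S' is what later produces differences from a weighted mean.\<close>

definition restart_deriv ::
  "('q, 'v) query_graphs \<Rightarrow> ('q, 'v, 'm1::finite, 'm2::finite) features \<Rightarrow> 'q \<Rightarrow>
   ('m1, 'm2) param \<Rightarrow> 'v \<Rightarrow> ('m1, 'm2) param \<Rightarrow> real" where
  "restart_deriv G F q \<phi> i h =
     (if i \<in> seeds G q
      then (fst h \<bullet> node_feat F q i - restart G F q \<phi> i * (\<Sum>l\<in>seeds G q. fst h \<bullet> node_feat F q l)) /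
        (\<Sum>l\<in>seeds G q. fst \<phi> \<bullet> node_feat F q l) else 0)"

definition transition_deriv ::
  "('q, 'v) query_graphs \<Rightarrow> ('q, 'v, 'm1::finite, 'm2::finite) features \<Rightarrow> 'q \<Rightarrow>
   ('m1, 'm2) param \<Rightarrow> 'v \<Rightarrow> 'v \<Rightarrow> ('m1, 'm2) param \<Rightarrow> real" where
  "transition_deriv G F q \<phi> i j h =
     (if out_nbrs G q i = {} then restart_deriv G F q \<phi> j h
      else if (i, j) \<in> edges G q
      then (snd h \<bullet> edge_feat F q i j -
          transition G F q \<phi> i j * (\<Sum>l\<in>out_nbrs G q i. snd h \<bullet> edge_feat F q i l)) /
        (\<Sum>l\<in>out_nbrs G q i. snd \<phi> \<bullet> edge_feat F q i l)
      else 0)"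

section \<open>Stochasticity and the stationary vector of one query\<close>

locale query_instance =
  fixes G :: "('q, 'v) query_graphs"
    and F :: "('q, 'v, 'm1::finite, 'm2::finite) features"
    and \<alpha> :: real and q :: 'q and \<phi> :: "('m1, 'm2) param"
  assumes wf: "wf_query_graphs G" and q: "q \<in> queries G"
    and nonneg: "nonneg_features G F"
    and pos: "\<forall>k. 0 < coord \<phi> k"
    and denom: "nonzero_denominators G F \<phi>"
    and damping: "0 < \<alpha>" "\<alpha> < 1"
begin

abbreviation "V \<equiv> nodes G q"

lemma finite_nodes: "finite V" and edges_sub: "edges G q \<subseteq> V \<times> V" and seeds_sub: "seeds G q \<subseteq> V"
  using wf q by (auto simp: wf_query_graphs_def)

lemma out_nbrs_sub: "out_nbrs G q i \<subseteq> V"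
  using edges_sub by (auto simp: out_nbrs_def)

lemma finite_seeds: "finite (seeds G q)" and finite_out_nbrs: "finite (out_nbrs G q i)"
  using finite_nodes seeds_sub out_nbrs_sub finite_subset by blast+

lemma inner_nonneg:
  "i \<in> V \<Longrightarrow> 0 \<le> fst \<phi> \<bullet> node_feat F q i"
  "(i, j) \<in> edges G q \<Longrightarrow> 0 \<le> snd \<phi> \<bullet> edge_feat F q i j"
proof -
  have "0 \<le> fst \<phi> $ a" "0 \<le> snd \<phi> $ c" for a c
    using pos[THEN spec, of "Inl a"] pos[THEN spec, of "Inr c"] by (simp_all add: coord_def)
  then show "i \<in> V \<Longrightarrow> 0 \<le> fst \<phi> \<bullet> node_feat F q i"
    "(i, j) \<in> edges G q \<Longrightarrow> 0 \<le> snd \<phi> \<bullet> edge_feat F q i j"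
    using nonneg q by (fastforce simp: inner_vec_def nonneg_features_def intro!: sum_nonneg)+
qed

lemma seed_denom: "(\<Sum>l\<in>seeds G q. fst \<phi> \<bullet> node_feat F q l) \<noteq> 0"
  using denom q by (auto simp: nonzero_denominators_def)

lemma out_denom: "i \<in> V \<Longrightarrow> out_nbrs G q i \<noteq> {} \<Longrightarrow> (\<Sum>l\<in>out_nbrs G q i. snd \<phi> \<bullet> edge_feat F q i l) \<noteq> 0"
  using denom q by (auto simp: nonzero_denominators_def)

lemma seeds_nonempty: "seeds G q \<noteq> {}"
  using seed_denom by auto

lemma restart_nonneg: "0 \<le> restart G F q \<phi> i"
  using seeds_sub by (auto simp: restart_def intro!: divide_nonneg_nonneg sum_nonneg inner_nonneg)

lemma restart_outside: "i \<notin> V \<Longrightarrow> restart G F q \<phi> i = 0"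
  using seeds_sub by (auto simp: restart_def)

lemma restart_sum: "(\<Sum>i\<in>V. restart G F q \<phi> i) = 1"
proof -
  have "(\<Sum>i\<in>V. restart G F q \<phi> i) = (\<Sum>i\<in>seeds G q. restart G F q \<phi> i)"
    using finite_nodes seeds_sub by (intro sum.mono_neutral_right) (auto simp: restart_def)
  also have "\<dots> = (\<Sum>i\<in>seeds G q. (fst \<phi> \<bullet> node_feat F q i)) / (\<Sum>l\<in>seeds G q. fst \<phi> \<bullet> node_feat F q l)"
    by (subst sum_divide_distrib) (simp add: restart_def)
  finally show ?thesis using seed_denom by simp
qed

lemma transition_nonneg: "0 \<le> transition G F q \<phi> j i"
  by (auto simp: transition_def restart_nonneg out_nbrs_def
      intro!: divide_nonneg_nonneg sum_nonneg inner_nonneg)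

lemma transition_outside: "i \<notin> V \<Longrightarrow> transition G F q \<phi> j i = 0"
  using edges_sub by (auto simp: transition_def restart_outside)

lemma transition_sum: "j \<in> V \<Longrightarrow> (\<Sum>i\<in>V. transition G F q \<phi> j i) = 1"
proof (cases "out_nbrs G q j = {}")
  case True
  then show ?thesis by (simp add: transition_def restart_sum)
next
  case False
  assume j: "j \<in> V"
  have "(\<Sum>i\<in>V. transition G F q \<phi> j i) = (\<Sum>i\<in>out_nbrs G q j. transition G F q \<phi> j i)"
    using finite_nodes out_nbrs_sub False
    by (intro sum.mono_neutral_right) (auto simp: transition_def out_nbrs_def)
  also have "\<dots> = (\<Sum>i\<in>out_nbrs G q j. snd \<phi> \<bullet> edge_feat F q j i) /
      (\<Sum>i\<in>out_nbrs G q j. snd \<phi> \<bullet> edge_feat F q j i)"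
    unfolding sum_divide_distrib using False by (auto simp: transition_def out_nbrs_def intro!: sum.cong)
  finally show ?thesis using out_denom[OF j False] by simp
qed

sublocale discounted_chain V "transition G F q \<phi>" \<alpha>
  using finite_nodes transition_nonneg transition_sum damping by unfold_locales auto

lemma stationary_unique_ex:
  "\<exists>!x. (\<forall>i\<in>V. x i = \<alpha> * restart G F q \<phi> i + (1 - \<alpha>) * (\<Sum>j\<in>V. transition G F q \<phi> j i * x j)) \<and>
    (\<forall>i. i \<notin> V \<longrightarrow> x i = 0)"
proof (rule ex_ex1I)
  show "\<exists>x. (\<forall>i\<in>V. x i = \<alpha> * restart G F q \<phi> i + (1 - \<alpha>) * (\<Sum>j\<in>V. transition G F q \<phi> j i * x j)) \<and>
    (\<forall>i. i \<notin> V \<longrightarrow> x i = 0)"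
    using fixpoint_ex[of "\<lambda>i. \<alpha> * restart G F q \<phi> i"] by (simp add: push_def)
next
  fix x y :: "'v \<Rightarrow> real"
  assume x: "(\<forall>i\<in>V. x i = \<alpha> * restart G F q \<phi> i + (1 - \<alpha>) * (\<Sum>j\<in>V. transition G F q \<phi> j i * x j)) \<and>
    (\<forall>i. i \<notin> V \<longrightarrow> x i = 0)"
    and y: "(\<forall>i\<in>V. y i = \<alpha> * restart G F q \<phi> i + (1 - \<alpha>) * (\<Sum>j\<in>V. transition G F q \<phi> j i * y j)) \<and>
    (\<forall>i. i \<notin> V \<longrightarrow> y i = 0)"
  show "x = y"
  proof
    fix i
    show "x i = y i"
    proof (cases "i \<in> V")
      case True
      show ?thesis
        by (rule fixpoint_unique[of x "\<lambda>i. \<alpha> * restart G F q \<phi> i" y])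
          (use x y True in \<open>auto simp: push_def\<close>)
    qed (use x y in auto)
  qed
qed

lemma stationary_fixpoint:
  "i \<in> V \<Longrightarrow> stationary G F \<alpha> q \<phi> i =
    \<alpha> * restart G F q \<phi> i + (1 - \<alpha>) * push V (transition G F q \<phi>) (stationary G F \<alpha> q \<phi>) i"
  using theI'[OF stationary_unique_ex] unfolding stationary_def[symmetric] push_def by blast

lemma l1_norm_restart: "l1_norm V (restart G F q \<phi>) = 1"
  by (simp add: l1_norm_def restart_nonneg restart_sum)

lemma l1_norm_stationary: "l1_norm V (stationary G F \<alpha> q \<phi>) \<le> 1"
  using fixpoint_bound[of "stationary G F \<alpha> q \<phi>" "\<lambda>i. \<alpha> * restart G F q \<phi> i"] stationary_fixpoint damping
  by (simp add: l1_norm_scale l1_norm_restart)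

lemma abs_stationary: "i \<in> V \<Longrightarrow> \<bar>stationary G F \<alpha> q \<phi> i\<bar> \<le> 1"
  using abs_le_l1_norm[OF finite_nodes] l1_norm_stationary order_trans by blast

lemma vec_iter_eq: "vec_iter G F q \<phi> k = (push V (transition G F q \<phi>) ^^ k) (restart G F q \<phi>)"
  by (induction k) (auto simp: push_def)

lemma vec_approx_eq:
  "vec_approx G F \<alpha> q \<phi> N i = 1 / (1 - (1 - \<alpha>) ^ (N + 1)) *
     trunc_series \<alpha> V (transition G F q \<phi>) N (\<lambda>i. \<alpha> * restart G F q \<phi> i) i"
  unfolding vec_approx_def trunc_series_def push_pow_scale vec_iter_eq
  by (simp only: sum_distrib_left mult_ac times_divide_eq_right times_divide_eq_left mult_1)

text \<open>The source, \<alpha> times the restart vector, has 1-norm \<alpha>, which cancels the 1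
  / \<alpha> of the general bound.\<close>

lemma vec_approx_error:
  "l1_norm V (\<lambda>i. vec_approx G F \<alpha> q \<phi> N i - stationary G F \<alpha> q \<phi> i) \<le> 2 * (1 - \<alpha>) ^ (N + 1)"
  using trunc_series_error[of "stationary G F \<alpha> q \<phi>" "\<lambda>i. \<alpha> * restart G F q \<phi> i" N]
    stationary_fixpoint damping
  unfolding vec_approx_eq[symmetric] l1_norm_scale l1_norm_restart by simp

lemma vec_approx_nonneg: "i \<in> V \<Longrightarrow> 0 \<le> vec_approx G F \<alpha> q \<phi> N i"
  using pow_less_1[of N] damping push_pow_nonneg[of "restart G F q \<phi>"] restart_nonneg
  unfolding vec_approx_def vec_iter_eq
  by (intro mult_nonneg_nonneg sum_nonneg divide_nonneg_nonneg) auto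

lemma vec_approx_sum: "(\<Sum>i\<in>V. vec_approx G F \<alpha> q \<phi> N i) = 1"
  using pow_less_1[of N] damping
  unfolding vec_approx_eq sum_distrib_left[symmetric] sum_trunc_series by (simp add: restart_sum)

lemma mat_iter_eq:
  "mat_iter G F \<alpha> q \<phi> N1 k i b = (push V (transition G F q \<phi>) ^^ k) (\<lambda>i. mat_iter G F \<alpha> q \<phi> N1 0 i b) i"
  by (induction k arbitrary: i) (simp_all add: push_def del: mat_iter.simps(1))

lemma mat_approx_eq:
  "mat_approx G F \<alpha> q \<phi> N1 N2 i b = 1 / (1 - (1 - \<alpha>) ^ (N2 + 1)) *
     trunc_series \<alpha> V (transition G F q \<phi>) N2 (\<lambda>i. mat_iter G F \<alpha> q \<phi> N1 0 i b) i"
  unfolding mat_approx_def trunc_series_def using mat_iter_eq by metis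

section \<open>Differentiability in the parameter\<close>

lemma restart_has_derivative:
  "((\<lambda>\<psi>. restart G F q \<psi> i) has_derivative restart_deriv G F q \<phi> i) (at \<phi>)"
proof (cases "i \<in> seeds G q")
  case True
  have "((\<lambda>\<psi>. (fst \<psi> \<bullet> node_feat F q i) / (\<Sum>l\<in>seeds G q. fst \<psi> \<bullet> node_feat F q l)) has_derivative
     restart_deriv G F q \<phi> i) (at \<phi>)"
    using True seed_denom
    by (auto intro!: derivative_eq_intros simp: restart_deriv_def restart_def fun_eq_iff field_simps)
  then show ?thesis using True by (simp add: restart_def)
next
  case False
  have "restart_deriv G F q \<phi> i = (\<lambda>h. 0)" using False by (auto simp: restart_deriv_def)
  then show ?thesis using False by (simp add: restart_def)
qed

lemma transition_has_derivative:
  assumes i: "i \<in> V"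
  shows "((\<lambda>\<psi>. transition G F q \<psi> i j) has_derivative transition_deriv G F q \<phi> i j) (at \<phi>)"
proof (cases "out_nbrs G q i = {}")
  case True
  have "transition_deriv G F q \<phi> i j = restart_deriv G F q \<phi> j"
    using True by (auto simp: transition_deriv_def)
  with True show ?thesis by (simp add: transition_def restart_has_derivative)
next
  case ne: False
  show ?thesis
  proof (cases "(i, j) \<in> edges G q")
    case True
    have "((\<lambda>\<psi>. (snd \<psi> \<bullet> edge_feat F q i j) / (\<Sum>l\<in>out_nbrs G q i. snd \<psi> \<bullet> edge_feat F q i l))
        has_derivative transition_deriv G F q \<phi> i j) (at \<phi>)"
      using True ne out_denom[OF i ne]
      by (auto intro!: derivative_eq_intros simp: transition_deriv_def transition_def fun_eq_iff field_simps)
    then show ?thesis using True ne by (simp add: transition_def)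
  next
    case False
    have "transition_deriv G F q \<phi> i j = (\<lambda>h. 0)"
      using False ne by (simp add: transition_deriv_def fun_eq_iff)
    then show ?thesis using False ne by (simp add: transition_def)
  qed
qed

lemma restart_jacobian: "param_jacobian (restart G F q) \<phi> i b = restart_deriv G F q \<phi> i b"
  using frechet_derivative_at[OF restart_has_derivative] by (simp add: param_jacobian_def)

lemma transition_jacobian:
  "l \<in> V \<Longrightarrow> param_jacobian (\<lambda>\<psi>. transition G F q \<psi> l) \<phi> i b = transition_deriv G F q \<phi> l i b"
  using frechet_derivative_at[OF transition_has_derivative] by (simp add: param_jacobian_def)

text \<open>Positivity and non-vanishing amount to finitely many open conditions. Differentiating
  the stationary vector at \<phi> requires its equation and stochasticity at all nearby parameters,
  and these follow from the locale there.\<close>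

lemma eventually_query_instance: "\<forall>\<^sub>F \<psi> in nhds \<phi>. query_instance G F \<alpha> q \<psi>"
proof -
  have fin: "finite (queries G)" "\<And>q. q \<in> queries G \<Longrightarrow> finite (nodes G q)"
    using wf by (auto simp: wf_query_graphs_def)
  have 1: "\<forall>\<^sub>F \<psi> in nhds \<phi>. 0 < coord \<psi> k" for k
  proof -
    have "open {\<psi> :: ('m1, 'm2) param. 0 < coord \<psi> k}"
      unfolding coord_def by (cases k) (auto intro!: open_Collect_less continuous_intros)
    from eventually_nhds_in_open[OF this, of \<phi>] pos show ?thesis by simp
  qed
  have 2: "\<forall>\<^sub>F \<psi> in nhds \<phi>. (\<Sum>l\<in>L. fst \<psi> \<bullet> f l) \<noteq> 0"
    if "(\<Sum>l\<in>L. fst \<phi> \<bullet> f l) \<noteq> 0" for L and f :: "'v \<Rightarrow> real ^ 'm1"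
  proof -
    have "open {\<psi> :: ('m1, 'm2) param. (\<Sum>l\<in>L. fst \<psi> \<bullet> f l) \<noteq> 0}"
      by (intro open_Collect_neq continuous_intros)
    from eventually_nhds_in_open[OF this, of \<phi>] that show ?thesis by simp
  qed
  have 3: "\<forall>\<^sub>F \<psi> in nhds \<phi>. (\<Sum>l\<in>L. snd \<psi> \<bullet> f l) \<noteq> 0"
    if "(\<Sum>l\<in>L. snd \<phi> \<bullet> f l) \<noteq> 0" for L and f :: "'v \<Rightarrow> real ^ 'm2"
  proof -
    have "open {\<psi> :: ('m1, 'm2) param. (\<Sum>l\<in>L. snd \<psi> \<bullet> f l) \<noteq> 0}"
      by (intro open_Collect_neq continuous_intros)
    from eventually_nhds_in_open[OF this, of \<phi>] that show ?thesis by simp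
  qed
  have 4: "\<forall>\<^sub>F \<psi> in nhds \<phi>. out_nbrs G q i \<noteq> {} \<longrightarrow>
      (\<Sum>l\<in>out_nbrs G q i. snd \<psi> \<bullet> edge_feat F q i l) \<noteq> 0"
    if "q \<in> queries G" "i \<in> nodes G q" for q i
    using denom that by (cases "out_nbrs G q i = {}") (auto simp: nonzero_denominators_def intro!: 3)
  have "\<forall>\<^sub>F \<psi> in nhds \<phi>. (\<forall>k. 0 < coord \<psi> k) \<and> nonzero_denominators G F \<psi>"
    unfolding nonzero_denominators_def
    using denom
    by (intro eventually_conj eventually_all_finite eventually_ball_finite ballI 1 2 4 fin)
      (auto simp: nonzero_denominators_def)
  then show ?thesis
    by eventually_elim (use wf q nonneg damping in \<open>auto simp: query_instance_def\<close>)
qed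

end

section \<open>The error of the approximate gradient\<close>

lemma trunc_series_add:
  "trunc_series \<alpha> V P N (\<lambda>i. x i + y i) i = trunc_series \<alpha> V P N x i + trunc_series \<alpha> V P N y i"
  by (simp add: trunc_series_def push_pow_add distrib_left sum.distrib)

section \<open>Positive part, gradient and ranking residual\<close>

lemma pos_part_diff: "\<bar>pos_part a - pos_part b\<bar> \<le> \<bar>a - b\<bar>"
  by (auto simp: pos_part_def)

text \<open>Away from 0 the function is locally a square or 0; at 0 the difference quotient is
  bounded by the modulus of the increment. So the loss is differentiable even where a ranking
  residual is not.\<close>

lemma pos_part_square_deriv: "((\<lambda>t. (pos_part t)\<^sup>2) has_real_derivative 2 * pos_part t) (at t)"
proof -
  consider "0 < t" | "t < 0" | "t = 0" by linarith
  then show ?thesis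
  proof cases
    case 1
    have "((\<lambda>t. t\<^sup>2) has_real_derivative 2 * pos_part t) (at t)"
      using 1 by (auto intro!: derivative_eq_intros simp: pos_part_def)
    then show ?thesis
      by (rule has_field_derivative_transform_within_open[of _ _ _ "{0<..}"])
        (use 1 in \<open>auto simp: pos_part_def\<close>)
  next
    case 2
    have "((\<lambda>t. 0) has_real_derivative 2 * pos_part t) (at t)"
      using 2 by (auto simp: pos_part_def)
    then show ?thesis
      by (rule has_field_derivative_transform_within_open[of _ _ _ "{..<0}"])
        (use 2 in \<open>auto simp: pos_part_def\<close>)
  next
    case 3
    have "((\<lambda>y::real. ((pos_part y)\<^sup>2 - (pos_part 0)\<^sup>2) / (y - 0)) \<longlongrightarrow> 0) (at 0)"
    proof (rule Lim_null_comparison)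
      show "((\<lambda>y. norm y) \<longlongrightarrow> 0) (at (0::real))"
        by (rule tendsto_norm_zero) (rule tendsto_ident_at)
      have "norm (((pos_part y)\<^sup>2 - (pos_part 0)\<^sup>2) / (y - 0)) \<le> norm y" for y
        by (auto simp: pos_part_def power2_eq_square max_def)
      then show "\<forall>\<^sub>F y in at 0. norm (((pos_part y)\<^sup>2 - (pos_part 0)\<^sup>2) / (y - 0)) \<le> norm y"
        by simp
    qed
    then show ?thesis using 3 by (simp add: has_field_derivative_iff pos_part_def)
  qed
qed

text \<open>The representing vector is assembled from the values of the derivative on the basis;
  uniqueness of the derivative then resolves the description in \<open>gradient\<close>.\<close>

lemma gradient_inner:
  assumes "(f has_derivative f') (at x)"
  shows "gradient f x \<bullet> h = f' h"
proof -
  interpret f': bounded_linear f' using assms by (rule has_derivative_bounded_linear)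
  define D where "D = (\<Sum>b\<in>Basis. f' b *\<^sub>R b)"
  have D: "D \<bullet> h = f' h" for h
  proof -
    have "f' h = f' (\<Sum>b\<in>Basis. (h \<bullet> b) *\<^sub>R b)" by (simp add: euclidean_representation)
    also have "\<dots> = D \<bullet> h"
      by (simp add: D_def f'.sum f'.scaleR inner_sum_left mult.commute inner_commute[of h])
    finally show ?thesis by simp
  qed
  have "GDERIV f x :> D" unfolding gderiv_def using assms D by (simp add: inner_commute)
  moreover have "D' = D" if "GDERIV f x :> D'" for D'
  proof -
    have "(\<lambda>h. h \<bullet> D') = f'"
      using that assms unfolding gderiv_def by (rule has_derivative_unique)
    then have "h \<bullet> D' = h \<bullet> D" for h using D[of h] by (metis inner_commute)
    then show ?thesis using vector_eq_ldot by blast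
  qed
  ultimately have "gradient f x = D" unfolding gradient_def by (rule the_equality)
  with D show ?thesis by simp
qed

lemma abs_pair_matrix: "\<bar>pair_matrix \<rho> i\<bar> \<le> 1"
  by (auto simp: pair_matrix_def)

lemma abs_sum_mult_le:
  assumes "\<And>i. i \<in> V \<Longrightarrow> \<bar>y i\<bar> \<le> M"
  shows "\<bar>\<Sum>i\<in>V. x i * y i\<bar> \<le> l1_norm V x * M"
proof -
  have "\<bar>\<Sum>i\<in>V. x i * y i\<bar> \<le> (\<Sum>i\<in>V. \<bar>x i * y i\<bar>)" by (rule sum_abs)
  also have "\<dots> \<le> (\<Sum>i\<in>V. \<bar>x i\<bar> * M)" by (intro sum_mono) (simp add: abs_mult assms mult_left_mono)
  finally show ?thesis by (simp add: l1_norm_def sum_distrib_right)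
qed

lemma abs_ranking_residual: "\<bar>ranking_residual G q x \<rho>\<bar> \<le> l1_norm (nodes G q) x"
  using abs_sum_mult_le[of "nodes G q" "pair_matrix \<rho>" 1 x] abs_pair_matrix[of \<rho>]
  by (simp add: ranking_residual_def pos_part_def mult.commute[of "x _"] abs_le_iff l1_norm_nonneg)

lemma ranking_residual_diff:
  "\<bar>ranking_residual G q x \<rho> - ranking_residual G q y \<rho>\<bar> \<le> l1_norm (nodes G q) (\<lambda>i. x i - y i)"
proof -
  have "\<bar>ranking_residual G q x \<rho> - ranking_residual G q y \<rho>\<bar> \<le> \<bar>\<Sum>i\<in>nodes G q. (x i - y i) * pair_matrix \<rho> i\<bar>"
    unfolding ranking_residual_def
    by (rule order_trans[OF pos_part_diff]) (simp add: sum_subtractf algebra_simps)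
  also have "\<dots> \<le> l1_norm (nodes G q) (\<lambda>i. x i - y i) * 1"
    by (rule abs_sum_mult_le) (rule abs_pair_matrix)
  finally show ?thesis by simp
qed

text \<open>The vector A^T (A x)_+ for the ranking matrix A, that is, the factor of the gradient
  formula that stands next to the Jacobian.\<close>

definition residual_pullback :: "('q, 'v) query_graphs \<Rightarrow> 'q \<Rightarrow> ('v \<Rightarrow> real) \<Rightarrow> 'v \<Rightarrow> real" where
  "residual_pullback G q x i = (\<Sum>\<rho>\<in>row_pairs G q. pair_matrix \<rho> i * ranking_residual G q x \<rho>)"

lemma abs_residual_pullback:
  "\<bar>residual_pullback G q x i\<bar> \<le> real (card (row_pairs G q)) * l1_norm (nodes G q) x"
proof -
  have "\<bar>pair_matrix \<rho> i * ranking_residual G q x \<rho>\<bar> \<le> 1 * l1_norm (nodes G q) x" for \<rho>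
    unfolding abs_mult by (intro mult_mono abs_pair_matrix abs_ranking_residual) auto
  then show ?thesis
    unfolding residual_pullback_def
    by (intro order_trans[OF sum_abs] order_trans[OF sum_bounded_above]) auto
qed

text \<open>The positive part is 1-Lipschitz and the entries of a row have modulus at most 1, so
  every row contributes at most the 1-norm of the difference. This is one origin of the factor r in
  the error bound.\<close>

lemma residual_pullback_diff:
  "\<bar>residual_pullback G q x i - residual_pullback G q y i\<bar>
    \<le> real (card (row_pairs G q)) * l1_norm (nodes G q) (\<lambda>i. x i - y i)"
proof -
  have "\<bar>pair_matrix \<rho> i * (ranking_residual G q x \<rho> - ranking_residual G q y \<rho>)\<bar>
      \<le> 1 * l1_norm (nodes G q) (\<lambda>i. x i - y i)" for \<rho>
    unfolding abs_mult by (intro mult_mono abs_pair_matrix ranking_residual_diff) auto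
  then show ?thesis
    unfolding residual_pullback_def sum_subtractf[symmetric] right_diff_distrib[symmetric]
    by (intro order_trans[OF sum_abs] order_trans[OF sum_bounded_above]) auto
qed

lemma finite_class_pairs: "finite (class_pairs G)"
proof (rule finite_subset)
  show "class_pairs G \<subseteq> {..num_labels G} \<times> {..num_labels G}" by (auto simp: class_pairs_def)
qed simp

lemma card_row_pairs:
  assumes "wf_query_graphs G" "q \<in> queries G"
  shows "card (row_pairs G q) \<le> max_rows G"
proof -
  have "card (row_pairs G q) \<le> num_rows G q"
    unfolding row_pairs_def num_rows_def
    by (rule order_trans[OF card_UN_le[OF finite_class_pairs]]) (simp add: case_prod_beta card_cartesian_product)
  also have "\<dots> \<le> max_rows G"
    using assms unfolding max_rows_def wf_query_graphs_def by (intro Max_ge) auto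
  finally show ?thesis .
qed

lemma matrix_norm1_ge: "finite J \<Longrightarrow> b \<in> J \<Longrightarrow> l1_norm I (\<lambda>i. M i b) \<le> matrix_norm1 I J M"
  unfolding l1_norm_def matrix_norm1_def by (intro Max_ge) auto

section \<open>The Jacobian of the stationary vector\<close>

context query_instance
begin

text \<open>Differentiating the stationary equation formally in direction \<open>h\<close> leaves a
  fixed point equation with the same operator and this source. \<open>mat_iter\<close> starts from
  the same expression, with the stationary vector replaced by its approximation.\<close>

definition stationary_deriv_rhs :: "('m1, 'm2) param \<Rightarrow> 'v \<Rightarrow> real" where
  "stationary_deriv_rhs h i = \<alpha> * restart_deriv G F q \<phi> i h +
     (1 - \<alpha>) * (\<Sum>l\<in>V. transition_deriv G F q \<phi> l i h * stationary G F \<alpha> q \<phi> l)"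

lemma bounded_linear_stationary_deriv_rhs: "bounded_linear (\<lambda>h. stationary_deriv_rhs h i)"
  unfolding stationary_deriv_rhs_def
  by (intro bounded_linear_add bounded_linear_mult_right[THEN bounded_linear_compose]
      bounded_linear_mult_left[THEN bounded_linear_compose] bounded_linear_sum
      has_derivative_bounded_linear[OF restart_has_derivative]
      has_derivative_bounded_linear[OF transition_has_derivative])

lemma stationary_deriv_ex:
  "\<exists>J. (\<forall>h. \<forall>i\<in>V. J h i = stationary_deriv_rhs h i + (1 - \<alpha>) * push V (transition G F q \<phi>) (J h) i) \<and>
     (\<forall>i\<in>V. ((\<lambda>\<psi>. stationary G F \<alpha> q \<psi> i) has_derivative (\<lambda>h. J h i)) (at \<phi>))"
proof -
  let ?P = "transition G F q \<phi>"
  obtain J where J: "J h i = stationary_deriv_rhs h i + (1 - \<alpha>) * push V ?P (J h) i" if "i \<in> V" for h i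
    using fixpoint_ex[of "stationary_deriv_rhs h" for h] by metis
  \<comment> \<open>The solutions \<open>J h\<close> were chosen separately for each
    \<open>h\<close>, so linearity in \<open>h\<close> has to come from uniqueness of the fixed
    point.\<close>
  have bl: "bounded_linear (\<lambda>h. J h v)" if v: "v \<in> V" for v
    unfolding linear_conv_bounded_linear[symmetric]
  proof (rule linearI)
    fix x y :: "('m1, 'm2) param" and c :: real
    interpret R: bounded_linear "\<lambda>h. stationary_deriv_rhs h i" for i
      by (rule bounded_linear_stationary_deriv_rhs)
    show "J (x + y) v = J x v + J y v"
    proof (rule fixpoint_unique[of "J (x + y)" "stationary_deriv_rhs (x + y)" "\<lambda>i. J x i + J y i"])
      show "J (x + y) k = stationary_deriv_rhs (x + y) k + (1 - \<alpha>) * push V ?P (J (x + y)) k" if "k \<in> V" for k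
        by (rule J[OF that])
      fix k assume "k \<in> V"
      then show "J x k + J y k = stationary_deriv_rhs (x + y) k + (1 - \<alpha>) * push V ?P (\<lambda>i. J x i + J y i) k"
        using J[of k x] J[of k y] by (simp add: push_add R.add algebra_simps)
    qed (rule v)
    show "J (c *\<^sub>R x) v = c *\<^sub>R J x v"
    proof (rule fixpoint_unique[of "J (c *\<^sub>R x)" "stationary_deriv_rhs (c *\<^sub>R x)" "\<lambda>i. c *\<^sub>R J x i"])
      show "J (c *\<^sub>R x) k = stationary_deriv_rhs (c *\<^sub>R x) k + (1 - \<alpha>) * push V ?P (J (c *\<^sub>R x)) k" if "k \<in> V" for k
        by (rule J[OF that])
      fix k assume "k \<in> V"
      have "c * J x k = c * (stationary_deriv_rhs x k + (1 - \<alpha>) * push V ?P (J x) k)"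
        using J[OF \<open>k \<in> V\<close>, of x] by simp
      then show "c *\<^sub>R J x k = stationary_deriv_rhs (c *\<^sub>R x) k + (1 - \<alpha>) * push V ?P (\<lambda>i. c *\<^sub>R J x i) k"
        by (simp add: push_scale R.scaleR algebra_simps)
    qed (rule v)
  qed
  have "((\<lambda>\<psi>. stationary G F \<alpha> q \<psi> i) has_derivative (\<lambda>h. J h i)) (at \<phi>)" if i: "i \<in> V" for i
  proof (rule fixpoint_has_derivative[where b = "\<lambda>\<psi> i. \<alpha> * restart G F q \<psi> i"
        and b' = "\<lambda>i h. \<alpha> * restart_deriv G F q \<phi> i h" and P' = "transition_deriv G F q \<phi>" and J = J])
    show "\<forall>\<^sub>F \<psi> in nhds \<phi>. discounted_chain V (transition G F q \<psi>) \<alpha>"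
      using eventually_query_instance
    proof eventually_elim
      case (elim \<psi>)
      interpret \<psi>: query_instance G F \<alpha> q \<psi> by (rule elim)
      show ?case by (rule \<psi>.discounted_chain_axioms)
    qed
    show "\<forall>\<^sub>F \<psi> in nhds \<phi>. \<forall>i\<in>V. stationary G F \<alpha> q \<psi> i = \<alpha> * restart G F q \<psi> i +
        (1 - \<alpha>) * push V (transition G F q \<psi>) (stationary G F \<alpha> q \<psi>) i"
      using eventually_query_instance by eventually_elim (intro ballI query_instance.stationary_fixpoint)
    show "((\<lambda>\<psi>. \<alpha> * restart G F q \<psi> i) has_derivative (\<lambda>h. \<alpha> * restart_deriv G F q \<phi> i h)) (at \<phi>)" for i
      by (intro has_derivative_mult_right restart_has_derivative)
    show "J h i = \<alpha> * restart_deriv G F q \<phi> i h +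
        (1 - \<alpha>) * (\<Sum>j\<in>V. transition_deriv G F q \<phi> j i h * stationary G F \<alpha> q \<phi> j) +
        (1 - \<alpha>) * push V ?P (J h) i" if "i \<in> V" for h i
      using J[OF that] by (simp add: stationary_deriv_rhs_def)
  qed (use bl i transition_has_derivative in auto)
  with J show ?thesis by blast
qed

text \<open>A difference of products M h' - J h is split as (M - J) h' + J (h' - h). The first part
  contains the truncation of the matrix series (2 c2) and the inexact source (2 c1), the second the
  inexact residual (2 c1). Each is a 1-norm of order \<beta> / \<alpha> against entries of order r.
  Nonnegativity of \<beta> is recorded for the degenerate case of the final estimate.\<close>

lemma gradient_term_error:
  assumes J: "\<And>i. i \<in> V \<Longrightarrow> J i = stationary_deriv_rhs b i + (1 - \<alpha>) * push V (transition G F q \<phi>) J i"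
    and b: "b \<in> Basis"
    and beta: "\<alpha> * matrix_norm1 V Basis (param_jacobian (restart G F q) \<phi>) +
        (1 - \<alpha>) * (\<Sum>i\<in>V. matrix_norm1 V Basis (param_jacobian (\<lambda>\<theta>. transition G F q \<theta> i) \<phi>)) \<le> \<beta>"
    and r: "card (row_pairs G q) \<le> r"
  shows "\<bar>(\<Sum>i\<in>V. mat_approx G F \<alpha> q \<phi> N1 N2 i b * residual_pullback G q (vec_approx G F \<alpha> q \<phi> N1) i) -
      (\<Sum>i\<in>V. J i * residual_pullback G q (stationary G F \<alpha> q \<phi>) i)\<bar>
    \<le> r * \<beta> / \<alpha> * (2 * (1 - \<alpha>) ^ (N2 + 1) + 4 * (1 - \<alpha>) ^ (N1 + 1))" (is "\<bar>?lhs\<bar> \<le> _")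
    and "0 \<le> \<beta>"
proof -
  let ?P = "transition G F q \<phi>" and ?\<pi> = "stationary G F \<alpha> q \<phi>" and ?\<pi>' = "vec_approx G F \<alpha> q \<phi> N1"
  let ?M = "\<lambda>i. mat_approx G F \<alpha> q \<phi> N1 N2 i b" and ?Z = "\<lambda>i. mat_iter G F \<alpha> q \<phi> N1 0 i b"
  let ?e = "\<lambda>i. ?\<pi>' i - ?\<pi> i"
  define c1 c2 where "c1 = (1 - \<alpha>) ^ (N1 + 1)" and "c2 = (1 - \<alpha>) ^ (N2 + 1)"
  have c: "0 < c1" "0 < c2" "c2 < 1"
    using pow_less_1 by (auto simp only: c1_def c2_def)
  have e: "l1_norm V ?e \<le> 2 * c1" using vec_approx_error by (simp add: c1_def)
  define n where "n l = l1_norm V (\<lambda>i. transition_deriv G F q \<phi> l i b)" for l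
  have n_le: "n l \<le> matrix_norm1 V Basis (param_jacobian (\<lambda>\<theta>. transition G F q \<theta> l) \<phi>)" if "l \<in> V" for l
    using matrix_norm1_ge[OF finite_Basis b, of V "param_jacobian (\<lambda>\<theta>. transition G F q \<theta> l) \<phi>"]
    by (simp add: n_def transition_jacobian that)
  have n0_le: "l1_norm V (\<lambda>i. restart_deriv G F q \<phi> i b) \<le> matrix_norm1 V Basis (param_jacobian (restart G F q) \<phi>)"
    using matrix_norm1_ge[OF finite_Basis b, of V "param_jacobian (restart G F q) \<phi>"] by (simp add: restart_jacobian)
  have n_nonneg: "0 \<le> n l" for l by (simp add: n_def l1_norm_nonneg)
  have sum_n: "\<alpha> * l1_norm V (\<lambda>i. restart_deriv G F q \<phi> i b) + (1 - \<alpha>) * (\<Sum>l\<in>V. n l) \<le> \<beta>"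
    using damping by (intro order_trans[OF _ beta] add_mono mult_left_mono sum_mono n0_le n_le) auto
  moreover have "0 \<le> \<alpha> * l1_norm V (\<lambda>i. restart_deriv G F q \<phi> i b)"
    using damping by (simp add: l1_norm_nonneg)
  ultimately have sum_n': "(1 - \<alpha>) * (\<Sum>l\<in>V. n l) \<le> \<beta>" by linarith
  have "0 \<le> (1 - \<alpha>) * (\<Sum>l\<in>V. n l)" using damping by (simp add: sum_nonneg n_nonneg)
  with sum_n' show \<beta>: "0 \<le> \<beta>" by linarith
  have weighted: "l1_norm V (\<lambda>i. (1 - \<alpha>) * (\<Sum>l\<in>V. transition_deriv G F q \<phi> l i b * x l)) \<le>
      (1 - \<alpha>) * (\<Sum>l\<in>V. n l * \<bar>x l\<bar>)" for x
  proof -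
    have "l1_norm V (\<lambda>i. \<Sum>l\<in>V. x l * transition_deriv G F q \<phi> l i b) \<le> (\<Sum>l\<in>V. \<bar>x l\<bar> * n l)"
      unfolding n_def l1_norm_scale[symmetric] by (rule l1_norm_sum)
    then show ?thesis using damping by (simp add: l1_norm_scale mult.commute)
  qed
  have rhs: "l1_norm V (stationary_deriv_rhs b) \<le> \<beta>"
  proof -
    have "l1_norm V (stationary_deriv_rhs b) \<le> \<alpha> * l1_norm V (\<lambda>i. restart_deriv G F q \<phi> i b) +
        (1 - \<alpha>) * (\<Sum>l\<in>V. n l * \<bar>?\<pi> l\<bar>)"
      unfolding stationary_deriv_rhs_def
      using damping by (intro order_trans[OF l1_norm_triangle] add_mono weighted) (simp add: l1_norm_scale)
    also have "\<dots> \<le> \<alpha> * l1_norm V (\<lambda>i. restart_deriv G F q \<phi> i b) + (1 - \<alpha>) * (\<Sum>l\<in>V. n l * 1)"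
      using damping by (intro add_left_mono mult_left_mono sum_mono abs_stationary n_nonneg) auto
    finally show ?thesis using sum_n by simp
  qed
  have Z: "?Z i = stationary_deriv_rhs b i + (1 - \<alpha>) * (\<Sum>l\<in>V. transition_deriv G F q \<phi> l i b * ?e l)" for i
    by (simp add: stationary_deriv_rhs_def restart_jacobian transition_jacobian right_diff_distrib sum_subtractf)
  \<comment> \<open>The change of the source caused by inserting the approximate vector for the
    stationary one.\<close>
  define d where "d i = (1 - \<alpha>) * (\<Sum>l\<in>V. transition_deriv G F q \<phi> l i b * ?e l)" for i
  have d: "l1_norm V d \<le> \<beta> * (2 * c1)"
  proof -
    have "l1_norm V d \<le> (1 - \<alpha>) * (\<Sum>l\<in>V. n l * \<bar>?e l\<bar>)"
      unfolding d_def by (rule weighted)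
    \<comment> \<open>\<beta> controls the sum of all the norms \<open>n l\<close>, so a uniform
      bound on the entries of the vector error is enough.\<close>
    also have "\<dots> \<le> (1 - \<alpha>) * (\<Sum>l\<in>V. n l * (2 * c1))"
      using damping order_trans[OF abs_le_l1_norm[OF finite_nodes] e]
      by (intro mult_left_mono sum_mono n_nonneg) auto
    also have "\<dots> \<le> \<beta> * (2 * c1)"
      unfolding sum_distrib_right[symmetric] mult.assoc[symmetric] using c by (intro mult_right_mono sum_n') auto
    finally show ?thesis .
  qed
  have J_norm: "l1_norm V J \<le> \<beta> / \<alpha>"
    using fixpoint_bound[OF J] rhs damping by (simp add: divide_right_mono order_trans)
  have M_err: "l1_norm V (\<lambda>i. ?M i - J i) \<le> \<beta> / \<alpha> * (2 * c2 + 2 * c1)"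
  proof -
    have "?M i - J i = (1 / (1 - c2) * trunc_series \<alpha> V ?P N2 (stationary_deriv_rhs b) i - J i) +
        1 / (1 - c2) * trunc_series \<alpha> V ?P N2 d i" for i
    proof -
      have "?M i = 1 / (1 - c2) * trunc_series \<alpha> V ?P N2 (\<lambda>i. stationary_deriv_rhs b i + d i) i"
        unfolding mat_approx_eq c2_def Z d_def ..
      then show ?thesis by (simp add: trunc_series_add add_divide_distrib)
    qed
    then have "l1_norm V (\<lambda>i. ?M i - J i) \<le>
        l1_norm V (\<lambda>i. 1 / (1 - c2) * trunc_series \<alpha> V ?P N2 (stationary_deriv_rhs b) i - J i) +
        l1_norm V (\<lambda>i. 1 / (1 - c2) * trunc_series \<alpha> V ?P N2 d i)"
      by (simp only: l1_norm_triangle)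
    also have "\<dots> \<le> 2 * c2 / \<alpha> * l1_norm V (stationary_deriv_rhs b) + 1 / (1 - c2) * ((1 - c2) / \<alpha> * l1_norm V d)"
      using trunc_series_error[OF J, of N2, folded c2_def] l1_norm_trunc_series[of N2 d, folded c2_def] c
      unfolding l1_norm_scale by (intro add_mono mult_mono) (auto simp: l1_norm_nonneg)
    also have "\<dots> \<le> 2 * c2 / \<alpha> * \<beta> + 1 / (1 - c2) * ((1 - c2) / \<alpha> * (\<beta> * (2 * c1)))"
      using damping c by (intro add_mono mult_left_mono rhs d) auto
    also have "\<dots> = \<beta> / \<alpha> * (2 * c2 + 2 * c1)"
      using damping c by (simp add: field_simps)
    finally show ?thesis .
  qed
  have \<pi>'_norm: "l1_norm V ?\<pi>' = 1" by (simp add: l1_norm_def vec_approx_nonneg vec_approx_sum)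
  have H': "\<bar>residual_pullback G q ?\<pi>' i\<bar> \<le> real r" for i
    using abs_residual_pullback[of G q ?\<pi>' i] r by (simp add: \<pi>'_norm)
  have H: "\<bar>residual_pullback G q ?\<pi>' i - residual_pullback G q ?\<pi> i\<bar> \<le> real r * (2 * c1)" for i
  proof (rule order_trans[OF residual_pullback_diff])
    show "real (card (row_pairs G q)) * l1_norm V ?e \<le> real r * (2 * c1)"
      using r e by (intro mult_mono) (auto simp: l1_norm_nonneg)
  qed
  have "?lhs = (\<Sum>i\<in>V. (?M i - J i) * residual_pullback G q ?\<pi>' i) +
      (\<Sum>i\<in>V. J i * (residual_pullback G q ?\<pi>' i - residual_pullback G q ?\<pi> i))"
    by (simp add: sum.distrib[symmetric] sum_subtractf[symmetric] algebra_simps)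
  also have "\<bar>\<dots>\<bar> \<le> l1_norm V (\<lambda>i. ?M i - J i) * real r + l1_norm V J * (real r * (2 * c1))"
    by (intro order_trans[OF abs_triangle_ineq] add_mono abs_sum_mult_le H' H)
  also have "\<dots> \<le> \<beta> / \<alpha> * (2 * c2 + 2 * c1) * real r + \<beta> / \<alpha> * (real r * (2 * c1))"
    using c by (intro add_mono mult_right_mono M_err J_norm) auto
  also have "\<dots> = r * \<beta> / \<alpha> * (2 * c2 + 4 * c1)" by (simp add: algebra_simps add_divide_distrib)
  finally show "\<bar>?lhs\<bar> \<le> r * \<beta> / \<alpha> * (2 * (1 - \<alpha>) ^ (N2 + 1) + 4 * (1 - \<alpha>) ^ (N1 + 1))"
    unfolding c1_def c2_def .
qed

end

section \<open>The derivative of the loss and the total error\<close>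

lemma loss_has_derivative:
  assumes fin: "finite (queries G)"
    and J: "\<And>q i. q \<in> queries G \<Longrightarrow> i \<in> nodes G q \<Longrightarrow>
      ((\<lambda>\<psi>. stationary G F \<alpha> q \<psi> i) has_derivative (\<lambda>h. J q h i)) (at \<phi>)"
  shows "(loss G F \<alpha> has_derivative (\<lambda>h. 2 / real (card (queries G)) * (\<Sum>q\<in>queries G. \<Sum>i\<in>nodes G q.
      J q h i * residual_pullback G q (stationary G F \<alpha> q \<phi>) i))) (at \<phi>)"
proof -
  let ?u = "\<lambda>q \<rho> \<psi>. \<Sum>i\<in>nodes G q. pair_matrix \<rho> i * stationary G F \<alpha> q \<psi> i"
  have "((\<lambda>\<psi>. (ranking_residual G q (stationary G F \<alpha> q \<psi>) \<rho>)\<^sup>2) has_derivative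
      (\<lambda>h. (\<Sum>i\<in>nodes G q. pair_matrix \<rho> i * J q h i) * (2 * pos_part (?u q \<rho> \<phi>)))) (at \<phi>)"
    if "q \<in> queries G" for q \<rho>
  proof -
    have "(?u q \<rho> has_derivative (\<lambda>h. \<Sum>i\<in>nodes G q. pair_matrix \<rho> i * J q h i)) (at \<phi>)"
      by (intro has_derivative_sum has_derivative_mult_right J that)
    from has_derivative_in_compose[OF this,
        of "\<lambda>t. (pos_part t)\<^sup>2" "\<lambda>h. h * (2 * pos_part (?u q \<rho> \<phi>))"]
    show ?thesis
      using has_derivative_at_withinI[OF pos_part_square_deriv[of "?u q \<rho> \<phi>", unfolded has_field_derivative_def]]
      by (simp add: ranking_residual_def mult.commute[of _ "2 * _"])
  qed
  then have "((\<lambda>\<psi>. 1 / real (card (queries G)) * (\<Sum>q\<in>queries G. \<Sum>\<rho>\<in>row_pairs G q.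
        (ranking_residual G q (stationary G F \<alpha> q \<psi>) \<rho>)\<^sup>2)) has_derivative
      (\<lambda>h. 1 / real (card (queries G)) * (\<Sum>q\<in>queries G. \<Sum>\<rho>\<in>row_pairs G q.
        (\<Sum>i\<in>nodes G q. pair_matrix \<rho> i * J q h i) * (2 * pos_part (?u q \<rho> \<phi>))))) (at \<phi>)"
    by (intro has_derivative_mult_right has_derivative_sum)
  moreover have "loss G F \<alpha> = (\<lambda>\<psi>. 1 / real (card (queries G)) * (\<Sum>q\<in>queries G. \<Sum>\<rho>\<in>row_pairs G q.
        (ranking_residual G q (stationary G F \<alpha> q \<psi>) \<rho>)\<^sup>2))"
    by (simp add: fun_eq_iff loss_def L2_set_def sum_nonneg)
  moreover have "(\<Sum>\<rho>\<in>row_pairs G q. (\<Sum>i\<in>nodes G q. pair_matrix \<rho> i * J q h i) * (2 * pos_part (?u q \<rho> \<phi>)))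
      = 2 * (\<Sum>i\<in>nodes G q. J q h i * residual_pullback G q (stationary G F \<alpha> q \<phi>) i)" for q h
    unfolding residual_pullback_def ranking_residual_def sum_distrib_left sum_distrib_right
    by (subst sum.swap) (simp add: mult_ac)
  ultimately show ?thesis by (simp add: sum_distrib_left[symmetric])
qed

text \<open>From 1 - \<alpha> \<le> exp (- \<alpha>). Where \<open>nat\<close> cuts off a negative
  number, \<open>N + 1\<close> is larger than the ceiling, so the estimate survives for small
  \<open>y\<close> as well.\<close>

lemma truncation_length:
  fixes \<alpha> y :: real
  assumes "0 < \<alpha>" "\<alpha> < 1" "0 < y" "N = nat (\<lceil>1 / \<alpha> * ln y\<rceil> - 1)"
  shows "(1 - \<alpha>) ^ (N + 1) \<le> 1 / y"
proof -
  have "1 / \<alpha> * ln y \<le> real (N + 1)" using assms(4) by linarith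
  then have "ln y \<le> \<alpha> * real (N + 1)" using assms(1) by (simp add: field_simps)
  have "(1 - \<alpha>) ^ (N + 1) \<le> exp (- \<alpha>) ^ (N + 1)"
    using assms exp_ge_add_one_self[of "- \<alpha>"] by (intro power_mono) auto
  also have "\<dots> = exp (- (\<alpha> * real (N + 1)))"
    by (simp only: exp_of_nat_mult[symmetric]) (simp add: algebra_simps)
  also have "\<dots> \<le> exp (- ln y)" using \<open>ln y \<le> _\<close> by simp
  also have "\<dots> = 1 / y" using assms(3) by (simp add: exp_minus inverse_eq_divide)
  finally show ?thesis .
qed

lemma approx_gradient_inner:
  assumes "b \<in> Basis"
  shows "approx_gradient G F \<alpha> \<phi> N1 N2 \<bullet> b = 2 / real (card (queries G)) *
    (\<Sum>q\<in>queries G. \<Sum>i\<in>nodes G q.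
      mat_approx G F \<alpha> q \<phi> N1 N2 i b * residual_pullback G q (vec_approx G F \<alpha> q \<phi> N1) i)"
  unfolding approx_gradient_def inner_scaleR_left inner_sum_left residual_pullback_def
  using assms by (simp add: inner_Basis if_distrib cong: if_cong)

theorem approx_gradient_error:
  fixes F :: "('q, 'v, 'm1::finite, 'm2::finite) features"
  assumes inst: "\<And>q. q \<in> queries G \<Longrightarrow> query_instance G F \<alpha> q \<phi>"
    and graphs: "wf_query_graphs G" and damping: "0 < \<alpha>" "\<alpha> < 1" and delta: "0 < \<delta>"
    and beta: "\<forall>q\<in>queries G. \<alpha> * matrix_norm1 (nodes G q) Basis (param_jacobian (restart G F q) \<phi>) +
        (1 - \<alpha>) * (\<Sum>i\<in>nodes G q.
           matrix_norm1 (nodes G q) Basis (param_jacobian (\<lambda>\<theta>. transition G F q \<theta> i) \<phi>)) \<le> \<beta>"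
    and r: "r = max_rows G"
    and N1: "N1 = nat (\<lceil>1 / \<alpha> * ln (24 * \<beta> * real r / (\<alpha> * \<delta>))\<rceil> - 1)"
    and N2: "N2 = nat (\<lceil>1 / \<alpha> * ln (8 * \<beta> * real r / (\<alpha> * \<delta>))\<rceil> - 1)"
  shows "infnorm (approx_gradient G F \<alpha> \<phi> N1 N2 - gradient (loss G F \<alpha>) \<phi>) \<le> \<delta>"
proof -
  let ?Q = "queries G" and ?\<pi> = "\<lambda>q. stationary G F \<alpha> q \<phi>"
  have fin: "finite ?Q" and ne: "?Q \<noteq> {}" using graphs by (auto simp: wf_query_graphs_def)
  define K where "K = real r * \<beta> / \<alpha> * (2 * (1 - \<alpha>) ^ (N2 + 1) + 4 * (1 - \<alpha>) ^ (N1 + 1))"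
  have "\<exists>J. \<forall>q\<in>?Q.
      (\<forall>h. \<forall>i\<in>nodes G q. J q h i = query_instance.stationary_deriv_rhs G F \<alpha> q \<phi> h i +
        (1 - \<alpha>) * push (nodes G q) (transition G F q \<phi>) (J q h) i) \<and>
     (\<forall>i\<in>nodes G q. ((\<lambda>\<psi>. stationary G F \<alpha> q \<psi> i) has_derivative (\<lambda>h. J q h i)) (at \<phi>))"
    by (intro bchoice ballI query_instance.stationary_deriv_ex inst)
  then obtain J where
    J_fix: "\<And>q h i. q \<in> ?Q \<Longrightarrow> i \<in> nodes G q \<Longrightarrow> J q h i = query_instance.stationary_deriv_rhs G F \<alpha> q \<phi> h i +
        (1 - \<alpha>) * push (nodes G q) (transition G F q \<phi>) (J q h) i"
    and J_deriv: "\<And>q i. q \<in> ?Q \<Longrightarrow> i \<in> nodes G q \<Longrightarrow>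
      ((\<lambda>\<psi>. stationary G F \<alpha> q \<psi> i) has_derivative (\<lambda>h. J q h i)) (at \<phi>)"
    by blast
  note grad = gradient_inner[OF loss_has_derivative[OF fin J_deriv]]
  \<comment> \<open>\<open>K\<close> bounds the error of one query; the outer factor 2 / |Q| turns
    \<delta> / 2 per query into \<delta>.\<close>
  have K: "K \<le> \<delta> / 2"
  proof (cases "0 < \<beta> \<and> 0 < r")
    case True
    then have "(1 - \<alpha>) ^ (N1 + 1) \<le> 1 / (24 * \<beta> * real r / (\<alpha> * \<delta>))"
      "(1 - \<alpha>) ^ (N2 + 1) \<le> 1 / (8 * \<beta> * real r / (\<alpha> * \<delta>))"
      using damping delta by (intro truncation_length N1 N2; simp)+
    then have "K \<le> real r * \<beta> / \<alpha> * (2 * (1 / (8 * \<beta> * real r / (\<alpha> * \<delta>))) + 4 * (1 / (24 * \<beta> * real r / (\<alpha> * \<delta>))))"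
      unfolding K_def using True damping by (intro mult_left_mono add_mono) auto
    also have "\<dots> = 5 / 12 * \<delta>" using True damping by (simp add: field_simps)
    finally show ?thesis using delta by simp
  next
    \<comment> \<open>Here \<beta> or r is 0: the logarithms say nothing, but \<open>K\<close>
      itself vanishes. That \<beta> is not negative is read off from one query and one basis
      vector.\<close>
    case False
    obtain q where q: "q \<in> ?Q" using ne by blast
    interpret query_instance G F \<alpha> q \<phi> by (rule inst[OF q])
    obtain b :: "('m1, 'm2) param" where "b \<in> Basis" using nonempty_Basis by blast
    then have "0 \<le> \<beta>"
      using gradient_term_error(2)[of "J q b" b \<beta>, OF J_fix[OF q]] beta q by blast
    with False have "\<beta> = 0 \<or> r = 0" by auto
    then show ?thesis using delta by (auto simp: K_def)
  qed
  have "\<bar>(approx_gradient G F \<alpha> \<phi> N1 N2 - gradient (loss G F \<alpha>) \<phi>) \<bullet> b\<bar> \<le> \<delta>" if b: "b \<in> Basis" for b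
  proof -
    let ?a = "\<lambda>q. \<Sum>i\<in>nodes G q. mat_approx G F \<alpha> q \<phi> N1 N2 i b *
        residual_pullback G q (vec_approx G F \<alpha> q \<phi> N1) i"
    let ?g = "\<lambda>q. \<Sum>i\<in>nodes G q. J q b i * residual_pullback G q (?\<pi> q) i"
    have "\<bar>?a q - ?g q\<bar> \<le> \<delta> / 2" if q: "q \<in> ?Q" for q
    proof -
      interpret query_instance G F \<alpha> q \<phi> by (rule inst[OF q])
      have "\<bar>?a q - ?g q\<bar> \<le> K"
        unfolding K_def using beta q card_row_pairs[OF graphs q]
        by (intro gradient_term_error(1)[OF J_fix[OF q] b]) (auto simp: r)
      with K show ?thesis by linarith
    qed
    then have "(\<Sum>q\<in>?Q. \<bar>?a q - ?g q\<bar>) \<le> real (card ?Q) * (\<delta> / 2)"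
      by (rule sum_bounded_above)
    with sum_abs have "\<bar>\<Sum>q\<in>?Q. ?a q - ?g q\<bar> \<le> real (card ?Q) * (\<delta> / 2)"
      by (rule order_trans)
    moreover have "(approx_gradient G F \<alpha> \<phi> N1 N2 - gradient (loss G F \<alpha>) \<phi>) \<bullet> b =
        2 / real (card ?Q) * (\<Sum>q\<in>?Q. ?a q - ?g q)"
      by (simp add: inner_diff_left approx_gradient_inner[OF b] grad sum_subtractf right_diff_distrib)
    moreover have "0 < real (card ?Q)" using fin ne by (simp add: card_gt_0_iff)
    ultimately show ?thesis by (simp only: abs_mult) (simp add: field_simps)
  qed
  then show ?thesis unfolding infnorm_Max by (intro Max.boundedI) auto
qed

section \<open>The adjoint form of the approximate gradient\<close>

lemma sum_push_adjoint:
  "(\<Sum>i\<in>V. push V P x i * h i) = (\<Sum>i\<in>V. x i * push V (\<lambda>j i. P i j) h i)"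
  unfolding push_def sum_distrib_left sum_distrib_right by (subst sum.swap) (simp add: mult_ac)

lemma sum_push_pow_adjoint:
  "(\<Sum>i\<in>V. (push V P ^^ k) x i * h i) = (\<Sum>i\<in>V. x i * (push V (\<lambda>j i. P i j) ^^ k) h i)"
proof (induction k arbitrary: h)
  case (Suc k)
  have "(\<Sum>i\<in>V. (push V P ^^ Suc k) x i * h i) =
      (\<Sum>i\<in>V. (push V P ^^ k) x i * push V (\<lambda>j i. P i j) h i)"
    by (simp add: sum_push_adjoint)
  also have "\<dots> = (\<Sum>i\<in>V. x i * (push V (\<lambda>j i. P i j) ^^ Suc k) h i)"
    unfolding Suc.IH by (simp only: funpow_Suc_right comp_apply)
  finally show ?case .
qed simp

text \<open>Transposition applies termwise, the weights being scalars. The series on the right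
  depends only on \<open>h\<close>, so all columns of the Jacobian share it.\<close>

lemma sum_trunc_series_adjoint:
  "(\<Sum>i\<in>V. trunc_series \<alpha> V P N x i * h i) = (\<Sum>i\<in>V. x i * trunc_series \<alpha> V (\<lambda>j i. P i j) N h i)"
proof -
  have "(\<Sum>i\<in>V. trunc_series \<alpha> V P N x i * h i) =
      (\<Sum>k=0..N. (1 - \<alpha>) ^ k * (\<Sum>i\<in>V. (push V P ^^ k) x i * h i))"
    unfolding trunc_series_def sum_distrib_left sum_distrib_right by (subst sum.swap) (simp add: mult_ac)
  also have "\<dots> = (\<Sum>i\<in>V. x i * trunc_series \<alpha> V (\<lambda>j i. P i j) N h i)"
    unfolding sum_push_pow_adjoint trunc_series_def sum_distrib_left
    by (subst sum.swap) (simp add: mult_ac)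
  finally show ?thesis .
qed

text \<open>Collecting the coefficient of each \<open>e i\<close> replaces \<open>z\<close> by its
  difference from the \<open>p\<close>-weighted mean. With \<open>e\<close> a feature coordinate and
  \<open>p\<close> the probabilities, the left side is the numerator produced by the quotient
  rule.\<close>

lemma centered_sum:
  fixes e z p :: "'a \<Rightarrow> real"
  shows "(\<Sum>i\<in>X. e i * z i - p i * z i * (\<Sum>j\<in>X. e j)) = (\<Sum>i\<in>X. (z i - (\<Sum>j\<in>X. p j * z j)) * e i)"
  unfolding left_diff_distrib sum_subtractf sum_distrib_left[symmetric] sum_distrib_right[symmetric]
  by (simp add: mult.commute)

lemma pos_part_scale:
  assumes "0 \<le> c"
  shows "pos_part (c * x) = c * pos_part x"
proof (cases "0 \<le> x")
  case False
  then have "c * x \<le> 0" using assms by (simp add: mult_nonneg_nonpos)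
  with False show ?thesis by (simp add: pos_part_def)
qed (use assms in \<open>simp add: pos_part_def\<close>)

text \<open>The positive part commutes with nonnegative factors. Therefore the residual may be
  computed from an unnormalised iterate and corrected by one scalar at the end.\<close>

lemma residual_pullback_scale:
  "0 \<le> c \<Longrightarrow> residual_pullback G q (\<lambda>i. c * x i) = (\<lambda>i. c * residual_pullback G q x i)"
proof -
  assume c: "0 \<le> c"
  have "(\<Sum>i\<in>nodes G q. pair_matrix \<rho> i * (c * x i)) = c * (\<Sum>i\<in>nodes G q. pair_matrix \<rho> i * x i)" for \<rho>
    by (simp add: sum_distrib_left mult_ac)
  then have "residual_pullback G q (\<lambda>i. c * x i) i =
      (\<Sum>\<rho>\<in>row_pairs G q. pair_matrix \<rho> i * (c * ranking_residual G q x \<rho>))" for i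
    by (simp add: residual_pullback_def ranking_residual_def pos_part_scale[OF c])
  then show ?thesis
    by (simp add: fun_eq_iff residual_pullback_def sum_distrib_left mult.left_commute)
qed

definition param_basis :: "'m1 + 'm2 \<Rightarrow> ('m1::finite, 'm2::finite) param" where
  "param_basis k = (case k of Inl a \<Rightarrow> (axis a 1, 0) | Inr c \<Rightarrow> (0, axis c 1))"

lemma coord_eq_inner: "coord \<phi> k = \<phi> \<bullet> param_basis k"
  by (cases k) (auto simp: coord_def param_basis_def inner_prod_def inner_axis)

lemma param_basis_Basis: "param_basis k \<in> Basis"
  by (cases k) (auto simp: param_basis_def Basis_prod_def axis_in_Basis_iff)

definition dangling :: "('q, 'v) query_graphs \<Rightarrow> 'q \<Rightarrow> 'v set" where
  "dangling G q = {i \<in> nodes G q. out_nbrs G q i = {}}"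

text \<open>
  A single outgoing edge has transition probability \<open>1\<close> whatever the parameters are. If all outdegrees
  are at most \<open>1\<close>, the claimed number of operations leaves no room for treating such edges as the others.
\<close>

definition single_out :: "('q, 'v) query_graphs \<Rightarrow> 'q \<Rightarrow> 'v set" where
  "single_out G q = {i \<in> nodes G q. card (out_nbrs G q i) = 1}"

definition branching :: "('q, 'v) query_graphs \<Rightarrow> 'q \<Rightarrow> 'v set" where
  "branching G q = {i \<in> nodes G q. 2 \<le> card (out_nbrs G q i)}"

definition in_nbrs :: "('q, 'v) query_graphs \<Rightarrow> 'q \<Rightarrow> 'v \<Rightarrow> 'v set" where
  "in_nbrs G q i = {l. (l, i) \<in> edges G q}"

section \<open>Adjoint formulas for one query\<close>

context query_instance
begin

abbreviation "S0 \<equiv> \<Sum>l\<in>seeds G q. fst \<phi> \<bullet> node_feat F q l"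

abbreviation "S1 i \<equiv> \<Sum>l\<in>out_nbrs G q i. snd \<phi> \<bullet> edge_feat F q i l"

lemma out_nbrs_iff: "j \<in> out_nbrs G q i \<longleftrightarrow> (i, j) \<in> edges G q"
  by (simp add: out_nbrs_def)

lemma finite_in_nbrs: "finite (in_nbrs G q i)" and in_nbrs_sub: "in_nbrs G q i \<subseteq> V"
  using edges_sub finite_nodes by (auto simp: in_nbrs_def intro: finite_subset)

lemma node_cases:
  "V = dangling G q \<union> single_out G q \<union> branching G q" "dangling G q \<inter> single_out G q = {}"
  "(dangling G q \<union> single_out G q) \<inter> branching G q = {}"
proof -
  have d: "dangling G q = {i \<in> V. card (out_nbrs G q i) = 0}"
    using finite_out_nbrs by (auto simp: dangling_def)
  have c: "c = 0 \<or> c = 1 \<or> 2 \<le> c" for c :: nat by linarith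
  show "V = dangling G q \<union> single_out G q \<union> branching G q"
    unfolding d single_out_def branching_def using c by blast
  show "dangling G q \<inter> single_out G q = {}" "(dangling G q \<union> single_out G q) \<inter> branching G q = {}"
    unfolding d single_out_def branching_def by (simp_all only: disjoint_iff mem_Collect_eq Un_iff) linarith+
qed

lemma sum_nodes: "(\<Sum>l\<in>V. f l) = (\<Sum>l\<in>dangling G q. f l) + (\<Sum>l\<in>V - dangling G q. f l)" for f :: "'v \<Rightarrow> real"
  using finite_nodes by (subst sum.subset_diff[of "dangling G q"]) (auto simp: dangling_def)

text \<open>The row of every dangling node is the restart vector, so these nodes act through their
  total mass alone, and the summand 1 merges the source into the same product. A step then needs one
  multiplication per node, one addition per dangling node and two operations per edge.\<close>

lemma push_step:
  assumes "i \<in> V"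
  shows "(1 + (\<Sum>l\<in>dangling G q. y l)) * ((1 - \<alpha>) * restart G F q \<phi> i) +
      (\<Sum>l\<in>in_nbrs G q i. (1 - \<alpha>) * transition G F q \<phi> l i * y l) =
    (1 - \<alpha>) * restart G F q \<phi> i + (1 - \<alpha>) * push V (transition G F q \<phi>) y i"
proof -
  have "push V (transition G F q \<phi>) y i = (\<Sum>l\<in>dangling G q. restart G F q \<phi> i * y l) +
      (\<Sum>l\<in>V - dangling G q. transition G F q \<phi> l i * y l)"
    unfolding push_def sum_nodes by (simp add: dangling_def transition_def)
  also have "(\<Sum>l\<in>V - dangling G q. transition G F q \<phi> l i * y l) =
      (\<Sum>l\<in>in_nbrs G q i. transition G F q \<phi> l i * y l)"
    using finite_nodes in_nbrs_sub
    by (intro sum.mono_neutral_right) (auto simp: transition_def dangling_def in_nbrs_def out_nbrs_def)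
  finally have "push V (transition G F q \<phi>) y i = restart G F q \<phi> i * (\<Sum>l\<in>dangling G q. y l) +
      (\<Sum>l\<in>in_nbrs G q i. transition G F q \<phi> l i * y l)"
    by (simp only: sum_distrib_left)
  moreover have "(\<Sum>l\<in>in_nbrs G q i. (1 - \<alpha>) * transition G F q \<phi> l i * y l) =
      (1 - \<alpha>) * (\<Sum>l\<in>in_nbrs G q i. transition G F q \<phi> l i * y l)"
    by (simp only: sum_distrib_left mult.assoc)
  ultimately show ?thesis by (simp add: algebra_simps)
qed

lemma pull_dangling: "l \<in> dangling G q \<Longrightarrow> push V (\<lambda>j i. transition G F q \<phi> i j) z l = (\<Sum>j\<in>V. restart G F q \<phi> j * z j)"
  by (simp add: push_def transition_def dangling_def)

lemma pull_out_nbrs: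
  assumes "l \<in> V" "l \<notin> dangling G q"
  shows "push V (\<lambda>j i. transition G F q \<phi> i j) z l = (\<Sum>j\<in>out_nbrs G q l. transition G F q \<phi> l j * z j)"
  unfolding push_def using finite_nodes out_nbrs_sub assms
  by (intro sum.mono_neutral_right) (auto simp: transition_def dangling_def out_nbrs_def)

lemma transition_single_out:
  assumes "l \<in> single_out G q" "j \<in> out_nbrs G q l"
  shows "transition G F q \<phi> l j = 1" "out_nbrs G q l = {j}"
proof -
  from assms show out: "out_nbrs G q l = {j}" by (auto simp: single_out_def card_1_singleton_iff)
  with assms out_denom[of l] show "transition G F q \<phi> l j = 1"
    by (auto simp: single_out_def transition_def out_nbrs_def)
qed

text \<open>Conservation of mass makes division by the total reproduce exactly the prescribed
  normalisation. The extra factor 1 - \<alpha> in \<open>y\<close>, due to the scaled data held by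
  the program, cancels in this division.\<close>

lemma vec_approx_normalize:
  fixes N defines "y \<equiv> \<lambda>i. (1 - \<alpha>) * trunc_series \<alpha> V (transition G F q \<phi>) N (restart G F q \<phi>) i"
  shows "0 < sum y V" "y i = sum y V * vec_approx G F \<alpha> q \<phi> N i"
proof -
  have sum: "sum y V = (1 - \<alpha>) * ((1 - (1 - \<alpha>) ^ (N + 1)) / \<alpha>)"
    unfolding y_def sum_distrib_left[symmetric] sum_trunc_series restart_sum by simp
  then show "0 < sum y V" using damping pow_less_1[of N] by simp
  have "trunc_series \<alpha> V (transition G F q \<phi>) N (\<lambda>i. \<alpha> * restart G F q \<phi> i) i =
      \<alpha> * trunc_series \<alpha> V (transition G F q \<phi>) N (restart G F q \<phi>) i"
    unfolding trunc_series_def push_pow_scale by (simp add: sum_distrib_left mult_ac)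
  then show "y i = sum y V * vec_approx G F \<alpha> q \<phi> N i"
    unfolding vec_approx_eq sum unfolding y_def using damping pow_less_1[of N] by simp
qed

lemma sum_mat_approx:
  fixes N1 N2 defines "y \<equiv> \<lambda>i. (1 - \<alpha>) * trunc_series \<alpha> V (transition G F q \<phi>) N1 (restart G F q \<phi>) i"
  shows "(\<Sum>i\<in>V. mat_approx G F \<alpha> q \<phi> N1 N2 i b * residual_pullback G q (vec_approx G F \<alpha> q \<phi> N1) i) =
    1 / ((1 - (1 - \<alpha>) ^ (N2 + 1)) * sum y V) * (\<Sum>i\<in>V. mat_iter G F \<alpha> q \<phi> N1 0 i b *
      trunc_series \<alpha> V (\<lambda>j i. transition G F q \<phi> i j) N2 (residual_pullback G q y) i)"
proof -
  define t where "t = sum y V"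
  have t: "0 < t" unfolding t_def y_def by (rule vec_approx_normalize)
  have y: "y = (\<lambda>i. t * vec_approx G F \<alpha> q \<phi> N1 i)"
    unfolding t_def y_def by (rule ext) (rule vec_approx_normalize)
  have "residual_pullback G q y = (\<lambda>i. t * residual_pullback G q (vec_approx G F \<alpha> q \<phi> N1) i)"
    unfolding y using t by (intro residual_pullback_scale) simp
  then have h: "residual_pullback G q (vec_approx G F \<alpha> q \<phi> N1) = (\<lambda>i. 1 / t * residual_pullback G q y i)"
    using t by simp
  show ?thesis
    unfolding t_def[symmetric] mat_approx_eq h sum_trunc_series_adjoint[symmetric]
    by (simp add: sum_distrib_left mult_ac)
qed

text \<open>Node parameters act only through the restart vector and the dangling rows, which equal
  it; so this column of the initial matrix is a scalar multiple of one derivative. The scalings by 1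
  - \<alpha> match the register contents: \<open>Start\<close> holds the scaled restart vector,
  \<open>Total\<close> the divided normaliser.\<close>

lemma sum_mat_iter_Inl:
  fixes y z :: "'v \<Rightarrow> real"
  assumes \<tau>: "0 < \<tau>" and y: "\<And>i. y i = \<tau> * vec_approx G F \<alpha> q \<phi> N1 i"
  shows "(\<Sum>i\<in>V. mat_iter G F \<alpha> q \<phi> N1 0 i (param_basis (Inl k)) * z i) =
    (\<alpha> * \<tau> / (1 - \<alpha>) + (\<Sum>l\<in>dangling G q. y l)) / (S0 / (1 - \<alpha>)) / \<tau> *
    (\<Sum>i\<in>seeds G q. (z i - (\<Sum>j\<in>V. (1 - \<alpha>) * restart G F q \<phi> j * z j) / (1 - \<alpha>)) * node_feat F q i $ k)"
proof -
  let ?b = "param_basis (Inl k) :: ('m1, 'm2) param" and ?\<pi> = "vec_approx G F \<alpha> q \<phi> N1"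
  let ?c = "\<Sum>j\<in>V. restart G F q \<phi> j * z j" and ?D = "\<Sum>l\<in>dangling G q. y l"
  have td: "(\<Sum>l\<in>V. transition_deriv G F q \<phi> l i ?b * ?\<pi> l) = restart_deriv G F q \<phi> i ?b * (?D / \<tau>)" for i
  proof -
    have "(\<Sum>l\<in>V. transition_deriv G F q \<phi> l i ?b * ?\<pi> l) =
        (\<Sum>l\<in>dangling G q. restart_deriv G F q \<phi> i ?b * ?\<pi> l)"
      using finite_nodes
      by (intro sum.mono_neutral_cong_right) (auto simp: transition_deriv_def dangling_def param_basis_def)
    also have "\<dots> = restart_deriv G F q \<phi> i ?b * (?D / \<tau>)"
      using \<tau> by (simp add: y sum_distrib_left[symmetric])
    finally show ?thesis .
  qed
  have M: "mat_iter G F \<alpha> q \<phi> N1 0 i ?b = (\<alpha> + (1 - \<alpha>) * ?D / \<tau>) * restart_deriv G F q \<phi> i ?b" for i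
    by (simp add: restart_jacobian transition_jacobian td) (simp add: algebra_simps)
  have "(\<Sum>i\<in>V. restart_deriv G F q \<phi> i ?b * z i) = (\<Sum>i\<in>seeds G q. restart_deriv G F q \<phi> i ?b * z i)"
    using finite_nodes seeds_sub by (intro sum.mono_neutral_right) (auto simp: restart_deriv_def)
  also have "\<dots> = (\<Sum>i\<in>seeds G q. node_feat F q i $ k * z i -
      restart G F q \<phi> i * z i * (\<Sum>l\<in>seeds G q. node_feat F q l $ k)) / S0"
    unfolding sum_divide_distrib
    by (intro sum.cong refl) (simp add: restart_deriv_def param_basis_def inner_axis' algebra_simps diff_divide_distrib)
  also have "(\<Sum>i\<in>seeds G q. node_feat F q i $ k * z i -
      restart G F q \<phi> i * z i * (\<Sum>l\<in>seeds G q. node_feat F q l $ k)) =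
      (\<Sum>i\<in>seeds G q. (z i - (\<Sum>j\<in>seeds G q. restart G F q \<phi> j * z j)) * node_feat F q i $ k)"
    by (rule centered_sum)
  also have "(\<Sum>i\<in>seeds G q. restart G F q \<phi> i * z i) = ?c"
    using finite_nodes seeds_sub by (intro sum.mono_neutral_left) (auto simp: restart_def)
  finally have R: "(\<Sum>i\<in>V. restart_deriv G F q \<phi> i ?b * z i) = (\<Sum>i\<in>seeds G q. (z i - ?c) * node_feat F q i $ k) / S0" .
  have c: "(\<Sum>j\<in>V. (1 - \<alpha>) * restart G F q \<phi> j * z j) / (1 - \<alpha>) = ?c"
    using damping by (simp add: sum_distrib_left[symmetric] mult.assoc)
  have "(\<Sum>i\<in>V. mat_iter G F \<alpha> q \<phi> N1 0 i ?b * z i) =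
      (\<alpha> + (1 - \<alpha>) * ?D / \<tau>) * ((\<Sum>i\<in>seeds G q. (z i - ?c) * node_feat F q i $ k) / S0)"
    unfolding M R[symmetric] by (simp add: sum_distrib_left mult.assoc)
  also have "\<alpha> + (1 - \<alpha>) * ?D / \<tau> = (\<alpha> * \<tau> / (1 - \<alpha>) + ?D) * (1 - \<alpha>) / \<tau>"
    using damping \<tau> by (simp add: field_simps)
  finally show ?thesis unfolding c using damping by simp
qed

text \<open>Edge parameters do not affect restart or dangling rows, and a row with a single edge is
  constant. Only branching rows survive, each centred at its own mean of \<open>z\<close>.\<close>

lemma sum_mat_iter_Inr:
  fixes y z :: "'v \<Rightarrow> real"
  assumes \<tau>: "0 < \<tau>" and y: "\<And>i. y i = \<tau> * vec_approx G F \<alpha> q \<phi> N1 i"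
  shows "(\<Sum>i\<in>V. mat_iter G F \<alpha> q \<phi> N1 0 i (param_basis (Inr k)) * z i) =
    (\<Sum>l\<in>branching G q. \<Sum>j\<in>out_nbrs G q l.
      (z j - (\<Sum>i\<in>out_nbrs G q l. (1 - \<alpha>) * transition G F q \<phi> l i * z i) / (1 - \<alpha>)) *
      (y l / (S1 l / (1 - \<alpha>))) * edge_feat F q l j $ k) / \<tau>"
proof -
  let ?b = "param_basis (Inr k) :: ('m1, 'm2) param" and ?\<pi> = "vec_approx G F \<alpha> q \<phi> N1"
  let ?p = "\<lambda>l. \<Sum>i\<in>out_nbrs G q l. transition G F q \<phi> l i * z i"
  have rd: "restart_deriv G F q \<phi> i ?b = 0" for i
    by (simp add: restart_deriv_def param_basis_def)
  have td: "(\<Sum>i\<in>V. transition_deriv G F q \<phi> l i ?b * z i) =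
      (if l \<in> branching G q then (\<Sum>j\<in>out_nbrs G q l. (z j - ?p l) * edge_feat F q l j $ k) / S1 l else 0)"
    if l: "l \<in> V" for l
  proof (cases "l \<in> dangling G q")
    case True
    then show ?thesis using node_cases(3) by (auto simp: transition_deriv_def dangling_def rd)
  next
    case False
    with l have ne: "out_nbrs G q l \<noteq> {}" by (simp add: dangling_def)
    have "(\<Sum>i\<in>V. transition_deriv G F q \<phi> l i ?b * z i) =
        (\<Sum>i\<in>out_nbrs G q l. transition_deriv G F q \<phi> l i ?b * z i)"
      using finite_nodes out_nbrs_sub ne
      by (intro sum.mono_neutral_right) (auto simp: transition_deriv_def out_nbrs_iff)
    also have "\<dots> = (\<Sum>i\<in>out_nbrs G q l. edge_feat F q l i $ k * z i -
        transition G F q \<phi> l i * z i * (\<Sum>j\<in>out_nbrs G q l. edge_feat F q l j $ k)) / S1 l"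
      unfolding sum_divide_distrib using ne
      by (intro sum.cong refl)
        (simp add: transition_deriv_def out_nbrs_iff param_basis_def inner_axis' algebra_simps diff_divide_distrib)
    also have "(\<Sum>i\<in>out_nbrs G q l. edge_feat F q l i $ k * z i -
        transition G F q \<phi> l i * z i * (\<Sum>j\<in>out_nbrs G q l. edge_feat F q l j $ k)) =
        (\<Sum>j\<in>out_nbrs G q l. (z j - ?p l) * edge_feat F q l j $ k)"
      by (rule centered_sum)
    finally have sum: "(\<Sum>i\<in>V. transition_deriv G F q \<phi> l i ?b * z i) =
        (\<Sum>j\<in>out_nbrs G q l. (z j - ?p l) * edge_feat F q l j $ k) / S1 l" .
    show ?thesis
    proof (cases "l \<in> branching G q")
      case False
      with l \<open>l \<notin> dangling G q\<close> have "l \<in> single_out G q" using node_cases(1) by auto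
      \<comment> \<open>The only out-neighbour carries probability 1, so the mean is the value at
        that neighbour.\<close>
      then have "z j - ?p l = 0" if "j \<in> out_nbrs G q l" for j
        using transition_single_out[OF \<open>l \<in> single_out G q\<close> that] by simp
      with sum False show ?thesis by simp
    qed (simp add: sum)
  qed
  have "(\<Sum>i\<in>V. mat_iter G F \<alpha> q \<phi> N1 0 i ?b * z i) =
      (\<Sum>i\<in>V. \<Sum>l\<in>V. (1 - \<alpha>) * ?\<pi> l * (transition_deriv G F q \<phi> l i ?b * z i))"
    by (simp add: restart_jacobian rd transition_jacobian sum_distrib_left sum_distrib_right mult_ac)
  also have "\<dots> = (\<Sum>l\<in>V. (1 - \<alpha>) * ?\<pi> l * (\<Sum>i\<in>V. transition_deriv G F q \<phi> l i ?b * z i))"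
    by (subst sum.swap) (simp add: sum_distrib_left)
  also have "\<dots> = (\<Sum>l\<in>branching G q. (1 - \<alpha>) * ?\<pi> l *
      ((\<Sum>j\<in>out_nbrs G q l. (z j - ?p l) * edge_feat F q l j $ k) / S1 l))"
    using finite_nodes by (intro sum.mono_neutral_cong_right) (auto simp: td branching_def)
  also have "\<dots> = (\<Sum>l\<in>branching G q. \<Sum>j\<in>out_nbrs G q l.
      (z j - ?p l) * (y l / (S1 l / (1 - \<alpha>))) * edge_feat F q l j $ k) / \<tau>"
  proof -
    have "(\<Sum>j\<in>out_nbrs G q l. (z j - ?p l) * (y l / (S1 l / (1 - \<alpha>))) * edge_feat F q l j $ k) =
        y l / (S1 l / (1 - \<alpha>)) * (\<Sum>j\<in>out_nbrs G q l. (z j - ?p l) * edge_feat F q l j $ k)" for l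
      by (simp only: sum_distrib_left mult_ac)
    then show ?thesis using \<tau> by (simp add: sum_divide_distrib[of _ _ \<tau>] y mult_ac)
  qed
  also have "?p = (\<lambda>l. (\<Sum>i\<in>out_nbrs G q l. (1 - \<alpha>) * transition G F q \<phi> l i * z i) / (1 - \<alpha>))"
    using damping by (simp add: sum_distrib_left[symmetric] mult.assoc)
  finally show ?thesis .
qed

end

section \<open>Straight-line programs with symbolic registers\<close>

text \<open>The instruction set over an arbitrary type of register names. Correctness is argued for
  named registers; \<open>place\<close> assigns numeric addresses afterwards, separately for each
  query.\<close>

datatype ('r, 'i) source = SReg 'r | SInp 'i | SConst int

datatype ('r, 'i) command = Load 'r "('r, 'i) source" | Apply 'r arith_op "('r, 'i) source" "('r, 'i) source"

primrec source_val :: "('i \<Rightarrow> real) \<Rightarrow> ('r \<Rightarrow> real) \<Rightarrow> ('r, 'i) source \<Rightarrow> real" where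
  "source_val inp \<sigma> (SReg r) = \<sigma> r"
| "source_val inp \<sigma> (SInp i) = inp i"
| "source_val inp \<sigma> (SConst c) = of_int c"

primrec step :: "('i \<Rightarrow> real) \<Rightarrow> ('r, 'i) command \<Rightarrow> ('r \<Rightarrow> real) \<Rightarrow> ('r \<Rightarrow> real) option" where
  "step inp (Load r x) \<sigma> = Some (\<sigma>(r := source_val inp \<sigma> x))"
| "step inp (Apply r f x y) \<sigma> =
     map_option (\<lambda>v. \<sigma>(r := v)) (apply_op f (source_val inp \<sigma> x) (source_val inp \<sigma> y))"

primrec run :: "('i \<Rightarrow> real) \<Rightarrow> ('r, 'i) command list \<Rightarrow> ('r \<Rightarrow> real) \<Rightarrow> ('r \<Rightarrow> real) option" where
  "run inp [] \<sigma> = Some \<sigma>"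
| "run inp (c # cs) \<sigma> = Option.bind (step inp c \<sigma>) (run inp cs)"

primrec source_regs :: "('r, 'i) source \<Rightarrow> 'r set" where
  "source_regs (SReg r) = {r}"
| "source_regs (SInp i) = {}"
| "source_regs (SConst c) = {}"

primrec command_regs :: "('r, 'i) command \<Rightarrow> 'r set" where
  "command_regs (Load r x) = insert r (source_regs x)"
| "command_regs (Apply r f x y) = insert r (source_regs x \<union> source_regs y)"

definition regs :: "('r, 'i) command list \<Rightarrow> 'r set" where
  "regs cs = (\<Union>c\<in>set cs. command_regs c)"

primrec command_ops :: "('r, 'i) command \<Rightarrow> nat" where
  "command_ops (Load r x) = 0"
| "command_ops (Apply r f x y) = 1"

definition ops :: "('r, 'i) command list \<Rightarrow> nat" where
  "ops cs = (\<Sum>c\<leftarrow>cs. command_ops c)"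

primrec place_source :: "('r \<Rightarrow> nat) \<Rightarrow> ('r, 'i) source \<Rightarrow> 'i operand" where
  "place_source \<rho> (SReg r) = Reg (\<rho> r)"
| "place_source \<rho> (SInp i) = Inp i"
| "place_source \<rho> (SConst c) = Const c"

primrec place :: "('r \<Rightarrow> nat) \<Rightarrow> ('r, 'i) command \<Rightarrow> 'i instr" where
  "place \<rho> (Load r x) = Move (\<rho> r) (place_source \<rho> x)"
| "place \<rho> (Apply r f x y) = Arith (\<rho> r) f (place_source \<rho> x) (place_source \<rho> y)"

lemma run_append [simp]: "run inp (cs @ ds) \<sigma> = Option.bind (run inp cs \<sigma>) (run inp ds)"
proof (induction cs arbitrary: \<sigma>)
  case (Cons c cs)
  then show ?case by (cases "step inp c \<sigma>") simp_all
qed simp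

lemma ops_simps [simp]:
  "ops [] = 0" "ops (c # cs) = command_ops c + ops cs" "ops (cs @ ds) = ops cs + ops ds"
  by (simp_all add: ops_def)

lemma regs_simps [simp]:
  "regs [] = {}" "regs (c # cs) = command_regs c \<union> regs cs" "regs (cs @ ds) = regs cs \<union> regs ds"
  by (auto simp: regs_def)

lemma arith_ops_place: "arith_ops (map (place \<rho>) cs) = ops cs"
proof (induction cs)
  case (Cons c cs)
  then show ?case by (cases c) (simp_all add: arith_ops_def)
qed (simp add: arith_ops_def)

lemma instr_regs_place:
  fixes c :: "('r, 'i) command"
  shows "instr_regs (place \<rho> c) = \<rho> ` command_regs c"
proof -
  have "operand_regs (place_source \<rho> x) = \<rho> ` source_regs x" for x :: "('r, 'i) source"
    by (cases x) auto
  then show ?thesis by (cases c) auto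
qed

lemma instr_regs_place_list: "(\<Union>c\<in>set (map (place \<rho>) cs). instr_regs c) = \<rho> ` regs cs"
  by (auto simp: regs_def instr_regs_place)

lemma exec_append: "exec inp (cs @ ds) mem = Option.bind (exec inp cs mem) (exec inp ds)"
proof (induction cs arbitrary: mem)
  case (Cons c cs)
  then show ?case by (cases "exec_instr inp c mem") simp_all
qed simp

text \<open>Injectivity keeps different names in different cells, so each command is simulated by
  its placed version. The relation speaks only about \<open>A\<close>; all other memory is
  arbitrary.\<close>

lemma exec_place:
  assumes inj: "inj_on \<rho> A" and sub: "regs cs \<subseteq> A"
    and mem: "\<And>r. r \<in> A \<Longrightarrow> mem (\<rho> r) = \<sigma> r" and run: "run inp cs \<sigma> = Some \<sigma>'"
  shows "\<exists>mem'. exec inp (map (place \<rho>) cs) mem = Some mem' \<and> (\<forall>r\<in>A. mem' (\<rho> r) = \<sigma>' r)"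
  using sub mem run
proof (induction cs arbitrary: mem \<sigma>)
  case Nil
  then show ?case by simp
next
  case (Cons c cs)
  have val: "operand_val inp mem (place_source \<rho> x) = source_val inp \<sigma> x" if "source_regs x \<subseteq> A" for x
    using that Cons.prems(2) by (cases x) auto
  have upd: "(mem(\<rho> r := v)) (\<rho> r') = (\<sigma>(r := v)) r'" if "r \<in> A" "r' \<in> A" for r r' v
    using that inj Cons.prems(2) by (auto simp: inj_on_def)
  obtain \<sigma>1 where \<sigma>1: "step inp c \<sigma> = Some \<sigma>1" "run inp cs \<sigma>1 = Some \<sigma>'"
    using Cons.prems(3) by (auto simp: bind_eq_Some_conv)
  have "\<exists>mem1. exec_instr inp (place \<rho> c) mem = Some mem1 \<and> (\<forall>r\<in>A. mem1 (\<rho> r) = \<sigma>1 r)"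
  proof (cases c)
    case (Load r x)
    then show ?thesis using \<sigma>1(1) Cons.prems(1) val upd by auto
  next
    case (Apply r f x y)
    with Cons.prems(1) have *: "r \<in> A" "source_regs x \<subseteq> A" "source_regs y \<subseteq> A" by auto
    obtain v where v: "apply_op f (source_val inp \<sigma> x) (source_val inp \<sigma> y) = Some v" "\<sigma>1 = \<sigma>(r := v)"
      using \<sigma>1(1) Apply by auto
    have "exec_instr inp (place \<rho> c) mem = Some (mem(\<rho> r := v))"
      using Apply v(1) val[OF *(2)] val[OF *(3)] by simp
    then show ?thesis using v(2) upd[OF *(1)] by auto
  qed
  then obtain mem1 where mem1: "exec_instr inp (place \<rho> c) mem = Some mem1"
    "\<And>r. r \<in> A \<Longrightarrow> mem1 (\<rho> r) = \<sigma>1 r" by blast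
  show ?case using Cons.IH[OF _ mem1(2) \<sigma>1(2)] Cons.prems(1) mem1(1) by simp
qed

section \<open>Loops over finite sets\<close>

definition enum :: "'a set \<Rightarrow> 'a list" where
  "enum X = (SOME xs. set xs = X \<and> distinct xs)"

definition for_each :: "'a set \<Rightarrow> ('a \<Rightarrow> ('r, 'i) command list) \<Rightarrow> ('r, 'i) command list" where
  "for_each X body = concat (map body (enum X))"

lemma enum: "finite X \<Longrightarrow> set (enum X) = X" "finite X \<Longrightarrow> distinct (enum X)"
  using someI_ex[OF finite_distinct_list, of X] by (auto simp: enum_def)

lemma ops_for_each [simp]: "finite X \<Longrightarrow> ops (for_each X body) = (\<Sum>x\<in>X. ops (body x))"
proof -
  assume X: "finite X"
  have "ops (concat (map body xs)) = (\<Sum>x\<leftarrow>xs. ops (body x))" for xs by (induction xs) auto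
  then show ?thesis
    using enum[OF X] by (simp add: for_each_def sum_list_distinct_conv_sum_set)
qed

lemma regs_for_each [simp]: "finite X \<Longrightarrow> regs (for_each X body) = (\<Union>x\<in>X. regs (body x))"
  by (auto simp: for_each_def enum regs_def)

text \<open>The invariant \<open>S\<close> is indexed by the set already processed, so that proofs
  never mention the arbitrary order chosen by \<open>enum\<close>.\<close>

lemma run_for_each:
  assumes X: "finite X" and base: "S {} = \<sigma>" and final: "S X = \<sigma>'"
    and body: "\<And>A x. A \<subseteq> X \<Longrightarrow> finite A \<Longrightarrow> x \<in> X \<Longrightarrow> x \<notin> A \<Longrightarrow>
      run inp (body x) (S A) = Some (S (insert x A))"
  shows "run inp (for_each X body) \<sigma> = Some \<sigma>'"
proof -
  have "run inp (concat (map body xs)) (S A) = Some (S (A \<union> set xs))"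
    if "distinct xs" "set xs \<subseteq> X" "A \<subseteq> X" "A \<inter> set xs = {}" for xs A
    using that
  proof (induction xs arbitrary: A)
    case (Cons x xs)
    have "run inp (body x) (S A) = Some (S (insert x A))"
      using Cons.prems X by (intro body) (auto intro: finite_subset)
    then show ?case using Cons.IH[of "insert x A"] Cons.prems by simp
  qed simp
  from this[of "enum X" "{}"] show ?thesis using enum[OF X] base final by (simp add: for_each_def)
qed

lemma run_repeat:
  assumes "S 0 = \<sigma>" "\<And>k. k < n \<Longrightarrow> run inp cs (S k) = Some (S (Suc k))"
  shows "run inp (concat (replicate n cs)) \<sigma> = Some (S n)"
proof -
  have "run inp (concat (replicate m cs)) (S k) = Some (S (k + m))" if "k + m \<le> n" for k m
    using that
  proof (induction m arbitrary: k)
    case (Suc m)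
    then show ?case using assms(2)[of k] Suc.IH[of "Suc k"] by simp
  qed simp
  from this[of 0 n] assms(1) show ?thesis by simp
qed

lemma ops_repeat [simp]: "ops (concat (replicate n cs)) = n * ops cs"
  by (induction n) auto

lemma regs_repeat: "regs (concat (replicate n cs)) \<subseteq> regs cs"
  by (induction n) auto

definition clear :: "'r set \<Rightarrow> ('r, 'i) command list" where
  "clear X = for_each X (\<lambda>r. [Load r (SConst 0)])"

definition add_all :: "'r \<Rightarrow> 'a set \<Rightarrow> ('a \<Rightarrow> ('r, 'i) source) \<Rightarrow> ('r, 'i) command list" where
  "add_all a X f = for_each X (\<lambda>x. [Apply a Add (SReg a) (f x)])"

definition add_products ::
  "'r \<Rightarrow> 'r \<Rightarrow> 'a set \<Rightarrow> ('a \<Rightarrow> ('r, 'i) source) \<Rightarrow> ('a \<Rightarrow> ('r, 'i) source) \<Rightarrow> ('r, 'i) command list"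
  where
  "add_products t a X f g =
     for_each X (\<lambda>x. [Apply t Mul (f x) (g x), Apply a Add (SReg a) (SReg t), Load t (SConst 0)])"

lemma source_val_upd: "r \<notin> source_regs x \<Longrightarrow> source_val inp (\<sigma>(r := v)) x = source_val inp \<sigma> x"
  by (cases x) auto

lemma run_clear: "finite X \<Longrightarrow> run inp (clear X) \<sigma> = Some (\<lambda>r. if r \<in> X then 0 else \<sigma> r)"
  unfolding clear_def
  by (rule run_for_each[where S = "\<lambda>A r. if r \<in> A then 0 else \<sigma> r"]) (auto simp: fun_eq_iff)

lemma run_add_all:
  assumes "finite X" "\<And>x. x \<in> X \<Longrightarrow> a \<notin> source_regs (f x)"
  shows "run inp (add_all a X f) \<sigma> = Some (\<sigma>(a := \<sigma> a + (\<Sum>x\<in>X. source_val inp \<sigma> (f x))))"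
  unfolding add_all_def
  by (rule run_for_each[where S = "\<lambda>A. \<sigma>(a := \<sigma> a + (\<Sum>x\<in>A. source_val inp \<sigma> (f x)))"])
    (use assms in \<open>auto simp: source_val_upd add_ac\<close>)

text \<open>The scratch register \<open>t\<close> is returned to \<open>0\<close>, so that the effect is a function of the state alone.\<close>

lemma run_add_products:
  assumes "finite X" "\<And>x. x \<in> X \<Longrightarrow> {a, t} \<inter> (source_regs (f x) \<union> source_regs (g x)) = {}"
    "\<sigma> t = 0" "t \<noteq> a"
  shows "run inp (add_products t a X f g) \<sigma> =
    Some (\<sigma>(a := \<sigma> a + (\<Sum>x\<in>X. source_val inp \<sigma> (f x) * source_val inp \<sigma> (g x))))"
  unfolding add_products_def
proof (rule run_for_each[where S = "\<lambda>A. \<sigma>(a := \<sigma> a + (\<Sum>x\<in>A. source_val inp \<sigma> (f x) * source_val inp \<sigma> (g x)))"])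
  fix A x
  assume "finite A" "x \<in> X" "x \<notin> A"
  moreover have "\<sigma>(t := 0) = \<sigma>" using assms(3) by auto
  ultimately show "run inp [Apply t Mul (f x) (g x), Apply a Add (SReg a) (SReg t), Load t (SConst 0)]
      (\<sigma>(a := \<sigma> a + (\<Sum>x\<in>A. source_val inp \<sigma> (f x) * source_val inp \<sigma> (g x)))) =
    Some (\<sigma>(a := \<sigma> a + (\<Sum>x\<in>insert x A. source_val inp \<sigma> (f x) * source_val inp \<sigma> (g x))))"
    using assms(2)[OF \<open>x \<in> X\<close>] assms(3,4) by (auto simp: source_val_upd fun_eq_iff)
qed (use assms in auto)

lemma ops_add_all [simp]: "finite X \<Longrightarrow> ops (add_all a X f) = card X"
  by (simp add: add_all_def)

lemma ops_add_products [simp]: "finite X \<Longrightarrow> ops (add_products t a X f g) = 2 * card X"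
  by (simp add: add_products_def)

lemma ops_clear [simp]: "finite X \<Longrightarrow> ops (clear X) = 0"
  by (simp add: clear_def)

lemma regs_clear [simp]: "finite X \<Longrightarrow> regs (clear X) = X"
  by (simp add: clear_def)

section \<open>The program for one query\<close>

text \<open>\<open>Edge\<close> and \<open>Start\<close> hold transition and restart probabilities
  times 1 - \<alpha>; \<open>Den\<close> and \<open>Total\<close> hold their denominators divided by
  1 - \<alpha>. \<open>Cur\<close> is the vector iterate, \<open>Adj\<close> the adjoint one,
  \<open>New\<close> the buffer for the next value, \<open>Resid\<close> the pulled back residual.
  \<open>Mass\<close> and \<open>Dang\<close> are the totals of \<open>Cur\<close> over all and over
  dangling nodes, \<open>Damp\<close> is 1 - \<alpha>, \<open>Pow\<close> a power of it,
  \<open>Fac\<close> the common output factor. Several are reused as scratch in the output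
  phase.\<close>

datatype ('v, 'k) reg =
    Edge 'v 'v | Start 'v | Cur 'v | New 'v | Resid 'v | Adj 'v | Den 'v | Out 'k
  | Damp | Total | Mass | Dang | Pow | Fac | Tmp | Acc

text \<open>A state in record form. Register updates become record updates, so that the invariants
  of the loops can name whole families of registers at once.\<close>

record ('v, 'k) memory =
  m_edge :: "'v \<Rightarrow> 'v \<Rightarrow> real"
  m_start :: "'v \<Rightarrow> real"
  m_cur :: "'v \<Rightarrow> real"
  m_new :: "'v \<Rightarrow> real"
  m_resid :: "'v \<Rightarrow> real"
  m_adj :: "'v \<Rightarrow> real"
  m_den :: "'v \<Rightarrow> real"
  m_out :: "'k \<Rightarrow> real"
  m_damp :: real
  m_total :: real
  m_mass :: real
  m_dang :: real
  m_pow :: real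
  m_fac :: real
  m_tmp :: real
  m_acc :: real

primrec store :: "('v, 'k) memory \<Rightarrow> ('v, 'k) reg \<Rightarrow> real" where
  "store s (Edge i j) = m_edge s i j"
| "store s (Start i) = m_start s i"
| "store s (Cur i) = m_cur s i"
| "store s (New i) = m_new s i"
| "store s (Resid i) = m_resid s i"
| "store s (Adj i) = m_adj s i"
| "store s (Den i) = m_den s i"
| "store s (Out k) = m_out s k"
| "store s Damp = m_damp s"
| "store s Total = m_total s"
| "store s Mass = m_mass s"
| "store s Dang = m_dang s"
| "store s Pow = m_pow s"
| "store s Fac = m_fac s"
| "store s Tmp = m_tmp s"
| "store s Acc = m_acc s"

lemma store_eqI:
  assumes "\<And>i j. m_edge s i j = m_edge t i j" "\<And>i. m_start s i = m_start t i" "\<And>i. m_cur s i = m_cur t i"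
    "\<And>i. m_new s i = m_new t i" "\<And>i. m_resid s i = m_resid t i" "\<And>i. m_adj s i = m_adj t i"
    "\<And>i. m_den s i = m_den t i" "\<And>k. m_out s k = m_out t k"
    "m_damp s = m_damp t" "m_total s = m_total t" "m_mass s = m_mass t" "m_dang s = m_dang t"
    "m_pow s = m_pow t" "m_fac s = m_fac t" "m_tmp s = m_tmp t" "m_acc s = m_acc t"
  shows "store s = store t"
proof
  fix r show "store s r = store t r" by (cases r) (simp_all add: assms)
qed

lemma store_upd [simp]:
  "(store s)(Edge i j := x) = store (s\<lparr>m_edge := (m_edge s)(i := (m_edge s i)(j := x))\<rparr>)"
  "(store s)(Start i := x) = store (s\<lparr>m_start := (m_start s)(i := x)\<rparr>)"
  "(store s)(Cur i := x) = store (s\<lparr>m_cur := (m_cur s)(i := x)\<rparr>)"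
  "(store s)(New i := x) = store (s\<lparr>m_new := (m_new s)(i := x)\<rparr>)"
  "(store s)(Resid i := x) = store (s\<lparr>m_resid := (m_resid s)(i := x)\<rparr>)"
  "(store s)(Adj i := x) = store (s\<lparr>m_adj := (m_adj s)(i := x)\<rparr>)"
  "(store s)(Den i := x) = store (s\<lparr>m_den := (m_den s)(i := x)\<rparr>)"
  "(store s)(Out k := x) = store (s\<lparr>m_out := (m_out s)(k := x)\<rparr>)"
  "(store s)(Damp := x) = store (s\<lparr>m_damp := x\<rparr>)"
  "(store s)(Total := x) = store (s\<lparr>m_total := x\<rparr>)"
  "(store s)(Mass := x) = store (s\<lparr>m_mass := x\<rparr>)"
  "(store s)(Dang := x) = store (s\<lparr>m_dang := x\<rparr>)"
  "(store s)(Pow := x) = store (s\<lparr>m_pow := x\<rparr>)"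
  "(store s)(Fac := x) = store (s\<lparr>m_fac := x\<rparr>)"
  "(store s)(Tmp := x) = store (s\<lparr>m_tmp := x\<rparr>)"
  "(store s)(Acc := x) = store (s\<lparr>m_acc := x\<rparr>)"
  by (rule ext, case_tac xa; simp)+

type_synonym ('q, 'v, 'm1, 'm2) program =
  "(('v, 'm1 + 'm2) reg, ('q, 'v, 'm1, 'm2) input) command list"

text \<open>Dividing the denominator by 1 - \<alpha> before it is used puts this factor into every
  entry at the price of one operation. \<open>compute_edge_row\<close> does the same for each
  row.\<close>

definition compute_start :: "('q, 'v) query_graphs \<Rightarrow> 'q \<Rightarrow> ('q, 'v, 'm1::finite, 'm2::finite) program" where
  "compute_start G q =
     [Apply Damp Sub (SConst 1) (SInp In_damping)] @
     for_each (seeds G q) (\<lambda>i. add_products Tmp (Start i) UNIV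
       (\<lambda>a. SInp (In_param (Inl a))) (\<lambda>a. SInp (In_node_feat q i a))) @
     add_all Total (seeds G q) (\<lambda>i. SReg (Start i)) @
     [Apply Total Div (SReg Total) (SReg Damp)] @
     for_each (seeds G q) (\<lambda>i. [Apply (Start i) Div (SReg (Start i)) (SReg Total)])"

definition compute_edge_row ::
  "('q, 'v) query_graphs \<Rightarrow> 'q \<Rightarrow> 'v \<Rightarrow> ('q, 'v, 'm1::finite, 'm2::finite) program" where
  "compute_edge_row G q l =
     for_each (out_nbrs G q l) (\<lambda>j. add_products Tmp (Edge l j) UNIV
       (\<lambda>a. SInp (In_param (Inr a))) (\<lambda>a. SInp (In_edge_feat q l j a))) @
     add_all (Den l) (out_nbrs G q l) (\<lambda>j. SReg (Edge l j)) @
     [Apply (Den l) Div (SReg (Den l)) (SReg Damp)] @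
     for_each (out_nbrs G q l) (\<lambda>j. [Apply (Edge l j) Div (SReg (Edge l j)) (SReg (Den l))])"

definition compute_edges :: "('q, 'v) query_graphs \<Rightarrow> 'q \<Rightarrow> ('q, 'v, 'm1::finite, 'm2::finite) program" where
  "compute_edges G q =
     for_each (branching G q) (compute_edge_row G q) @
     for_each (single_out G q) (\<lambda>l. for_each (out_nbrs G q l) (\<lambda>j. [Load (Edge l j) (SReg Damp)]))"

text \<open>\<open>New\<close> is a second buffer, so all reads concern the old iterate. Resetting
  \<open>New\<close> and \<open>Acc\<close> is free and restores the state that the next step
  expects.\<close>

definition vec_step :: "('q, 'v) query_graphs \<Rightarrow> 'q \<Rightarrow> ('q, 'v, 'm1::finite, 'm2::finite) program" where
  "vec_step G q =
     [Load Acc (SConst 1)] @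
     add_all Acc (dangling G q) (\<lambda>l. SReg (Cur l)) @
     for_each (nodes G q) (\<lambda>i. Apply (New i) Mul (SReg Acc) (SReg (Start i)) #
       add_products Tmp (New i) (in_nbrs G q i) (\<lambda>l. SReg (Edge l i)) (\<lambda>l. SReg (Cur l))) @
     for_each (nodes G q) (\<lambda>i. [Load (Cur i) (SReg (New i)), Load (New i) (SConst 0)]) @
     [Load Acc (SConst 0)]"

text \<open>Starting \<open>Mass\<close> from \<open>Dang\<close> avoids adding the dangling nodes
  twice; both totals together cost one addition per node.\<close>

definition compute_mass :: "('q, 'v) query_graphs \<Rightarrow> 'q \<Rightarrow> ('q, 'v, 'm1::finite, 'm2::finite) program" where
  "compute_mass G q =
     add_all Dang (dangling G q) (\<lambda>l. SReg (Cur l)) @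
     [Load Mass (SReg Dang)] @
     add_all Mass (nodes G q - dangling G q) (\<lambda>l. SReg (Cur l))"

text \<open>A row of the ranking matrix has two nonzero entries, 1 and -1. Handling rows one at a
  time costs four operations each and stores neither the matrix nor the residual vector.\<close>

definition compute_residual :: "('q, 'v) query_graphs \<Rightarrow> 'q \<Rightarrow> ('q, 'v, 'm1::finite, 'm2::finite) program" where
  "compute_residual G q =
     for_each (row_pairs G q) (\<lambda>\<rho>.
       [Apply Tmp Sub (SReg (Cur (snd \<rho>))) (SReg (Cur (fst \<rho>))),
        Apply Tmp Maximum (SReg Tmp) (SConst 0),
        Apply (Resid (snd \<rho>)) Add (SReg (Resid (snd \<rho>))) (SReg Tmp),
        Apply (Resid (fst \<rho>)) Sub (SReg (Resid (fst \<rho>))) (SReg Tmp),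
        Load Tmp (SConst 0)])"

text \<open>A dangling row sees only the restart mean of \<open>Adj\<close>, which is computed once
  in \<open>Acc\<close>. The power for the second normaliser is updated here, because the bound 3mps
  per adjoint step has room for it.\<close>

definition adj_step :: "('q, 'v) query_graphs \<Rightarrow> 'q \<Rightarrow> ('q, 'v, 'm1::finite, 'm2::finite) program" where
  "adj_step G q =
     add_products Tmp Acc (nodes G q) (\<lambda>j. SReg (Start j)) (\<lambda>j. SReg (Adj j)) @
     for_each (nodes G q) (\<lambda>l.
       if l \<in> dangling G q then [Apply (New l) Add (SReg (Resid l)) (SReg Acc)]
       else Load (New l) (SReg (Resid l)) #
         add_products Tmp (New l) (out_nbrs G q l) (\<lambda>j. SReg (Edge l j)) (\<lambda>j. SReg (Adj j))) @
     for_each (nodes G q) (\<lambda>l. [Load (Adj l) (SReg (New l)), Load (New l) (SConst 0)]) @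
     [Load Acc (SConst 0), Apply Pow Mul (SReg Pow) (SReg Damp)]"

section \<open>Correctness of the computing phases\<close>

context query_instance
begin

abbreviation "inp \<equiv> data_input (F, \<phi>, \<alpha>)"

lemma param_node_product: "(\<Sum>a\<in>UNIV. inp (In_param (Inl a)) * inp (In_node_feat q i a)) = fst \<phi> \<bullet> node_feat F q i"
  and param_edge_product: "(\<Sum>a\<in>UNIV. inp (In_param (Inr a)) * inp (In_edge_feat q i j a)) = snd \<phi> \<bullet> edge_feat F q i j"
  by (simp_all add: coord_def inner_vec_def)

lemma run_compute_start:
  assumes "m_start s = (\<lambda>_. 0)" "m_total s = 0" "m_tmp s = 0"
  shows "run inp (compute_start G q) (store s) = Some (store (s\<lparr>m_damp := 1 - \<alpha>,
    m_start := \<lambda>i. (1 - \<alpha>) * restart G F q \<phi> i, m_total := S0 / (1 - \<alpha>)\<rparr>))"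
proof -
  let ?d = "s\<lparr>m_damp := 1 - \<alpha>\<rparr>" and ?U = "seeds G q"
  have 1: "run inp (for_each ?U (\<lambda>i. add_products Tmp (Start i) UNIV
      (\<lambda>a. SInp (In_param (Inl a))) (\<lambda>a. SInp (In_node_feat q i a)))) (store ?d) =
    Some (store (?d\<lparr>m_start := \<lambda>i. if i \<in> ?U then fst \<phi> \<bullet> node_feat F q i else 0\<rparr>))"
    by (rule run_for_each[where S = "\<lambda>A. store (?d\<lparr>m_start := \<lambda>i. if i \<in> A then fst \<phi> \<bullet> node_feat F q i else 0\<rparr>)"])
      (auto simp: finite_seeds run_add_products assms param_node_product[simplified]
        intro!: store_eqI)
  have 2: "run inp (for_each ?U (\<lambda>i. [Apply (Start i) Div (SReg (Start i)) (SReg Total)]))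
      (store (?d\<lparr>m_start := \<lambda>i. if i \<in> ?U then fst \<phi> \<bullet> node_feat F q i else 0, m_total := S0 / (1 - \<alpha>)\<rparr>)) =
    Some (store (?d\<lparr>m_start := \<lambda>i. (1 - \<alpha>) * restart G F q \<phi> i, m_total := S0 / (1 - \<alpha>)\<rparr>))"
    by (rule run_for_each[where S = "\<lambda>A. store (?d\<lparr>m_start := \<lambda>i. if i \<in> A then (1 - \<alpha>) * restart G F q \<phi> i
        else if i \<in> ?U then fst \<phi> \<bullet> node_feat F q i else 0, m_total := S0 / (1 - \<alpha>)\<rparr>)"])
      (use damping in \<open>auto simp: finite_seeds seed_denom restart_def
        intro!: store_eqI\<close>)
  show ?thesis
    unfolding compute_start_def using 1 2 damping
    by (simp add: run_add_all finite_seeds assms)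
qed

lemma run_compute_edge_row:
  assumes l: "l \<in> branching G q" and s: "m_damp s = 1 - \<alpha>" "m_tmp s = 0" "m_edge s l = (\<lambda>_. 0)" "m_den s l = 0"
  shows "run inp (compute_edge_row G q l) (store s) = Some (store (s\<lparr>
    m_edge := (m_edge s)(l := \<lambda>j. if (l, j) \<in> edges G q then (1 - \<alpha>) * transition G F q \<phi> l j else 0),
    m_den := (m_den s)(l := S1 l / (1 - \<alpha>))\<rparr>))"
proof -
  let ?O = "out_nbrs G q l" and ?f = "\<lambda>j. snd \<phi> \<bullet> edge_feat F q l j"
  have ne: "?O \<noteq> {}" using l by (auto simp: branching_def)
  then have S1: "S1 l \<noteq> 0" using l by (intro out_denom) (auto simp: branching_def)
  have 1: "run inp (for_each ?O (\<lambda>j. add_products Tmp (Edge l j) UNIV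
       (\<lambda>a. SInp (In_param (Inr a))) (\<lambda>a. SInp (In_edge_feat q l j a)))) (store s) =
    Some (store (s\<lparr>m_edge := (m_edge s)(l := \<lambda>j. if j \<in> ?O then ?f j else 0)\<rparr>))"
    by (rule run_for_each[where S = "\<lambda>A. store (s\<lparr>m_edge := (m_edge s)(l := \<lambda>j. if j \<in> A then ?f j else 0)\<rparr>)"])
      (auto simp: finite_out_nbrs run_add_products s param_edge_product[simplified]
        intro!: store_eqI)
  have 2: "run inp (for_each ?O (\<lambda>j. [Apply (Edge l j) Div (SReg (Edge l j)) (SReg (Den l))]))
      (store (s\<lparr>m_edge := (m_edge s)(l := \<lambda>j. if j \<in> ?O then ?f j else 0),
        m_den := (m_den s)(l := S1 l / (1 - \<alpha>))\<rparr>)) =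
    Some (store (s\<lparr>
      m_edge := (m_edge s)(l := \<lambda>j. if (l, j) \<in> edges G q then (1 - \<alpha>) * transition G F q \<phi> l j else 0),
      m_den := (m_den s)(l := S1 l / (1 - \<alpha>))\<rparr>))"
    by (rule run_for_each[where S = "\<lambda>A. store (s\<lparr>m_edge := (m_edge s)(l := \<lambda>j.
        if j \<in> A then (1 - \<alpha>) * transition G F q \<phi> l j else if j \<in> ?O then ?f j else 0),
        m_den := (m_den s)(l := S1 l / (1 - \<alpha>))\<rparr>)"])
      (use damping ne S1 in \<open>auto simp: finite_out_nbrs transition_def out_nbrs_iff
        intro!: store_eqI\<close>)
  show ?thesis
    unfolding compute_edge_row_def using 1 2 damping
    by (simp add: run_add_all finite_out_nbrs s)
qed

text \<open>The exact contents of the \<open>Edge\<close> registers. Rows of dangling nodes are 0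
  here; their transitions are handled through \<open>Start\<close>.\<close>

definition scaled_transition :: "'v \<Rightarrow> 'v \<Rightarrow> real" where
  "scaled_transition l j = (if (l, j) \<in> edges G q then (1 - \<alpha>) * transition G F q \<phi> l j else 0)"

lemma finite_classes: "finite (dangling G q)" "finite (single_out G q)" "finite (branching G q)"
  using finite_nodes by (auto simp: dangling_def single_out_def branching_def)

lemma run_compute_edges:
  assumes s: "m_damp s = 1 - \<alpha>" "m_tmp s = 0" "m_edge s = (\<lambda>_ _. 0)" "m_den s = (\<lambda>_. 0)"
  shows "run inp (compute_edges G q) (store s) = Some (store (s\<lparr>
    m_edge := \<lambda>l j. scaled_transition l j,
    m_den := \<lambda>l. if l \<in> branching G q then S1 l / (1 - \<alpha>) else 0\<rparr>))"
proof -
  let ?e = "\<lambda>A l j. if l \<in> A \<and> (l, j) \<in> edges G q then (1 - \<alpha>) * transition G F q \<phi> l j else 0"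
  let ?d = "\<lambda>A l. if l \<in> A then S1 l / (1 - \<alpha>) else 0"
  have 1: "run inp (for_each (branching G q) (compute_edge_row G q)) (store s) =
    Some (store (s\<lparr>m_edge := ?e (branching G q), m_den := ?d (branching G q)\<rparr>))"
    by (rule run_for_each[where S = "\<lambda>A. store (s\<lparr>m_edge := ?e A, m_den := ?d A\<rparr>)"])
      (auto simp: finite_classes run_compute_edge_row s intro!: store_eqI)
  have row: "run inp (for_each (out_nbrs G q l) (\<lambda>j. [Load (Edge l j) (SReg Damp)])) (store t) =
      Some (store (t\<lparr>m_edge := (m_edge t)(l := \<lambda>j. if (l, j) \<in> edges G q then 1 - \<alpha> else m_edge t l j)\<rparr>))"
    if "m_damp t = 1 - \<alpha>" for l and t :: "('v, 'm1 + 'm2) memory"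
    by (rule run_for_each[where S = "\<lambda>A. store (t\<lparr>m_edge := (m_edge t)(l := \<lambda>j. if j \<in> A then 1 - \<alpha> else m_edge t l j)\<rparr>)"])
      (auto simp: finite_out_nbrs that out_nbrs_iff intro!: store_eqI)
  have single: "transition G F q \<phi> l j = 1" if "l \<in> single_out G q" "(l, j) \<in> edges G q" for l j
    using that transition_single_out(1) out_nbrs_iff by blast
  have all: "l \<in> branching G q \<or> l \<in> single_out G q" if "(l, j) \<in> edges G q" for l j
  proof -
    have "l \<in> V" "l \<notin> dangling G q"
      using that edges_sub by (auto simp: dangling_def out_nbrs_def)
    then show ?thesis using node_cases(1) by blast
  qed
  have disj: "l \<in> single_out G q \<Longrightarrow> l \<notin> branching G q" for l using node_cases by blast
  have 2: "run inp (for_each (single_out G q) (\<lambda>l. for_each (out_nbrs G q l) (\<lambda>j. [Load (Edge l j) (SReg Damp)])))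
      (store (s\<lparr>m_edge := ?e (branching G q), m_den := ?d (branching G q)\<rparr>)) =
    Some (store (s\<lparr>m_edge := ?e UNIV, m_den := ?d (branching G q)\<rparr>))"
    by (rule run_for_each[where S = "\<lambda>A. store (s\<lparr>m_edge := ?e (branching G q \<union> A), m_den := ?d (branching G q)\<rparr>)"])
      (auto simp: finite_classes row s single dest: all disj intro!: store_eqI)
  show ?thesis unfolding compute_edges_def scaled_transition_def using 1 2 by simp
qed

text \<open>With 1 - \<alpha> built into both \<open>Start\<close> and \<open>Edge\<close>, the
  recursion of the program adds \<open>Start\<close> to the product with \<open>Edge\<close>, which
  produces the partial sum times 1 - \<alpha>.\<close>

definition forward :: "nat \<Rightarrow> 'v \<Rightarrow> real" where
  "forward k i = (1 - \<alpha>) * trunc_series \<alpha> V (transition G F q \<phi>) k (restart G F q \<phi>) i"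

lemma forward_0: "forward 0 = (\<lambda>i. (1 - \<alpha>) * restart G F q \<phi> i)"
  by (simp add: forward_def trunc_series_def fun_eq_iff)

lemma forward_Suc:
  "forward (Suc k) i = (1 - \<alpha>) * restart G F q \<phi> i + (1 - \<alpha>) * push V (transition G F q \<phi>) (forward k) i"
  by (simp only: forward_def[abs_def] trunc_series_Suc push_scale distrib_left)

text \<open>The invariant equates the \<open>Cur\<close> registers with \<open>forward k\<close> as
  total functions, and registers outside \<open>V\<close> keep their initial 0.\<close>

lemma forward_outside: "i \<notin> V \<Longrightarrow> forward k i = 0"
  by (induction k) (simp_all add: forward_0 forward_Suc restart_outside push_def transition_outside)

lemma forward_step:
  assumes "i \<in> V"
  shows "(1 + (\<Sum>l\<in>dangling G q. forward k l)) * ((1 - \<alpha>) * restart G F q \<phi> i) +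
    (\<Sum>l\<in>in_nbrs G q i. scaled_transition l i * forward k l) = forward (Suc k) i"
  unfolding forward_Suc push_step[OF assms, symmetric]
  by (simp add: scaled_transition_def in_nbrs_def)

text \<open>The cut to \<open>V\<close> is essential: a node outside \<open>V\<close> has no
  out-neighbours, so \<open>transition\<close> treats it as dangling and the plain series need not
  vanish there, whereas its register stays 0.\<close>

definition backward :: "('v \<Rightarrow> real) \<Rightarrow> nat \<Rightarrow> 'v \<Rightarrow> real" where
  "backward h k i = (if i \<in> V then trunc_series \<alpha> V (\<lambda>j i. transition G F q \<phi> i j) k h i else 0)"

lemma backward_0: "backward h 0 i = (if i \<in> V then h i else 0)"
  by (simp add: backward_def trunc_series_def)

lemma backward_Suc:
  assumes "i \<in> V"
  shows "backward h (Suc k) i = h i + (1 - \<alpha>) * push V (\<lambda>j i. transition G F q \<phi> i j) (backward h k) i"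
proof -
  have "push V (\<lambda>j i. transition G F q \<phi> i j) (backward h k) =
      push V (\<lambda>j i. transition G F q \<phi> i j) (trunc_series \<alpha> V (\<lambda>j i. transition G F q \<phi> i j) k h)"
    by (rule push_cong) (simp add: backward_def)
  then show ?thesis using assms by (simp add: backward_def trunc_series_Suc)
qed

lemma backward_step:
  "l \<in> dangling G q \<Longrightarrow>
    h l + (\<Sum>j\<in>V. (1 - \<alpha>) * restart G F q \<phi> j * backward h k j) = backward h (Suc k) l"
  "l \<in> V \<Longrightarrow> l \<notin> dangling G q \<Longrightarrow>
    h l + (\<Sum>j\<in>out_nbrs G q l. scaled_transition l j * backward h k j) = backward h (Suc k) l"
proof -
  assume "l \<in> dangling G q"
  moreover from this have "l \<in> V" by (simp add: dangling_def)
  ultimately show "h l + (\<Sum>j\<in>V. (1 - \<alpha>) * restart G F q \<phi> j * backward h k j) = backward h (Suc k) l"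
    by (simp add: backward_Suc pull_dangling sum_distrib_left mult.assoc)
next
  assume l: "l \<in> V" "l \<notin> dangling G q"
  have "(\<Sum>j\<in>out_nbrs G q l. scaled_transition l j * backward h k j) =
      (1 - \<alpha>) * (\<Sum>j\<in>out_nbrs G q l. transition G F q \<phi> l j * backward h k j)"
    unfolding sum_distrib_left by (intro sum.cong refl) (simp add: scaled_transition_def out_nbrs_iff)
  then show "h l + (\<Sum>j\<in>out_nbrs G q l. scaled_transition l j * backward h k j) = backward h (Suc k) l"
    using l by (simp add: backward_Suc pull_out_nbrs)
qed

lemma run_vec_step:
  assumes s: "m_edge s = scaled_transition" "m_start s = (\<lambda>i. (1 - \<alpha>) * restart G F q \<phi> i)"
    "m_new s = (\<lambda>_. 0)" "m_tmp s = 0" "m_acc s = 0"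
  shows "run inp (vec_step G q) (store (s\<lparr>m_cur := forward k\<rparr>)) = Some (store (s\<lparr>m_cur := forward (Suc k)\<rparr>))"
proof -
  let ?a = "1 + (\<Sum>l\<in>dangling G q. forward k l)"
  let ?s = "s\<lparr>m_cur := forward k, m_acc := ?a\<rparr>"
  have 1: "run inp (for_each V (\<lambda>i. Apply (New i) Mul (SReg Acc) (SReg (Start i)) #
       add_products Tmp (New i) (in_nbrs G q i) (\<lambda>l. SReg (Edge l i)) (\<lambda>l. SReg (Cur l)))) (store ?s) =
     Some (store (?s\<lparr>m_new := \<lambda>i. if i \<in> V then forward (Suc k) i else 0\<rparr>))"
    by (rule run_for_each[where S = "\<lambda>A. store (?s\<lparr>m_new := \<lambda>i. if i \<in> A then forward (Suc k) i else 0\<rparr>)"])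
      (auto simp: finite_nodes finite_in_nbrs run_add_products s forward_step intro!: store_eqI)
  have 2: "run inp (for_each V (\<lambda>i. [Load (Cur i) (SReg (New i)), Load (New i) (SConst 0)]))
      (store (?s\<lparr>m_new := \<lambda>i. if i \<in> V then forward (Suc k) i else 0\<rparr>)) =
     Some (store (s\<lparr>m_cur := forward (Suc k), m_acc := ?a\<rparr>))"
    by (rule run_for_each[where S = "\<lambda>A. store (s\<lparr>m_cur := \<lambda>i. if i \<in> A then forward (Suc k) i else forward k i,
        m_acc := ?a, m_new := \<lambda>i. if i \<in> V \<and> i \<notin> A then forward (Suc k) i else 0\<rparr>)"])
      (auto simp: finite_nodes s forward_outside intro!: store_eqI)
  show ?thesis unfolding vec_step_def using 1 2 by (auto simp: run_add_all finite_classes s intro!: store_eqI)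
qed

text \<open>\<open>Pow\<close> runs one exponent ahead of the step count, since it starts from 1 -
  \<alpha>; after N2 steps it is the power occurring in the normaliser.\<close>

lemma run_adj_step:
  assumes s: "m_edge s = scaled_transition" "m_start s = (\<lambda>i. (1 - \<alpha>) * restart G F q \<phi> i)"
    "m_new s = (\<lambda>_. 0)" "m_tmp s = 0" "m_acc s = 0" "m_damp s = 1 - \<alpha>"
  shows "run inp (adj_step G q) (store (s\<lparr>m_adj := backward (m_resid s) k, m_pow := (1 - \<alpha>) ^ (k + 1)\<rparr>)) =
    Some (store (s\<lparr>m_adj := backward (m_resid s) (Suc k), m_pow := (1 - \<alpha>) ^ (Suc k + 1)\<rparr>))"
proof -
  let ?h = "m_resid s"
  let ?a = "\<Sum>j\<in>V. (1 - \<alpha>) * restart G F q \<phi> j * backward ?h k j"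
  let ?s = "s\<lparr>m_adj := backward ?h k, m_pow := (1 - \<alpha>) ^ (k + 1), m_acc := ?a\<rparr>"
  have 1: "run inp (for_each V (\<lambda>l.
       if l \<in> dangling G q then [Apply (New l) Add (SReg (Resid l)) (SReg Acc)]
       else Load (New l) (SReg (Resid l)) #
         add_products Tmp (New l) (out_nbrs G q l) (\<lambda>j. SReg (Edge l j)) (\<lambda>j. SReg (Adj j)))) (store ?s) =
     Some (store (?s\<lparr>m_new := \<lambda>i. if i \<in> V then backward ?h (Suc k) i else 0\<rparr>))"
    by (rule run_for_each[where S = "\<lambda>A. store (?s\<lparr>m_new := \<lambda>i. if i \<in> A then backward ?h (Suc k) i else 0\<rparr>)"])
      (auto simp: finite_nodes finite_out_nbrs run_add_products s backward_step intro!: store_eqI)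
  have 2: "run inp (for_each V (\<lambda>l. [Load (Adj l) (SReg (New l)), Load (New l) (SConst 0)]))
      (store (?s\<lparr>m_new := \<lambda>i. if i \<in> V then backward ?h (Suc k) i else 0\<rparr>)) =
     Some (store (s\<lparr>m_adj := backward ?h (Suc k), m_pow := (1 - \<alpha>) ^ (k + 1), m_acc := ?a\<rparr>))"
    by (rule run_for_each[where S = "\<lambda>A. store (s\<lparr>m_adj := \<lambda>i. if i \<in> A then backward ?h (Suc k) i else backward ?h k i,
        m_pow := (1 - \<alpha>) ^ (k + 1), m_acc := ?a,
        m_new := \<lambda>i. if i \<in> V \<and> i \<notin> A then backward ?h (Suc k) i else 0\<rparr>)"])
      (auto simp: finite_nodes s backward_def intro!: store_eqI)
  show ?thesis unfolding adj_step_def using 1 2 by (auto simp: run_add_products finite_nodes s intro!: store_eqI)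
qed

lemma run_compute_mass:
  assumes "m_dang s = 0"
  shows "run inp (compute_mass G q) (store s) = Some (store (s\<lparr>m_dang := (\<Sum>l\<in>dangling G q. m_cur s l),
    m_mass := (\<Sum>l\<in>V. m_cur s l)\<rparr>))"
  unfolding compute_mass_def sum_nodes using assms
  by (simp add: run_add_all finite_classes finite_nodes)

lemma row_pairs_dest:
  assumes "\<rho> \<in> row_pairs G q"
  shows "fst \<rho> \<in> V" "snd \<rho> \<in> V" "fst \<rho> \<noteq> snd \<rho>"
proof -
  from assms obtain j l where "1 \<le> j" "j < l" "l \<le> num_labels G"
    and \<rho>: "fst \<rho> \<in> label_class G q j" "snd \<rho> \<in> label_class G q l"
    by (force simp: row_pairs_def class_pairs_def)
  \<comment> \<open>Both truncated subtractions are exact because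
    \<open>l \<le> num_labels G\<close>; hence the two nodes carry different labels.\<close>
  then have "num_labels G + 1 - j \<noteq> num_labels G + 1 - l" by linarith
  with \<rho> show "fst \<rho> \<in> V" "snd \<rho> \<in> V" "fst \<rho> \<noteq> snd \<rho>" by (auto simp: label_class_def)
qed

lemma finite_row_pairs: "finite (row_pairs G q)"
proof (rule finite_subset)
  show "row_pairs G q \<subseteq> V \<times> V" using row_pairs_dest by (auto simp: mem_Times_iff)
qed (simp add: finite_nodes)

lemma ranking_residual_row:
  assumes "\<rho> \<in> row_pairs G q"
  shows "ranking_residual G q x \<rho> = max (x (snd \<rho>) - x (fst \<rho>)) 0"
proof -
  note \<rho> = row_pairs_dest[OF assms]
  have "(\<Sum>i\<in>V. pair_matrix \<rho> i * x i) =
      (\<Sum>i\<in>V. (if i = snd \<rho> then x i else 0) - (if i = fst \<rho> then x i else 0))"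
    using \<rho> by (intro sum.cong) (auto simp: pair_matrix_def)
  also have "\<dots> = x (snd \<rho>) - x (fst \<rho>)"
    using \<rho> finite_nodes by (simp add: sum_subtractf)
  finally show ?thesis by (simp add: ranking_residual_def pos_part_def)
qed

lemma run_compute_residual:
  assumes s: "m_resid s = (\<lambda>_. 0)" "m_tmp s = 0"
  shows "run inp (compute_residual G q) (store s) = Some (store (s\<lparr>m_resid := residual_pullback G q (m_cur s)\<rparr>))"
  unfolding compute_residual_def
proof (rule run_for_each[where S = "\<lambda>A. store (s\<lparr>m_resid := \<lambda>i. \<Sum>\<rho>\<in>A. pair_matrix \<rho> i * ranking_residual G q (m_cur s) \<rho>\<rparr>)"])
  fix A \<rho>
  assume "finite A" "\<rho> \<in> row_pairs G q" "\<rho> \<notin> A"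
  then show "run inp
       [Apply Tmp Sub (SReg (Cur (snd \<rho>))) (SReg (Cur (fst \<rho>))),
        Apply Tmp Maximum (SReg Tmp) (SConst 0),
        Apply (Resid (snd \<rho>)) Add (SReg (Resid (snd \<rho>))) (SReg Tmp),
        Apply (Resid (fst \<rho>)) Sub (SReg (Resid (fst \<rho>))) (SReg Tmp),
        Load Tmp (SConst 0)]
       (store (s\<lparr>m_resid := \<lambda>i. \<Sum>\<rho>\<in>A. pair_matrix \<rho> i * ranking_residual G q (m_cur s) \<rho>\<rparr>)) =
    Some (store (s\<lparr>m_resid := \<lambda>i. \<Sum>\<rho>\<in>insert \<rho> A. pair_matrix \<rho> i * ranking_residual G q (m_cur s) \<rho>\<rparr>))"
    using row_pairs_dest(3)[of \<rho>] s
    by (auto simp: ranking_residual_row pair_matrix_def intro!: store_eqI)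
qed (auto simp: finite_row_pairs s residual_pullback_def intro!: store_eqI)

end

text \<open>\<open>Mass\<close> enters twice: the residual was computed from the unnormalised
  iterate, and so were the weights of the transition derivatives in the initial matrix. The restart
  part is adapted to this by the factor \<open>Mass\<close> in \<open>output_nodes\<close>.\<close>

definition compute_factor :: "('q, 'v) query_graphs \<Rightarrow> ('q, 'v, 'm1::finite, 'm2::finite) program" where
  "compute_factor G =
     [Apply Fac Sub (SConst 1) (SReg Pow),
      Apply Fac Mul (SReg Fac) (SReg Mass),
      Apply Fac Mul (SReg Fac) (SReg Mass),
      Apply Fac Mul (SReg Fac) (SConst (int (card (queries G)))),
      Apply Fac Div (SConst 2) (SReg Fac)]"

text \<open>The centred and scaled weight of each seed is stored in \<open>New\<close>, so a feature
  costs one multiplication and one addition. \<open>Mass\<close> and \<open>Dang\<close> are cleared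
  for their reuse as scratch registers by the edge rows.\<close>

definition output_nodes :: "('q, 'v) query_graphs \<Rightarrow> 'q \<Rightarrow> ('q, 'v, 'm1::finite, 'm2::finite) program" where
  "output_nodes G q =
     add_products Tmp Acc (nodes G q) (\<lambda>j. SReg (Start j)) (\<lambda>j. SReg (Adj j)) @
     [Apply Acc Div (SReg Acc) (SReg Damp),
      Apply Pow Mul (SInp In_damping) (SReg Mass),
      Apply Pow Div (SReg Pow) (SReg Damp),
      Apply Pow Add (SReg Pow) (SReg Dang),
      Apply Pow Div (SReg Pow) (SReg Total),
      Apply Pow Mul (SReg Pow) (SReg Fac)] @
     for_each (seeds G q) (\<lambda>j. [Apply (New j) Sub (SReg (Adj j)) (SReg Acc), Apply (New j) Mul (SReg (New j)) (SReg Pow)]) @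
     for_each UNIV (\<lambda>a. add_products Tmp (Out (Inl a)) (seeds G q)
       (\<lambda>j. SReg (New j)) (\<lambda>j. SInp (In_node_feat q j a))) @
     [Load Acc (SConst 0), Load Mass (SConst 0), Load Dang (SConst 0)]"

text \<open>\<open>Dang\<close> holds the scalar of the row and \<open>Mass\<close> the weight of
  the current edge. A product sum over the singleton \<open>{j}\<close> is one multiply-and-add,
  which reuses the convention for \<open>Tmp\<close>.\<close>

definition output_edge_row ::
  "('q, 'v) query_graphs \<Rightarrow> 'q \<Rightarrow> 'v \<Rightarrow> ('q, 'v, 'm1::finite, 'm2::finite) program" where
  "output_edge_row G q l =
     add_products Tmp Acc (out_nbrs G q l) (\<lambda>j. SReg (Edge l j)) (\<lambda>j. SReg (Adj j)) @
     [Apply Acc Div (SReg Acc) (SReg Damp),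
      Apply Dang Mul (SReg (Cur l)) (SReg Fac),
      Apply Dang Div (SReg Dang) (SReg (Den l))] @
     for_each (out_nbrs G q l) (\<lambda>j.
       [Apply Mass Sub (SReg (Adj j)) (SReg Acc), Apply Mass Mul (SReg Mass) (SReg Dang)] @
       for_each UNIV (\<lambda>a. add_products Tmp (Out (Inr a)) {j} (\<lambda>_. SReg Mass) (\<lambda>j. SInp (In_edge_feat q l j a))) @
       [Load Mass (SConst 0)]) @
     [Load Acc (SConst 0), Load Dang (SConst 0)]"

definition work_regs :: "('q, 'v) query_graphs \<Rightarrow> 'q \<Rightarrow> ('v, 'k) reg set" where
  "work_regs G q = case_prod Edge ` edges G q \<union> Start ` nodes G q \<union> Cur ` nodes G q \<union> New ` nodes G q \<union>
     Resid ` nodes G q \<union> Adj ` nodes G q \<union> Den ` nodes G q \<union> {Damp, Total, Mass, Dang, Pow, Fac, Tmp, Acc}"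

text \<open>
  The vector iterate is normalised by its sum (\<open>Mass\<close>): computing the power in
  \<open>1 - (1 - \<alpha>) ^ (N1 + 1)\<close> would cost \<open>N1\<close> operations, which the bound \<open>3 p s N1\<close> does not leave. A query
  without rows contributes nothing; skipping it guarantees two nodes and one row in the remaining cases,
  which pay for the constant number of scalar operations.
\<close>

definition query_program ::
  "('q, 'v) query_graphs \<Rightarrow> nat \<Rightarrow> nat \<Rightarrow> 'q \<Rightarrow> ('q, 'v, 'm1::finite, 'm2::finite) program" where
  "query_program G N1 N2 q = (if row_pairs G q = {} then [] else
     clear (work_regs G q) @ compute_start G q @ compute_edges G q @
     for_each (nodes G q) (\<lambda>i. [Load (Cur i) (SReg (Start i))]) @
     concat (replicate N1 (vec_step G q)) @
     compute_mass G q @ compute_residual G q @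
     for_each (nodes G q) (\<lambda>i. [Load (Adj i) (SReg (Resid i))]) @ [Load Pow (SReg Damp)] @
     concat (replicate N2 (adj_step G q)) @
     compute_factor G @ output_nodes G q @ for_each (branching G q) (output_edge_row G q))"

section \<open>Correctness of the whole program for one query\<close>

context query_instance
begin

lemma run_compute_factor:
  assumes "m_pow s \<noteq> 1" "m_mass s \<noteq> 0"
  shows "run inp (compute_factor G) (store s) = Some (store (s\<lparr>m_fac :=
    2 / ((1 - m_pow s) * m_mass s * m_mass s * real (card (queries G)))\<rparr>))"
proof -
  have "card (queries G) \<noteq> 0" using wf by (simp add: wf_query_graphs_def)
  with assms show ?thesis by (simp add: compute_factor_def)
qed

lemma run_output_nodes:
  fixes s :: "('v, 'm1 + 'm2) memory"
  assumes s: "m_damp s = 1 - \<alpha>" "m_total s = S0 / (1 - \<alpha>)" "m_tmp s = 0" "m_acc s = 0"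
    "m_start s = (\<lambda>i. (1 - \<alpha>) * restart G F q \<phi> i)"
  defines "c \<equiv> (\<Sum>j\<in>V. (1 - \<alpha>) * restart G F q \<phi> j * m_adj s j) / (1 - \<alpha>)"
  defines "\<kappa> \<equiv> (\<alpha> * m_mass s / (1 - \<alpha>) + m_dang s) / (S0 / (1 - \<alpha>)) * m_fac s"
  shows "run inp (output_nodes G q) (store s) = Some (store (s\<lparr>
    m_new := \<lambda>j. if j \<in> seeds G q then (m_adj s j - c) * \<kappa> else m_new s j,
    m_pow := \<kappa>, m_mass := 0, m_dang := 0,
    m_out := \<lambda>k. m_out s k + (case k of Inr b \<Rightarrow> 0 | Inl a \<Rightarrow>
      \<Sum>j\<in>seeds G q. (m_adj s j - c) * \<kappa> * node_feat F q j $ a)\<rparr>))"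
proof -
  let ?U = "seeds G q" and ?w = "\<lambda>j. (m_adj s j - c) * \<kappa>"
  let ?s = "s\<lparr>m_acc := c, m_pow := \<kappa>\<rparr>"
  let ?n = "?s\<lparr>m_new := \<lambda>j. if j \<in> ?U then ?w j else m_new s j\<rparr>"
  have 1: "run inp (for_each ?U (\<lambda>j. [Apply (New j) Sub (SReg (Adj j)) (SReg Acc),
      Apply (New j) Mul (SReg (New j)) (SReg Pow)])) (store ?s) = Some (store ?n)"
    by (rule run_for_each[where S = "\<lambda>A. store (?s\<lparr>m_new := \<lambda>j. if j \<in> A then ?w j else m_new s j\<rparr>)"])
      (auto simp: finite_seeds intro!: store_eqI)
  let ?o = "\<lambda>A k. m_out s k + (case k of Inr b \<Rightarrow> 0 | Inl a \<Rightarrow>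
      if a \<in> A then \<Sum>j\<in>?U. ?w j * node_feat F q j $ a else 0)"
  have 2: "run inp (for_each UNIV (\<lambda>a. add_products Tmp (Out (Inl a)) ?U
       (\<lambda>j. SReg (New j)) (\<lambda>j. SInp (In_node_feat q j a)))) (store ?n) = Some (store (?n\<lparr>m_out := ?o UNIV\<rparr>))"
    by (rule run_for_each[where S = "\<lambda>A. store (?n\<lparr>m_out := ?o A\<rparr>)"])
      (auto simp: finite_seeds run_add_products s split: sum.splits intro!: store_eqI)
  show ?thesis
    unfolding output_nodes_def using 1 2 damping seed_denom
    by (auto simp: run_add_products finite_nodes s c_def \<kappa>_def split: sum.splits intro!: store_eqI)
qed

lemma run_output_edge_row:
  fixes s :: "('v, 'm1 + 'm2) memory"
  assumes s: "m_damp s = 1 - \<alpha>" "m_tmp s = 0" "m_acc s = 0" "m_mass s = 0" "m_dang s = 0"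
    "m_edge s = scaled_transition" "m_den s l = S1 l / (1 - \<alpha>)" and l: "l \<in> branching G q"
  defines "c \<equiv> (\<Sum>j\<in>out_nbrs G q l. scaled_transition l j * m_adj s j) / (1 - \<alpha>)"
  defines "\<kappa> \<equiv> m_cur s l * m_fac s / (S1 l / (1 - \<alpha>))"
  shows "run inp (output_edge_row G q l) (store s) = Some (store (s\<lparr>
    m_out := \<lambda>k. m_out s k + (case k of Inl a \<Rightarrow> 0 | Inr b \<Rightarrow>
      \<Sum>j\<in>out_nbrs G q l. (m_adj s j - c) * \<kappa> * edge_feat F q l j $ b)\<rparr>))"
proof -
  have S1: "S1 l \<noteq> 0" using l by (intro out_denom) (auto simp: branching_def)
  let ?w = "\<lambda>j. (m_adj s j - c) * \<kappa>"
  let ?s = "s\<lparr>m_acc := c, m_dang := \<kappa>\<rparr>"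
  let ?o = "\<lambda>J k. m_out s k + (case k of Inl a \<Rightarrow> 0 | Inr b \<Rightarrow> \<Sum>j\<in>J. ?w j * edge_feat F q l j $ b)"
  have row: "run inp (for_each UNIV (\<lambda>a. add_products Tmp (Out (Inr a)) {j} (\<lambda>_. SReg Mass)
      (\<lambda>j. SInp (In_edge_feat q l j a)))) (store t) =
    Some (store (t\<lparr>m_out := \<lambda>k. m_out t k + (case k of Inl a \<Rightarrow> 0 | Inr b \<Rightarrow> m_mass t * edge_feat F q l j $ b)\<rparr>))"
    if "m_tmp t = 0" for j and t :: "('v, 'm1 + 'm2) memory"
    by (rule run_for_each[where S = "\<lambda>A. store (t\<lparr>m_out := \<lambda>k. m_out t k + (case k of Inl a \<Rightarrow> 0 | Inr b \<Rightarrow>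
        if b \<in> A then m_mass t * edge_feat F q l j $ b else 0)\<rparr>)"])
      (auto simp: run_add_products that split: sum.splits intro!: store_eqI)
  have 1: "run inp (for_each (out_nbrs G q l) (\<lambda>j.
       [Apply Mass Sub (SReg (Adj j)) (SReg Acc), Apply Mass Mul (SReg Mass) (SReg Dang)] @
       for_each UNIV (\<lambda>a. add_products Tmp (Out (Inr a)) {j} (\<lambda>_. SReg Mass) (\<lambda>j. SInp (In_edge_feat q l j a))) @
       [Load Mass (SConst 0)])) (store ?s) = Some (store (?s\<lparr>m_out := ?o (out_nbrs G q l)\<rparr>))"
    by (rule run_for_each[where S = "\<lambda>A. store (?s\<lparr>m_out := ?o A\<rparr>)"])
      (auto simp: finite_out_nbrs row s split: sum.splits intro!: store_eqI)
  show ?thesis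
    unfolding output_edge_row_def using 1 damping S1
    by (auto simp: run_add_products finite_out_nbrs s c_def \<kappa>_def split: sum.splits intro!: store_eqI)
qed

lemma finite_work_regs: "finite (work_regs G q)"
  using finite_nodes finite_subset[OF edges_sub] by (auto simp: work_regs_def)

definition contribution :: "nat \<Rightarrow> nat \<Rightarrow> 'm1 + 'm2 \<Rightarrow> real" where
  "contribution N1 N2 k = 2 / real (card (queries G)) *
     (\<Sum>i\<in>V. mat_approx G F \<alpha> q \<phi> N1 N2 i (param_basis k) *
        residual_pullback G q (vec_approx G F \<alpha> q \<phi> N1) i)"

text \<open>With zeros outside the registers in use, the state after clearing is a
  \<open>store\<close> of one explicit record. The hypothesis is harmless for real memory: a
  symbolic state may be set to 0 at names to which the program never refers.\<close>

lemma run_query_program: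
  assumes \<sigma>: "\<And>r. r \<notin> work_regs G q \<union> range Out \<Longrightarrow> \<sigma> r = 0"
  shows "\<exists>\<sigma>'. run inp (query_program G N1 N2 q) \<sigma> = Some \<sigma>' \<and>
    (\<forall>k. \<sigma>' (Out k) = \<sigma> (Out k) + contribution N1 N2 k)"
proof (cases "row_pairs G q = {}")
  case True
  then have "residual_pullback G q x i = 0" for x i by (simp add: residual_pullback_def)
  then show ?thesis using True by (simp add: query_program_def contribution_def)
next
  case False
  let ?h = "residual_pullback G q (forward N1)" and ?\<tau> = "\<Sum>i\<in>V. forward N1 i"
  let ?z = "backward ?h N2"
  define s0 :: "('v, 'm1 + 'm2) memory" where "s0 = \<lparr>m_edge = (\<lambda>_ _. 0), m_start = (\<lambda>_. 0), m_cur = (\<lambda>_. 0), m_new = (\<lambda>_. 0),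
    m_resid = (\<lambda>_. 0), m_adj = (\<lambda>_. 0), m_den = (\<lambda>_. 0), m_out = (\<lambda>k. \<sigma> (Out k)), m_damp = 0,
    m_total = 0, m_mass = 0, m_dang = 0, m_pow = 0, m_fac = 0, m_tmp = 0, m_acc = 0\<rparr>"
  have 0: "run inp (clear (work_regs G q)) \<sigma> = Some (store s0)"
  proof -
    have "(if r \<in> work_regs G q then 0 else \<sigma> r) = store s0 r" for r
      using \<sigma>[of r] by (cases r) (auto simp: s0_def work_regs_def)
    then show ?thesis unfolding run_clear[OF finite_work_regs] by presburger
  qed
  define s1 where "s1 = s0\<lparr>m_damp := 1 - \<alpha>, m_start := \<lambda>i. (1 - \<alpha>) * restart G F q \<phi> i, m_total := S0 / (1 - \<alpha>)\<rparr>"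
  have 1: "run inp (compute_start G q) (store s0) = Some (store s1)"
    unfolding s1_def by (rule run_compute_start) (simp_all add: s0_def)
  define s2 where "s2 = s1\<lparr>m_edge := scaled_transition, m_den := \<lambda>l. if l \<in> branching G q then S1 l / (1 - \<alpha>) else 0\<rparr>"
  have 2: "run inp (compute_edges G q) (store s1) = Some (store s2)"
    unfolding s2_def by (rule run_compute_edges[where s = s1, simplified]) (simp_all add: s1_def s0_def)
  have 3: "run inp (for_each V (\<lambda>i. [Load (Cur i) (SReg (Start i))])) (store s2) =
      Some (store (s2\<lparr>m_cur := forward 0\<rparr>))"
    by (rule run_for_each[where S = "\<lambda>A. store (s2\<lparr>m_cur := \<lambda>i. if i \<in> A then forward 0 i else 0\<rparr>)"])
      (auto simp: finite_nodes s0_def s1_def s2_def forward_outside forward_0 restart_outside intro!: store_eqI)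
  define s4 where "s4 = s2\<lparr>m_cur := forward N1\<rparr>"
  have 4: "run inp (concat (replicate N1 (vec_step G q))) (store (s2\<lparr>m_cur := forward 0\<rparr>)) = Some (store s4)"
    unfolding s4_def
  proof (rule run_repeat[where S = "\<lambda>k. store (s2\<lparr>m_cur := forward k\<rparr>)"])
    show "run inp (vec_step G q) (store (s2\<lparr>m_cur := forward k\<rparr>)) = Some (store (s2\<lparr>m_cur := forward (Suc k)\<rparr>))" for k
      by (rule run_vec_step) (simp_all add: s0_def s1_def s2_def)
  qed simp
  define s5 where "s5 = s4\<lparr>m_dang := (\<Sum>l\<in>dangling G q. forward N1 l), m_mass := ?\<tau>\<rparr>"
  have 5: "run inp (compute_mass G q) (store s4) = Some (store s5)"
    using run_compute_mass[of s4] by (simp add: s5_def s0_def s1_def s2_def s4_def)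
  define s6 where "s6 = s5\<lparr>m_resid := ?h\<rparr>"
  have 6: "run inp (compute_residual G q) (store s5) = Some (store s6)"
    using run_compute_residual[of s5] by (simp add: s6_def s5_def s0_def s1_def s2_def s4_def)
  let ?s7 = "\<lambda>k. s6\<lparr>m_adj := backward ?h k, m_pow := (1 - \<alpha>) ^ (k + 1)\<rparr>"
  have 7: "run inp (for_each V (\<lambda>i. [Load (Adj i) (SReg (Resid i))])) (store s6) =
      Some (store (s6\<lparr>m_adj := backward ?h 0\<rparr>))"
    by (rule run_for_each[where S = "\<lambda>A. store (s6\<lparr>m_adj := \<lambda>i. if i \<in> A then backward ?h 0 i else 0\<rparr>)"])
      (auto simp: finite_nodes s0_def s1_def s2_def s4_def s5_def s6_def backward_0 intro!: store_eqI)
  have 8: "run inp [Load Pow (SReg Damp)] (store (s6\<lparr>m_adj := backward ?h 0\<rparr>)) = Some (store (?s7 0))"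
    by (simp add: s0_def s1_def s2_def s4_def s5_def s6_def)
  have 9: "run inp (concat (replicate N2 (adj_step G q))) (store (?s7 0)) = Some (store (?s7 N2))"
  proof (rule run_repeat[where S = "\<lambda>k. store (?s7 k)"])
    have *: "?h = m_resid s6" by (simp add: s6_def)
    show "run inp (adj_step G q) (store (?s7 k)) = Some (store (?s7 (Suc k)))" for k
      unfolding * by (rule run_adj_step) (simp_all add: s0_def s1_def s2_def s4_def s5_def s6_def)
  qed simp
  have \<tau>: "0 < ?\<tau>" unfolding forward_def by (rule vec_approx_normalize)
  have fw: "forward N1 i = ?\<tau> * vec_approx G F \<alpha> q \<phi> N1 i" for i
    unfolding forward_def by (rule vec_approx_normalize)
  define f where "f = 2 / ((1 - (1 - \<alpha>) ^ (N2 + 1)) * ?\<tau> * ?\<tau> * real (card (queries G)))"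
  define s10 where "s10 = (?s7 N2)\<lparr>m_fac := f\<rparr>"
  have 10: "run inp (compute_factor G) (store (?s7 N2)) = Some (store s10)"
    using run_compute_factor[of "?s7 N2"] pow_less_1(1)[of N2] \<tau>
    by (simp add: s10_def f_def s0_def s1_def s2_def s4_def s5_def s6_def)
  define c where "c = (\<Sum>j\<in>V. (1 - \<alpha>) * restart G F q \<phi> j * ?z j) / (1 - \<alpha>)"
  define \<kappa> where "\<kappa> = (\<alpha> * ?\<tau> / (1 - \<alpha>) + (\<Sum>l\<in>dangling G q. forward N1 l)) / (S0 / (1 - \<alpha>)) * f"
  define s11 where "s11 = s10\<lparr>
    m_new := \<lambda>j. if j \<in> seeds G q then (?z j - c) * \<kappa> else 0, m_pow := \<kappa>, m_mass := 0, m_dang := 0,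
    m_out := \<lambda>k. \<sigma> (Out k) + (case k of Inr b \<Rightarrow> 0 | Inl a \<Rightarrow>
      \<Sum>j\<in>seeds G q. (?z j - c) * \<kappa> * node_feat F q j $ a)\<rparr>"
  have 11: "run inp (output_nodes G q) (store s10) = Some (store s11)"
  proof -
    have s10: "m_adj s10 = ?z" "m_mass s10 = ?\<tau>" "m_dang s10 = (\<Sum>l\<in>dangling G q. forward N1 l)"
      "m_fac s10 = f" "m_new s10 = (\<lambda>_. 0)" "m_out s10 = (\<lambda>k. \<sigma> (Out k))"
      by (simp_all add: s0_def s1_def s2_def s4_def s5_def s6_def s10_def)
    have "m_damp s10 = 1 - \<alpha>" "m_total s10 = S0 / (1 - \<alpha>)" "m_tmp s10 = 0" "m_acc s10 = 0"
      "m_start s10 = (\<lambda>i. (1 - \<alpha>) * restart G F q \<phi> i)"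
      by (simp_all add: s0_def s1_def s2_def s4_def s5_def s6_def s10_def)
    from run_output_nodes[OF this] show ?thesis
      by (simp only: s10 s11_def c_def \<kappa>_def)
  qed
  define g where "g l k = (case k of Inl a \<Rightarrow> 0 | Inr b \<Rightarrow>
      \<Sum>j\<in>out_nbrs G q l. (?z j - (\<Sum>i\<in>out_nbrs G q l. scaled_transition l i * ?z i) / (1 - \<alpha>)) *
        (forward N1 l * f / (S1 l / (1 - \<alpha>))) * edge_feat F q l j $ b)" for l and k :: "'m1 + 'm2"
  have 12: "run inp (for_each (branching G q) (output_edge_row G q)) (store s11) =
    Some (store (s11\<lparr>m_out := \<lambda>k. m_out s11 k + (\<Sum>l\<in>branching G q. g l k)\<rparr>))"
  proof (rule run_for_each[where S = "\<lambda>A. store (s11\<lparr>m_out := \<lambda>k. m_out s11 k + (\<Sum>l\<in>A. g l k)\<rparr>)"])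
    fix A l
    assume A: "finite A" "l \<notin> A" and l: "l \<in> branching G q"
    let ?t = "s11\<lparr>m_out := \<lambda>k. m_out s11 k + (\<Sum>l\<in>A. g l k)\<rparr>"
    have t: "m_adj ?t = ?z" "m_cur ?t = forward N1" "m_fac ?t = f"
      by (simp_all add: s11_def s10_def s6_def s5_def s4_def)
    have "m_damp ?t = 1 - \<alpha>" "m_tmp ?t = 0" "m_acc ?t = 0" "m_mass ?t = 0" "m_dang ?t = 0"
      "m_edge ?t = scaled_transition" "m_den ?t l = S1 l / (1 - \<alpha>)"
      using l by (simp_all add: s11_def s10_def s0_def s1_def s2_def s4_def s5_def s6_def)
    note row = run_output_edge_row[OF this l]
    have "run inp (output_edge_row G q l) (store ?t) =
        Some (store (?t\<lparr>m_out := \<lambda>k. m_out ?t k + g l k\<rparr>))"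
      using row unfolding t by (simp only: g_def)
    then show "run inp (output_edge_row G q l) (store ?t) =
        Some (store (s11\<lparr>m_out := \<lambda>k. m_out s11 k + (\<Sum>l\<in>insert l A. g l k)\<rparr>))"
      using A by (simp add: add_ac)
  qed (auto simp: finite_classes intro!: store_eqI)
  have run: "run inp (query_program G N1 N2 q) \<sigma> =
      Some (store (s11\<lparr>m_out := \<lambda>k. m_out s11 k + (\<Sum>l\<in>branching G q. g l k)\<rparr>))"
    unfolding query_program_def using False 0 1 2 3 4 5 6 7 8 9 10 11 12
    by (simp only: if_False run_append bind_simps bind.bind_lunit)
  have st: "scaled_transition l i = (1 - \<alpha>) * transition G F q \<phi> l i" if "i \<in> out_nbrs G q l" for l i
    using that by (simp add: scaled_transition_def out_nbrs_iff)
  \<comment> \<open>Of the two divisions by the total in \<open>f\<close>, one belongs to the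
    initial matrix and appears in the formulas for the two kinds of parameters; multiplying by the
    total hands it back.\<close>
  have contr: "contribution N1 N2 k = f * ?\<tau> * (\<Sum>i\<in>V. mat_iter G F \<alpha> q \<phi> N1 0 i (param_basis k) * ?z i)" for k
  proof -
    have M: "(\<Sum>i\<in>V. mat_iter G F \<alpha> q \<phi> N1 0 i (param_basis k) * ?z i) =
        (\<Sum>i\<in>V. mat_iter G F \<alpha> q \<phi> N1 0 i (param_basis k) *
          trunc_series \<alpha> V (\<lambda>j i. transition G F q \<phi> i j) N2 ?h i)"
      by (intro sum.cong refl) (simp add: backward_def)
    have "contribution N1 N2 k = 2 / real (card (queries G)) * (1 / ((1 - (1 - \<alpha>) ^ (N2 + 1)) * ?\<tau>) *
        (\<Sum>i\<in>V. mat_iter G F \<alpha> q \<phi> N1 0 i (param_basis k) * ?z i))"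
      unfolding M by (simp only: contribution_def sum_mat_approx forward_def[abs_def])
    also have "\<dots> = 2 / real (card (queries G)) * (1 / ((1 - (1 - \<alpha>) ^ (N2 + 1)) * ?\<tau>)) *
        (\<Sum>i\<in>V. mat_iter G F \<alpha> q \<phi> N1 0 i (param_basis k) * ?z i)"
      by (rule mult.assoc[symmetric])
    also have "2 / real (card (queries G)) * (1 / ((1 - (1 - \<alpha>) ^ (N2 + 1)) * ?\<tau>)) = f * ?\<tau>"
      using \<tau> by (simp add: f_def)
    finally show ?thesis .
  qed
  have "(case k of Inr b \<Rightarrow> 0 | Inl a \<Rightarrow> \<Sum>j\<in>seeds G q. (?z j - c) * \<kappa> * node_feat F q j $ a) +
      (\<Sum>l\<in>branching G q. g l k) = contribution N1 N2 k" for k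
  proof (cases k)
    case (Inl a)
    have "contribution N1 N2 k = \<kappa> * (\<Sum>j\<in>seeds G q. (?z j - c) * node_feat F q j $ a)"
      unfolding contr Inl sum_mat_iter_Inl[OF \<tau> fw] c_def[symmetric] \<kappa>_def using \<tau> by simp
    then show ?thesis using Inl by (simp add: g_def sum_distrib_left mult_ac)
  next
    case (Inr b)
    have "contribution N1 N2 k = f * (\<Sum>l\<in>branching G q. \<Sum>j\<in>out_nbrs G q l.
      (?z j - (\<Sum>i\<in>out_nbrs G q l. (1 - \<alpha>) * transition G F q \<phi> l i * ?z i) / (1 - \<alpha>)) *
      (forward N1 l / (S1 l / (1 - \<alpha>))) * edge_feat F q l j $ b)"
      unfolding contr Inr sum_mat_iter_Inr[OF \<tau> fw] using \<tau> by simp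
    also have "\<dots> = (\<Sum>l\<in>branching G q. g l k)"
      unfolding sum_distrib_left Inr g_def by (intro sum.cong refl) (simp add: st mult_ac)
    finally show ?thesis using Inr by simp
  qed
  then have "store (s11\<lparr>m_out := \<lambda>k. m_out s11 k + (\<Sum>l\<in>branching G q. g l k)\<rparr>) (Out k) =
      \<sigma> (Out k) + contribution N1 N2 k" for k
    by (simp add: s11_def add.assoc)
  with run show ?thesis by blast
qed

end

section \<open>Operations and registers\<close>

text \<open>The output registers come first, at addresses that do not depend on the query.\<close>

definition address :: "('v, 'k::finite) reg set \<Rightarrow> ('v, 'k) reg \<Rightarrow> nat" where
  "address W r = (if r \<in> range Out then to_nat_on (range Out) r else CARD('k) + to_nat_on W r)"

lemma card_range_Out: "card (range (Out :: 'k::finite \<Rightarrow> ('v, 'k) reg)) = CARD('k)"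
  by (intro card_image injI) simp

lemma to_nat_on_less: "finite X \<Longrightarrow> x \<in> X \<Longrightarrow> to_nat_on X x < card X"
  using to_nat_on_finite[of X] by (auto simp: bij_betw_def)

lemma address_Out: "address (W :: ('v, 'k) reg set) (Out k) = address ({} :: ('v, 'k::finite) reg set) (Out k)"
  by (simp add: address_def)

lemma address_less:
  fixes W :: "('v, 'k::finite) reg set"
  assumes "finite W" "r \<in> W \<union> range Out"
  shows "address W r < CARD('k) + card W"
  using assms to_nat_on_less[of "range Out" r] to_nat_on_less[of W r]
  by (auto simp: address_def card_range_Out intro: trans_less_add1)

lemma inj_on_address:
  fixes W :: "('v, 'k::finite) reg set"
  assumes "finite W"
  shows "inj_on (address W) (W \<union> range Out)"
proof (rule inj_onI)
  fix r r' assume r: "r \<in> W \<union> range Out" "r' \<in> W \<union> range Out" and eq: "address W r = address W r'"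
  have less: "to_nat_on (range Out) r < CARD('k)" if "r \<in> range Out" for r :: "('v, 'k) reg"
    using to_nat_on_less[OF _ that] by (simp add: card_range_Out)
  show "r = r'"
    using r eq less[of r] less[of r'] assms inj_onD[OF inj_on_to_nat_on[of W]]
      inj_onD[OF inj_on_to_nat_on[of "range Out"]]
    by (auto simp: address_def countable_finite split: if_splits)
qed

lemma work_regs_iff:
  "Edge i j \<in> work_regs G q \<longleftrightarrow> (i, j) \<in> edges G q" "Start i \<in> work_regs G q \<longleftrightarrow> i \<in> nodes G q"
  "Cur i \<in> work_regs G q \<longleftrightarrow> i \<in> nodes G q" "New i \<in> work_regs G q \<longleftrightarrow> i \<in> nodes G q"
  "Resid i \<in> work_regs G q \<longleftrightarrow> i \<in> nodes G q" "Adj i \<in> work_regs G q \<longleftrightarrow> i \<in> nodes G q"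
  "Den i \<in> work_regs G q \<longleftrightarrow> i \<in> nodes G q" "Out k \<notin> work_regs G q"
  "Damp \<in> work_regs G q" "Total \<in> work_regs G q" "Mass \<in> work_regs G q" "Dang \<in> work_regs G q"
  "Pow \<in> work_regs G q" "Fac \<in> work_regs G q" "Tmp \<in> work_regs G q" "Acc \<in> work_regs G q"
  by (auto simp: work_regs_def)

context query_instance
begin

lemma regs_query_program:
  "regs (query_program G N1 N2 q :: ('q, 'v, 'm1, 'm2) program) \<subseteq> work_regs G q \<union> range Out"
proof -
  have [simp]: "finite V" "finite (seeds G q)" "finite (out_nbrs G q i)" "finite (in_nbrs G q i)"
    "finite (dangling G q)" "finite (branching G q)" "finite (single_out G q)" "finite (row_pairs G q)"
    "finite (work_regs G q :: ('v, 'm1 + 'm2) reg set)" for i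
    by (rule finite_nodes finite_seeds finite_out_nbrs finite_in_nbrs finite_classes finite_row_pairs finite_work_regs)+
  have node: "i \<in> seeds G q \<Longrightarrow> i \<in> V" "i \<in> dangling G q \<Longrightarrow> i \<in> V" "i \<in> branching G q \<Longrightarrow> i \<in> V"
    "i \<in> single_out G q \<Longrightarrow> i \<in> V" "(i, j) \<in> edges G q \<Longrightarrow> i \<in> V" "(i, j) \<in> edges G q \<Longrightarrow> j \<in> V" for i j
    using seeds_sub edges_sub by (auto simp: dangling_def branching_def single_out_def)
  have in_nbrs_iff: "l \<in> in_nbrs G q i \<longleftrightarrow> (l, i) \<in> edges G q" for l i by (simp add: in_nbrs_def)
  note defs = add_all_def add_products_def work_regs_iff out_nbrs_iff in_nbrs_iff
  let ?R = "work_regs G q \<union> range Out :: ('v, 'm1 + 'm2) reg set"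
  have "regs (compute_start G q :: ('q, 'v, 'm1, 'm2) program) \<subseteq> ?R"
    by (auto simp: compute_start_def defs node(1-4) split: if_splits)
  moreover have "regs (compute_edges G q :: ('q, 'v, 'm1, 'm2) program) \<subseteq> ?R"
    by (auto simp: compute_edges_def compute_edge_row_def defs node(1-4) split: if_splits)
  moreover have "regs (vec_step G q :: ('q, 'v, 'm1, 'm2) program) \<subseteq> ?R"
    by (auto simp: vec_step_def defs node(1-4) split: if_splits) (use edges_sub in blast)+
  moreover have "regs (compute_mass G q :: ('q, 'v, 'm1, 'm2) program) \<subseteq> ?R"
    by (auto simp: compute_mass_def defs node(1-4) split: if_splits)
  moreover have "regs (compute_residual G q :: ('q, 'v, 'm1, 'm2) program) \<subseteq> ?R"
    by (auto simp: compute_residual_def defs split: if_splits dest: row_pairs_dest)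
  moreover have "regs (adj_step G q :: ('q, 'v, 'm1, 'm2) program) \<subseteq> ?R"
    by (auto simp: adj_step_def defs node(1-4) split: if_splits) (use edges_sub in blast)+
  moreover have "regs (compute_factor G :: ('q, 'v, 'm1, 'm2) program) \<subseteq> ?R"
    by (auto simp: compute_factor_def work_regs_iff)
  moreover have "regs (output_nodes G q :: ('q, 'v, 'm1, 'm2) program) \<subseteq> ?R"
    by (auto simp: output_nodes_def defs node(1-4) split: if_splits)
  moreover have rows: "regs (output_edge_row G q l :: ('q, 'v, 'm1, 'm2) program) \<subseteq> ?R" if "l \<in> branching G q" for l
    using that by (auto simp: output_edge_row_def defs node(1-4) split: if_splits) (use edges_sub in blast)+
  ultimately show ?thesis
    using regs_repeat[of N1 "vec_step G q :: ('q, 'v, 'm1, 'm2) program"]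
      regs_repeat[of N2 "adj_step G q :: ('q, 'v, 'm1, 'm2) program"]
    by (auto simp: query_program_def work_regs_iff) (use rows in blast)
qed

section \<open>Counting operations and registers for one query\<close>

lemma card_edges:
  "card (edges G q) = (\<Sum>l\<in>V. card (out_nbrs G q l))" "card (edges G q) = (\<Sum>l\<in>V. card (in_nbrs G q l))"
proof -
  have "edges G q = Sigma V (out_nbrs G q)" using edges_sub by (auto simp: out_nbrs_def)
  then show "card (edges G q) = (\<Sum>l\<in>V. card (out_nbrs G q l))"
    using finite_nodes finite_out_nbrs by (metis card_SigmaI)
  have "edges G q = (\<lambda>(i, l). (l, i)) ` Sigma V (in_nbrs G q)" using edges_sub by (force simp: in_nbrs_def)
  moreover have "inj_on (\<lambda>(i, l). (l, i)) (Sigma V (in_nbrs G q))" by (auto simp: inj_on_def)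
  ultimately have "card (edges G q) = card (Sigma V (in_nbrs G q))" by (metis card_image)
  then show "card (edges G q) = (\<Sum>l\<in>V. card (in_nbrs G q l))"
    using finite_nodes finite_in_nbrs by simp
qed

lemma card_work_regs:
  "card (work_regs G q :: ('v, 'k) reg set) \<le> card (edges G q) + 6 * card V + 8"
proof -
  have "finite (edges G q)" using finite_nodes finite_subset[OF edges_sub] by auto
  then have "card (work_regs G q :: ('v, 'k) reg set) \<le>
      card (edges G q) + card V + card V + card V + card V + card V + card V + 8"
    unfolding work_regs_def
    by (intro order_trans[OF card_Un_le] add_mono card_image_le finite_nodes) simp_all
  then show ?thesis by simp
qed

lemma card_nodes_le: "card V \<le> max_nodes G"
  using wf q unfolding max_nodes_def wf_query_graphs_def by (intro Max_ge) auto

lemma card_out_nbrs_le: "l \<in> V \<Longrightarrow> card (out_nbrs G q l) \<le> max_outdegree G"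
  using wf q finite_nodes unfolding max_outdegree_def wf_query_graphs_def
  by (intro order_trans[OF Max_ge[of "(\<lambda>i. card (out_nbrs G q i)) ` V"] Max_ge]) auto

lemma dangling_sub: "dangling G q \<subseteq> V" by (auto simp: dangling_def)

text \<open>Dangling nodes must be left out of the product: each costs an extra addition in a vector
  step, to be paid from the edges it does not have.\<close>

lemma card_edges_le: "card (edges G q) \<le> (card V - card (dangling G q)) * max_outdegree G"
proof -
  have "card (edges G q) = (\<Sum>l\<in>V - dangling G q. card (out_nbrs G q l))"
    unfolding card_edges(1) using finite_nodes by (intro sum.mono_neutral_right) (auto simp: dangling_def)
  also have "\<dots> \<le> of_nat (card (V - dangling G q)) * max_outdegree G"
    by (rule sum_bounded_above) (auto intro: card_out_nbrs_le)
  finally show ?thesis using card_Diff_subset[OF finite_classes(1) dangling_sub] by simp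
qed

text \<open>A node with outgoing edges is charged 1 + 2s \<le> 3s operations, a dangling one 2 \<le>
  3s.\<close>

lemma ops_vec_step:
  assumes "1 \<le> max_outdegree G"
  shows "ops (vec_step G q :: ('q, 'v, 'm1, 'm2) program) \<le> 3 * max_nodes G * max_outdegree G"
proof -
  let ?s = "max_outdegree G" and ?d = "card (dangling G q)"
  obtain e where e: "card V = e + ?d"
    using card_mono[OF finite_nodes dangling_sub] by (metis le_add_diff_inverse2)
  have "ops (vec_step G q :: ('q, 'v, 'm1, 'm2) program) = ?d + card V + 2 * card (edges G q)"
    by (simp add: vec_step_def finite_classes finite_nodes finite_in_nbrs card_edges(2) sum_Suc sum_distrib_left)
  also have "\<dots> \<le> ?d + card V + 2 * (e * ?s)" using card_edges_le e by simp
  also have "\<dots> \<le> 3 * (card V * ?s)"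
  proof -
    have "e \<le> e * ?s" "?d \<le> ?d * ?s" using assms by simp_all
    moreover have "card V * ?s = e * ?s + ?d * ?s" by (simp add: e distrib_right)
    ultimately show ?thesis using e by linarith
  qed
  also have "\<dots> \<le> 3 * (max_nodes G * ?s)" using card_nodes_le by simp
  finally show ?thesis by simp
qed

text \<open>Dot product, dangling additions and the update of the power cost at most 4n beyond the
  2ns for edges, where n is the number of nodes. The total 6ns fits because m is at least 2; a
  single backward vector leaves this slack.\<close>

lemma ops_adj_step:
  assumes "1 \<le> max_outdegree G" "2 \<le> m"
  shows "ops (adj_step G q :: ('q, 'v, 'm1, 'm2) program) \<le> 3 * m * max_nodes G * max_outdegree G"
proof -
  let ?s = "max_outdegree G" and ?d = "card (dangling G q)"
  have n: "1 \<le> card V" using seeds_nonempty seeds_sub finite_nodes by (auto simp: Suc_le_eq card_gt_0_iff)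
  have d: "?d \<le> card V" by (rule card_mono[OF finite_nodes dangling_sub])
  have "(\<Sum>l\<in>V. ops (if l \<in> dangling G q then [Apply (New l) Add (SReg (Resid l)) (SReg Acc)]
       else Load (New l) (SReg (Resid l)) #
         add_products Tmp (New l) (out_nbrs G q l) (\<lambda>j. SReg (Edge l j)) (\<lambda>j. SReg (Adj j)) :: ('q, 'v, 'm1, 'm2) program)) \<le>
      (\<Sum>l\<in>V. (if l \<in> dangling G q then 1 else 0) + 2 * card (out_nbrs G q l))"
    by (intro sum_mono) (auto simp: finite_out_nbrs)
  also have "\<dots> = ?d + 2 * card (edges G q)"
    using finite_nodes by (simp add: sum.distrib sum_distrib_left card_edges(1) Int_absorb1[OF dangling_sub] sum.If_cases)
  finally have "ops (adj_step G q :: ('q, 'v, 'm1, 'm2) program) \<le> 2 * card V + (?d + 2 * card (edges G q)) + 1"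
    by (simp add: adj_step_def finite_nodes)
  also have "\<dots> \<le> 4 * card V + 2 * (card V * ?s)"
  proof -
    have "card (edges G q) \<le> card V * ?s" by (rule order_trans[OF card_edges_le]) simp
    then show ?thesis using n d by linarith
  qed
  also have "\<dots> \<le> 6 * (card V * ?s)" using mult_le_mono2[OF assms(1), of "card V"] by simp
  also have "\<dots> \<le> 3 * m * (max_nodes G * ?s)" using card_nodes_le assms(2) by (intro mult_le_mono) auto
  finally show ?thesis by (simp add: mult.assoc)
qed

lemma two_nodes: "row_pairs G q \<noteq> {} \<Longrightarrow> 2 \<le> card V"
proof -
  assume "row_pairs G q \<noteq> {}"
  then obtain \<rho> where "\<rho> \<in> row_pairs G q" by blast
  note \<rho> = row_pairs_dest[OF this]
  then have "card {fst \<rho>, snd \<rho>} \<le> card V" by (intro card_mono finite_nodes) auto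
  with \<rho>(3) show ?thesis by simp
qed

text \<open>Pure arithmetic for the non-iterated phases: \<open>u\<close> seeds, \<open>a\<close>
  branching nodes, \<open>e\<close> edges leaving them, \<open>r\<close> rows. The tight case is s =
  1.\<close>

lemma ops_once_bound:
  fixes n s p m1 m2 u a e r R :: nat
  assumes "2 \<le> n" "n \<le> p" "u \<le> n" "1 \<le> s" "1 \<le> m1" "1 \<le> m2" "1 \<le> r" "r \<le> R"
    and a: "2 * a \<le> e" "e \<le> a * s" "a \<le> n"
  shows "13 + 4 * u + 3 * n + 4 * (u * m1) + e * (6 + 4 * m2) + 4 * a + 4 * r \<le> 10 * (m1 + m2) * p * s + 7 * R"
proof -
  have "u * m1 \<le> n * m1" using assms by simp
  have m: "n * s \<le> m1 * (n * s)" "n * s \<le> m2 * (n * s)" using assms by simp_all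
  have ns: "n \<le> n * s" using assms by simp
  \<comment> \<open>The 3 on the right is what 7R leaves after 4r, as there is at least one row; the
    remaining constant 10 is absorbed using n \<ge> 2.\<close>
  have "13 + 7 * n + 4 * (n * m1) + e * (6 + 4 * m2) + 4 * a \<le> 10 * (m1 * (n * s)) + 10 * (m2 * (n * s)) + 3"
  proof (cases "s = 1")
    \<comment> \<open>With s = 1 the bounds 2a \<le> e \<le> a leave no branching node, and every
      edge is free.\<close>
    case True
    with a have "a = 0" "e = 0" by simp_all
    moreover have "n \<le> m1 * n" "n \<le> m2 * n" using assms by simp_all
    then have "13 + 7 * n + 4 * (m1 * n) \<le> 10 * (m1 * n) + 10 * (m2 * n) + 3"
      using assms(1) by linarith
    ultimately show ?thesis using True by (simp add: mult.commute)
  next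
    case False
    with assms have "2 \<le> s" by simp
    then have 1: "2 * n \<le> n * s" by simp
    then have 2: "2 * (n * m1) \<le> m1 * (n * s)" using mult_le_mono2[of "2 * n" "n * s" m1] by (simp add: mult_ac)
    have 3: "e \<le> n * s" using a by (meson mult_le_mono1 order_trans)
    then have 4: "e * m2 \<le> m2 * (n * s)" by simp
    have "e * (6 + 4 * m2) = 6 * e + 4 * (e * m2)" by (simp add: algebra_simps)
    with 1 2 3 4 m a(1) assms(1) show ?thesis by linarith
  qed
  moreover have "m1 * (n * s) \<le> m1 * (p * s)" "m2 * (n * s) \<le> m2 * (p * s)" using assms by simp_all
  ultimately have "13 + 4 * u + 3 * n + 4 * (u * m1) + e * (6 + 4 * m2) + 4 * a + 4 * r \<le>
      10 * (m1 * (p * s)) + 10 * (m2 * (p * s)) + 7 * R"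
    using \<open>u * m1 \<le> n * m1\<close> assms(3,7,8) by linarith
  then show ?thesis by (simp add: algebra_simps)
qed

lemma ops_query_program:
  assumes s: "1 \<le> max_outdegree G" and m: "m = CARD('m1) + CARD('m2)"
  shows "ops (query_program G N1 N2 q :: ('q, 'v, 'm1, 'm2) program) \<le>
    10 * m * max_nodes G * max_outdegree G + 3 * max_nodes G * max_outdegree G * N1 +
    3 * m * max_nodes G * max_outdegree G * N2 + 7 * max_rows G"
proof (cases "row_pairs G q = {}")
  case True
  then show ?thesis by (simp add: query_program_def)
next
  case False
  let ?P = "\<lambda>c :: ('q, 'v, 'm1, 'm2) program. ops c"
  define u a e where "u = card (seeds G q)" and "a = card (branching G q)"
    and "e = (\<Sum>l\<in>branching G q. card (out_nbrs G q l))"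
  have card_m: "1 \<le> CARD('m1)" "1 \<le> CARD('m2)" by (simp_all add: Suc_le_eq)
  have br: "branching G q \<subseteq> V" by (auto simp: branching_def)
  have "e \<le> of_nat (card (branching G q)) * max_outdegree G"
    unfolding e_def using br by (intro sum_bounded_above) (auto intro: card_out_nbrs_le)
  then have e_le: "e \<le> a * max_outdegree G" by (simp add: a_def)
  have "of_nat (card (branching G q)) * 2 \<le> e"
    unfolding e_def by (rule sum_bounded_below) (simp add: branching_def)
  then have a_le: "2 * a \<le> e" by (simp add: a_def)
  have start: "?P (compute_start G q) = 2 + 2 * u + 2 * (u * CARD('m1))"
    by (simp add: compute_start_def finite_seeds u_def)
  have edges: "?P (compute_edges G q) = e * (2 + 2 * CARD('m2)) + a"
    by (simp add: compute_edges_def compute_edge_row_def finite_classes finite_out_nbrs e_def a_def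
        sum_Suc sum.distrib sum_distrib_left[symmetric] sum_distrib_right[symmetric] algebra_simps)
  have mass: "?P (compute_mass G q) = card V"
    using card_mono[OF finite_nodes dangling_sub]
    by (simp add: compute_mass_def finite_classes finite_nodes card_Diff_subset[OF finite_classes(1) dangling_sub])
  have resid: "?P (compute_residual G q) = 4 * card (row_pairs G q)"
    by (simp add: compute_residual_def finite_row_pairs)
  have factor: "?P (compute_factor G) = 5" by (simp add: compute_factor_def)
  have out1: "?P (output_nodes G q) = 2 * card V + 6 + 2 * u + 2 * (u * CARD('m1))"
    by (simp add: output_nodes_def finite_nodes finite_seeds u_def)
  have out2: "(\<Sum>l\<in>branching G q. ?P (output_edge_row G q l)) = e * (4 + 2 * CARD('m2)) + 3 * a"
    by (simp add: output_edge_row_def finite_classes finite_out_nbrs e_def a_def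
        sum_Suc sum.distrib sum_distrib_left[symmetric] sum_distrib_right[symmetric] algebra_simps)
  \<comment> \<open>The constant 13 collects 2 scalar operations of the start phase, 5 of the factor
    and 6 of the node output.\<close>
  have once: "13 + 4 * u + 3 * card V + 4 * (u * CARD('m1)) + e * (6 + 4 * CARD('m2)) + 4 * a +
      4 * card (row_pairs G q) \<le> 10 * (CARD('m1) + CARD('m2)) * max_nodes G * max_outdegree G + 7 * max_rows G"
  proof (rule ops_once_bound)
    show "1 \<le> card (row_pairs G q)" using False finite_row_pairs by (simp add: Suc_le_eq card_gt_0_iff)
  qed (use card_m s a_le e_le two_nodes[OF False] card_nodes_le card_row_pairs[OF wf q]
      card_mono[OF finite_nodes seeds_sub] card_mono[OF finite_nodes br] in \<open>simp_all add: u_def a_def\<close>)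
  have vec: "N1 * ?P (vec_step G q) \<le> 3 * max_nodes G * max_outdegree G * N1"
    using mult_le_mono2[OF ops_vec_step[OF s], of N1] by (simp add: mult.commute)
  have adj: "N2 * ?P (adj_step G q) \<le> 3 * m * max_nodes G * max_outdegree G * N2"
    using mult_le_mono2[OF ops_adj_step[OF s, of m], of N2] card_m m by (simp add: mult.commute)
  have "?P (query_program G N1 N2 q) = ?P (compute_start G q) + ?P (compute_edges G q) + N1 * ?P (vec_step G q) +
      ?P (compute_mass G q) + ?P (compute_residual G q) + N2 * ?P (adj_step G q) + ?P (compute_factor G) +
      ?P (output_nodes G q) + (\<Sum>l\<in>branching G q. ?P (output_edge_row G q l))"
    using False by (simp add: query_program_def finite_work_regs finite_nodes finite_classes)
  also have "\<dots> = (13 + 4 * u + 3 * card V + 4 * (u * CARD('m1)) + e * (6 + 4 * CARD('m2)) + 4 * a +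
      4 * card (row_pairs G q)) + N1 * ?P (vec_step G q) + N2 * ?P (adj_step G q)"
    unfolding start edges mass resid factor out1 out2 by (simp add: algebra_simps)
  finally show ?thesis using once[folded m] vec adj by linarith
qed

text \<open>Needed are m outputs, one register per edge, six node vectors and eight scalars. Since p
  \<ge> 2, the scalars fit into 4p; then m + 10p is covered by 3ps + 4mp, using m \<ge> 2 and s
  \<ge> 1.\<close>

lemma work_regs_fit:
  assumes s: "1 \<le> max_outdegree G" and m: "2 \<le> m" and rows: "row_pairs G q \<noteq> {}"
  shows "m + card (work_regs G q :: ('v, 'k) reg set) \<le>
    4 * max_nodes G * max_outdegree G + 4 * m * max_nodes G + max_rows G"
proof -
  let ?p = "max_nodes G" and ?s = "max_outdegree G"
  have p: "2 \<le> ?p" using two_nodes[OF rows] card_nodes_le by linarith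
  have "card (edges G q) \<le> card V * ?s" by (rule order_trans[OF card_edges_le]) simp
  then have e: "card (edges G q) \<le> ?p * ?s" using card_nodes_le by (meson mult_le_mono1 order_trans)
  have "1 \<le> card (row_pairs G q)" using rows finite_row_pairs by (simp add: Suc_le_eq card_gt_0_iff)
  then have R: "1 \<le> max_rows G" using card_row_pairs[OF wf q] by linarith
  have 1: "?p \<le> ?p * ?s" using s by simp
  have 2: "2 * ?p \<le> m * ?p" "2 * m \<le> m * ?p" using m p by simp_all
  have "m + (card (edges G q) + 6 * card V + 8) \<le> 4 * (?p * ?s) + 4 * (m * ?p) + max_rows G"
    using e R 1 2 p card_nodes_le by linarith
  then show ?thesis using card_work_regs[where 'k = 'k] by (simp add: mult.assoc order_trans)
qed

end

section \<open>Concatenating the queries\<close>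

lemma arith_ops_append [simp]: "arith_ops (cs @ ds) = arith_ops cs + arith_ops ds"
  by (simp add: arith_ops_def)

definition query_code ::
  "('q, 'v) query_graphs \<Rightarrow> nat \<Rightarrow> nat \<Rightarrow> 'q \<Rightarrow> ('q, 'v, 'm1::finite, 'm2::finite) input instr list" where
  "query_code G N1 N2 q = map (place (address (work_regs G q))) (query_program G N1 N2 q)"

text \<open>Outputs are cleared once and every query adds its share, already scaled by 2 / |Q|. Each
  nonempty query program clears its own work registers first, so all queries share the same
  memory.\<close>

definition gradient_code ::
  "('q, 'v) query_graphs \<Rightarrow> nat \<Rightarrow> nat \<Rightarrow> ('q, 'v, 'm1::finite, 'm2::finite) input instr list" where
  "gradient_code G N1 N2 =
     map (place (address {} :: ('v, 'm1 + 'm2) reg \<Rightarrow> nat)) (clear (range Out)) @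
     concat (map (query_code G N1 N2) (enum (queries G)))"

context query_instance
begin

lemma exec_query_code:
  "\<exists>mem'. exec inp (query_code G N1 N2 q) mem = Some mem' \<and>
    (\<forall>k. mem' (address ({} :: ('v, 'm1 + 'm2) reg set) (Out k)) =
      mem (address ({} :: ('v, 'm1 + 'm2) reg set) (Out k)) + contribution N1 N2 k)"
proof -
  let ?W = "work_regs G q :: ('v, 'm1 + 'm2) reg set"
  let ?A = "?W \<union> range Out"
  define \<sigma> where "\<sigma> r = (if r \<in> ?A then mem (address ?W r) else 0)" for r
  obtain \<sigma>' where run: "run inp (query_program G N1 N2 q) \<sigma> = Some \<sigma>'"
    and \<sigma>': "\<And>k. \<sigma>' (Out k) = \<sigma> (Out k) + contribution N1 N2 k"
    using run_query_program[of \<sigma> N1 N2] by (auto simp: \<sigma>_def)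
  have "\<exists>mem'. exec inp (map (place (address ?W)) (query_program G N1 N2 q)) mem = Some mem' \<and>
      (\<forall>r\<in>?A. mem' (address ?W r) = \<sigma>' r)"
    by (rule exec_place[OF inj_on_address[OF finite_work_regs] regs_query_program _ run]) (simp add: \<sigma>_def)
  then obtain mem' where "exec inp (map (place (address ?W)) (query_program G N1 N2 q)) mem = Some mem'"
    and "\<And>r. r \<in> ?A \<Longrightarrow> mem' (address ?W r) = \<sigma>' r" by blast
  moreover from this(2)[of "Out k" for k]
  have "mem' (address ?W (Out k)) = mem (address ?W (Out k)) + contribution N1 N2 k" for k
    by (simp add: \<sigma>' \<sigma>_def)
  ultimately show ?thesis unfolding query_code_def address_Out[of ?W] by blast
qed

lemma query_code_regs:
  assumes "1 \<le> max_outdegree G"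
  shows "(\<Union>c\<in>set (query_code G N1 N2 q :: ('q, 'v, 'm1, 'm2) input instr list). instr_regs c) \<subseteq>
    {..<4 * max_nodes G * max_outdegree G + 4 * (CARD('m1) + CARD('m2)) * max_nodes G + max_rows G}"
proof (cases "row_pairs G q = {}")
  case True
  then show ?thesis by (simp add: query_code_def query_program_def)
next
  case False
  let ?W = "work_regs G q :: ('v, 'm1 + 'm2) reg set"
  have "2 \<le> CARD('m1) + CARD('m2)"
    using zero_less_card_finite[where 'a = 'm1] zero_less_card_finite[where 'a = 'm2] by linarith
  from work_regs_fit[OF assms this False, where 'k = "'m1 + 'm2"]
  have fit: "CARD('m1 + 'm2) + card ?W \<le>
      4 * max_nodes G * max_outdegree G + 4 * (CARD('m1) + CARD('m2)) * max_nodes G + max_rows G" by simp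
  have "address ?W ` regs (query_program G N1 N2 q :: ('q, 'v, 'm1, 'm2) program) \<subseteq> address ?W ` (?W \<union> range Out)"
    by (rule image_mono) (rule regs_query_program)
  also have "\<dots> \<subseteq> {..<CARD('m1 + 'm2) + card ?W}"
    using address_less[OF finite_work_regs] by blast
  finally show ?thesis
    unfolding query_code_def instr_regs_place_list using fit by force
qed

end

lemma gradient_code_correct:
  fixes G :: "('q, 'v) query_graphs" and F :: "('q, 'v, 'm1::finite, 'm2::finite) features"
    and mem :: "nat \<Rightarrow> real"
  assumes inst: "\<And>q. q \<in> queries G \<Longrightarrow> query_instance G F \<alpha> q \<phi>" and fin: "finite (queries G)"
  shows "\<exists>mem'. exec (data_input (F, \<phi>, \<alpha>)) (gradient_code G N1 N2) mem = Some mem' \<and>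
    (\<forall>k. mem' (address ({} :: ('v, 'm1 + 'm2) reg set) (Out k)) = coord (approx_gradient G F \<alpha> \<phi> N1 N2) k)"
proof -
  let ?inp = "data_input (F, \<phi>, \<alpha>)" and ?addr = "\<lambda>k. address ({} :: ('v, 'm1 + 'm2) reg set) (Out k)"
  let ?c = "\<lambda>q k. 2 / real (card (queries G)) * (\<Sum>i\<in>nodes G q. mat_approx G F \<alpha> q \<phi> N1 N2 i (param_basis k) *
        residual_pullback G q (vec_approx G F \<alpha> q \<phi> N1) i)"
  have "\<exists>mem'. exec ?inp (concat (map (query_code G N1 N2) qs)) mem = Some mem' \<and>
      (\<forall>k. mem' (?addr k) = mem (?addr k) + (\<Sum>q\<leftarrow>qs. ?c q k))" if "set qs \<subseteq> queries G" for qs mem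
    using that
  proof (induction qs arbitrary: mem)
    case (Cons q qs)
    interpret query_instance G F \<alpha> q \<phi> using Cons.prems by (intro inst) simp
    obtain mem1 where "exec ?inp (query_code G N1 N2 q) mem = Some mem1"
      "\<And>k. mem1 (?addr k) = mem (?addr k) + ?c q k"
      using exec_query_code[of N1 N2 mem] unfolding contribution_def by blast
    with Cons.IH[of mem1] Cons.prems show ?case by (auto simp: exec_append add.assoc)
  qed simp
  note all = this
  let ?O = "range Out :: ('v, 'm1 + 'm2) reg set"
  have "\<exists>mem'. exec ?inp (map (place (address ({} :: ('v, 'm1 + 'm2) reg set))) (clear ?O)) mem = Some mem' \<and>
      (\<forall>r\<in>?O. mem' (address {} r) = 0)"
    using exec_place[where A = ?O and cs = "clear ?O" and \<rho> = "address {}" and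
        \<sigma> = "\<lambda>r. mem (address {} r)" and \<sigma>' = "\<lambda>r. if r \<in> ?O then 0 else mem (address {} r)" and inp = ?inp and mem = mem]
      inj_on_address[of "{} :: ('v, 'm1 + 'm2) reg set"]
    by (simp add: run_clear)
  then obtain mem0 where mem0: "exec ?inp (map (place (address ({} :: ('v, 'm1 + 'm2) reg set))) (clear ?O)) mem = Some mem0"
    "\<And>k. mem0 (?addr k) = 0" by blast
  obtain mem1 where mem1: "exec ?inp (concat (map (query_code G N1 N2) (enum (queries G)))) mem0 = Some mem1"
    "\<And>k. mem1 (?addr k) = mem0 (?addr k) + (\<Sum>q\<leftarrow>enum (queries G). ?c q k)"
    using all[of "enum (queries G)" mem0] enum[OF fin] by auto
  have "(\<Sum>q\<leftarrow>enum (queries G). ?c q k) = coord (approx_gradient G F \<alpha> \<phi> N1 N2) k" for k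
    unfolding coord_eq_inner approx_gradient_inner[OF param_basis_Basis] sum_distrib_left
    using enum[OF fin] by (simp add: sum_list_distinct_conv_sum_set sum_distrib_left)
  with mem0 mem1 show ?thesis by (simp add: gradient_code_def exec_append)
qed

theorem lemma2p2:
  fixes G :: "('q, 'v) query_graphs"
    and F :: "('q, 'v, 'm1::finite, 'm2::finite) features"
    and \<alpha> \<beta>\<^sub>1 \<delta>\<^sub>2 R :: real
    and \<phi> \<phi>\<^sub>0 :: "('m1, 'm2) param"
    and \<Phi> :: "('m1, 'm2) param set"
    and m p s r N\<^sub>1 N\<^sub>2 :: nat
  assumes graphs: "wf_query_graphs G"
    and features: "nonneg_features G F"
    and damping: "0 < \<alpha>" "\<alpha> < 1"
    and radius: "0 < R"
    and Phi: "\<Phi> = {\<psi>. norm (\<psi> - \<phi>\<^sub>0) \<le> R}"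
    and Phi_pos: "\<forall>\<psi>\<in>\<Phi>. \<forall>k. 0 < coord \<psi> k"
    and denominators: "\<forall>\<psi>\<in>\<Phi>. nonzero_denominators G F \<psi>"
    and phi: "\<phi> \<in> \<Phi>"
    and sizes: "m = CARD('m1) + CARD('m2)" "p = max_nodes G" "s = max_outdegree G" "r = max_rows G"
    and beta: "\<forall>\<psi>\<in>\<Phi>. \<forall>q\<in>queries G.
        \<alpha> * matrix_norm1 (nodes G q) Basis (param_jacobian (restart G F q) \<psi>) +
        (1 - \<alpha>) * (\<Sum>i\<in>nodes G q.
           matrix_norm1 (nodes G q) Basis (param_jacobian (\<lambda>\<theta>. transition G F q \<theta> i) \<psi>)) \<le> \<beta>\<^sub>1"
    and delta: "0 < \<delta>\<^sub>2"
    and N1: "N\<^sub>1 = nat (\<lceil>1 / \<alpha> * ln (24 * \<beta>\<^sub>1 * real r / (\<alpha> * \<delta>\<^sub>2))\<rceil> - 1)"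
    and N2: "N\<^sub>2 = nat (\<lceil>1 / \<alpha> * ln (8 * \<beta>\<^sub>1 * real r / (\<alpha> * \<delta>\<^sub>2))\<rceil> - 1)"
  shows "infnorm (approx_gradient G F \<alpha> \<phi> N\<^sub>1 N\<^sub>2 - gradient (loss G F \<alpha>) \<phi>) \<le> \<delta>\<^sub>2 \<and>
    (1 \<le> s \<longrightarrow>
     computable_within
       (card (queries G) * (10 * m * p * s + 3 * p * s * N\<^sub>1 + 3 * m * p * s * N\<^sub>2 + 7 * r))
       (4 * p * s + 4 * m * p + r)
       (admissible_data G :: ('q, 'v, 'm1, 'm2) num_data set)
       data_input
       (\<lambda>(F', \<phi>', \<alpha>'). coord (approx_gradient G F' \<alpha>' \<phi>' N\<^sub>1 N\<^sub>2)))"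
proof (intro conjI impI)
  have inst: "query_instance G F \<alpha> q \<phi>" if "q \<in> queries G" for q
    using that graphs features damping Phi_pos denominators phi by (simp add: query_instance_def)
  show "infnorm (approx_gradient G F \<alpha> \<phi> N\<^sub>1 N\<^sub>2 - gradient (loss G F \<alpha>) \<phi>) \<le> \<delta>\<^sub>2"
    by (rule approx_gradient_error[OF inst graphs damping delta _ sizes(4) N1 N2]) (use beta phi in auto)
next
  assume s: "1 \<le> s"
  have inst: "query_instance G F \<alpha> q \<phi>" if "q \<in> queries G" for q
    using that graphs features damping Phi_pos denominators phi by (simp add: query_instance_def)
  have fin: "finite (queries G)" and ne: "queries G \<noteq> {}" using graphs by (auto simp: wf_query_graphs_def)
  let ?O = "range Out :: ('v, 'm1 + 'm2) reg set"
  let ?addr = "\<lambda>k. address ({} :: ('v, 'm1 + 'm2) reg set) (Out k)"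
  let ?code = "gradient_code G N\<^sub>1 N\<^sub>2 :: ('q, 'v, 'm1, 'm2) input instr list"
  let ?B = "10 * m * p * s + 3 * p * s * N\<^sub>1 + 3 * m * p * s * N\<^sub>2 + 7 * r"
  let ?M = "4 * p * s + 4 * m * p + r"
  have "arith_ops (concat (map (query_code G N\<^sub>1 N\<^sub>2 :: _ \<Rightarrow> ('q, 'v, 'm1, 'm2) input instr list) qs)) \<le> length qs * ?B"
    if "set qs \<subseteq> queries G" for qs
    using that
  proof (induction qs)
    case Nil
    then show ?case by (simp add: arith_ops_def)
  next
    case (Cons q qs)
    \<comment> \<open>The count concerns the graphs alone; the given data serve to enter the
      locale.\<close>
    then interpret query_instance G F \<alpha> q \<phi> by (intro inst) simp
    have "arith_ops (query_code G N\<^sub>1 N\<^sub>2 q :: ('q, 'v, 'm1, 'm2) input instr list) \<le> ?B"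
      unfolding query_code_def arith_ops_place sizes using ops_query_program[OF _ refl] s sizes by simp
    with Cons show ?case by simp
  qed
  from this[of "enum (queries G)"] have ops: "arith_ops ?code \<le> card (queries G) * ?B"
    using enum[OF fin] distinct_card[of "enum (queries G)"] by (simp add: gradient_code_def arith_ops_place)
  have out: "address {} ` ?O \<subseteq> {..<?M}"
  proof -
    obtain q where q: "q \<in> queries G" using ne by blast
    interpret query_instance G F \<alpha> q \<phi> by (rule inst[OF q])
    \<comment> \<open>If no query has rows, nothing but the outputs is stored; they fit because a
      seed set is nonempty and hence p \<ge> 1.\<close>
    have "1 \<le> card (nodes G q)" using seeds_nonempty seeds_sub finite_nodes by (auto simp: Suc_le_eq card_gt_0_iff)
    then have "1 \<le> p" using card_nodes_le sizes(2) by linarith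
    then have "m \<le> m * p" by simp
    then have "m \<le> ?M" by linarith
    show ?thesis
    proof (rule image_subsetI)
      fix r assume "r \<in> ?O"
      then have "address {} r < m" using address_less[of "{}" r] sizes(1) by simp
      with \<open>m \<le> ?M\<close> show "address {} r \<in> {..<?M}" by (simp only: lessThan_iff order_less_le_trans)
    qed
  qed
  have regs: "(\<Union>c\<in>set ?code. instr_regs c) \<subseteq> {..<?M}"
  proof -
    have "(\<Union>c\<in>set (query_code G N\<^sub>1 N\<^sub>2 q :: ('q, 'v, 'm1, 'm2) input instr list). instr_regs c) \<subseteq> {..<?M}"
      if "q \<in> queries G" for q
      using query_instance.query_code_regs[OF inst[OF that]] s unfolding sizes by blast
    then have "(\<Union>c\<in>set (concat (map (query_code G N\<^sub>1 N\<^sub>2) (enum (queries G))) :: ('q, 'v, 'm1, 'm2) input instr list).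
        instr_regs c) \<subseteq> {..<?M}"
      using enum[OF fin] by fastforce
    moreover have "(\<Union>c\<in>set (map (place (address {})) (clear ?O) :: ('q, 'v, 'm1, 'm2) input instr list). instr_regs c) \<subseteq> {..<?M}"
      unfolding instr_regs_place_list using out by simp
    ultimately show ?thesis unfolding gradient_code_def set_append UN_Un by blast
  qed
  have inj: "inj ?addr"
    using inj_on_address[of "{} :: ('v, 'm1 + 'm2) reg set"] by (auto simp: inj_on_def)
  have correct: "\<forall>d\<in>admissible_data G. \<forall>mem. \<exists>mem'. exec (data_input d) ?code mem = Some mem' \<and>
      (\<forall>k. mem' (?addr k) = (case d of (F', \<phi>', \<alpha>') \<Rightarrow> coord (approx_gradient G F' \<alpha>' \<phi>' N\<^sub>1 N\<^sub>2)) k)"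
  proof (intro ballI allI)
    fix d :: "('q, 'v, 'm1, 'm2) num_data" and mem :: "nat \<Rightarrow> real"
    assume "d \<in> admissible_data G"
    then obtain F' \<phi>' \<alpha>' where d: "d = (F', \<phi>', \<alpha>')" and adm: "nonneg_features G F'" "\<forall>k. 0 < coord \<phi>' k"
      "nonzero_denominators G F' \<phi>'" "0 < \<alpha>'" "\<alpha>' < 1" by (auto simp: admissible_data_def)
    have "query_instance G F' \<alpha>' q \<phi>'" if "q \<in> queries G" for q
      using that adm graphs by (simp add: query_instance_def)
    from gradient_code_correct[OF this fin] show "\<exists>mem'. exec (data_input d) ?code mem = Some mem' \<and>
      (\<forall>k. mem' (?addr k) = (case d of (F', \<phi>', \<alpha>') \<Rightarrow> coord (approx_gradient G F' \<alpha>' \<phi>' N\<^sub>1 N\<^sub>2)) k)"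
      unfolding d prod.case .
  qed
  show "computable_within (card (queries G) * ?B) ?M (admissible_data G :: ('q, 'v, 'm1, 'm2) num_data set)
      data_input (\<lambda>(F', \<phi>', \<alpha>'). coord (approx_gradient G F' \<alpha>' \<phi>' N\<^sub>1 N\<^sub>2))"
    unfolding computable_within_def
  proof (intro exI conjI)
    show "arith_ops ?code \<le> card (queries G) * ?B" by (rule ops)
    show "(\<Union>c\<in>set ?code. instr_regs c) \<union> range ?addr \<subseteq> {..<?M}" using regs out by blast
  qed (use inj correct in blast)+
qed

end
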